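(* Let $\mathcal{E}$ be the Cantor set, let $x\in\mathcal{E}$, and let $G$ be the group of all homeomorphisms of $\mathcal{E}$ fixing the point $x$. Then the universal minimal flow of $G$ is the space of all maximal chains of closed subsets of $\mathcal{E}$ containing $\{x\}$ (as an element of the chain).
   Context: The homeomorphism group of $\mathcal{E}$ carries the compact-open topology (equivalently, pointwise convergence on the algebra of clopen subsets), and $G$ the subspace topology. For a compact space $X$, $\exp X$ is the space of nonempty closed subsets of $X$ with the Vietoris topology; maximal chains (with respect to inclusion) of closed subsets of $X$ form a closed subspace $\Phi(X)$ of $\exp\exp X$. The space in the claim is the subspace $\{\mathcal{M}\in\Phi(\mathcal{E}):\{x\}\in\mathcal{M}\}$, on which $G$ acts by $g\mathcal{M}=\{g(M):M\in\mathcal{M}\}$. For a topological group $G$, a $G$-flow is a continuous action of $G$ on a compact Hausdorff space; the universal minimal flow is the (unique up to isomorphism of $G$-flows) minimal $G$-flow having every minimal $G$-flow as a factor. "Is" means isomorphic as $G$-flows. *)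

theory Defs
  imports "HOL-Analysis.Analysis" "HOL-Algebra.Group_Action"
begin

section \<open>Topological groups and flows\<close>

locale topological_group = group G for G (structure) +
  fixes T :: "'g topology"
  assumes topspace_eq_carrier: "topspace T = carrier G"
    and continuous_mult: "continuous_map (prod_topology T T) T (\<lambda>(g, h). g \<otimes> h)"
    and continuous_inv: "continuous_map T T (\<lambda>g. inv g)"

locale flow = topological_group G T + group_action G "topspace X" \<phi>
  for G (structure) and T and X :: "'p topology" and \<phi> +
  assumes compact: "compact_space X"
    and Hausdorff: "Hausdorff_space X"
    and continuous_action: "continuous_map (prod_topology T X) X (\<lambda>(g, p). \<phi> g p)"

locale minimal_flow = flow +
  assumes nonempty: "topspace X \<noteq> {}"
    and minimal: "\<lbrakk>closedin X A; A \<noteq> {}; \<And>g. g \<in> carrier G \<Longrightarrow> \<phi> g ` A \<subseteq> A\<rbrakk> \<Longrightarrow> A = topspace X"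

text \<open>The flow \<open>(Y, \<psi>)\<close> is a factor of the flow \<open>(X, \<phi>)\<close>.\<close>

definition flow_factor ::
  "('g, 'm) monoid_scheme \<Rightarrow> 'p topology \<Rightarrow> ('g \<Rightarrow> 'p \<Rightarrow> 'p) \<Rightarrow>
     'q topology \<Rightarrow> ('g \<Rightarrow> 'q \<Rightarrow> 'q) \<Rightarrow> bool"
  where "flow_factor G X \<phi> Y \<psi> \<longleftrightarrow>
    (\<exists>\<pi>. continuous_map X Y \<pi> \<and> \<pi> ` topspace X = topspace Y \<and>
      (\<forall>g \<in> carrier G. \<forall>p \<in> topspace X. \<pi> (\<phi> g p) = \<psi> g (\<pi> p)))"

text \<open>HOL cannot quantify over types inside a formula, so the type carrying the minimal flows that
  are tested for being factors is a parameter. A theorem in which this type is a free type variable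
  ranges over all minimal flows.\<close>

definition universal_minimal_flow ::
  "'q itself \<Rightarrow> ('g, 'm) monoid_scheme \<Rightarrow> 'g topology \<Rightarrow> 'p topology \<Rightarrow> ('g \<Rightarrow> 'p \<Rightarrow> 'p) \<Rightarrow> bool"
  where "universal_minimal_flow (_ :: 'q itself) G T X \<phi> \<longleftrightarrow>
    minimal_flow G T X \<phi> \<and>
    (\<forall>(Y :: 'q topology) \<psi>. minimal_flow G T Y \<psi> \<longrightarrow> flow_factor G X \<phi> Y \<psi>)"

section \<open>Homeomorphism groups\<close>

text \<open>As in \<^const>\<open>BijGroup\<close>, homeomorphisms are extensional functions, so that each one is
  represented exactly once.\<close>

definition homeo_group :: "'a topology \<Rightarrow> ('a \<Rightarrow> 'a) monoid"
  where "homeo_group E = (BijGroup (topspace E))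
    \<lparr>carrier := {g \<in> Bij (topspace E). homeomorphic_map E E g}\<rparr>"

definition compact_open_topology :: "'a topology \<Rightarrow> ('a \<Rightarrow> 'a) topology"
  where "compact_open_topology E = topology_generated_by
    {{g \<in> carrier (homeo_group E). g ` K \<subseteq> U} | K U. compactin E K \<and> openin E U}"

definition homeo_group_fixing :: "'a topology \<Rightarrow> 'a \<Rightarrow> ('a \<Rightarrow> 'a) monoid"
  where "homeo_group_fixing E x = (homeo_group E)
    \<lparr>carrier := {g \<in> carrier (homeo_group E). g x = x}\<rparr>"

definition homeo_topology_fixing :: "'a topology \<Rightarrow> 'a \<Rightarrow> ('a \<Rightarrow> 'a) topology"
  where "homeo_topology_fixing E x =
    subtopology (compact_open_topology E) (carrier (homeo_group_fixing E x))"

section \<open>Hyperspaces and maximal chains\<close>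

definition hyperspace :: "'a topology \<Rightarrow> 'a set set"
  where "hyperspace X = {F. closedin X F \<and> F \<noteq> {}}"

definition vietoris :: "'a topology \<Rightarrow> 'a set topology"
  where "vietoris X = topology_generated_by
    ({{F \<in> hyperspace X. F \<subseteq> U} | U. openin X U} \<union>
     {{F \<in> hyperspace X. F \<inter> U \<noteq> {}} | U. openin X U})"

text \<open>\<open>subset.maxchain \<A>\<close> is the library's predicate for the maximal chains in \<open>\<A>\<close> with respect to
  inclusion.\<close>

definition maxchain_space :: "'a topology \<Rightarrow> 'a set set topology"
  where "maxchain_space X =
    subtopology (vietoris (vietoris X)) {M. subset.maxchain (hyperspace X) M}"

definition maxchain_space_at :: "'a topology \<Rightarrow> 'a \<Rightarrow> 'a set set topology"
  where "maxchain_space_at X x = subtopology (maxchain_space X) {M. {x} \<in> M}"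

definition maxchain_action :: "'a topology \<Rightarrow> 'a \<Rightarrow> ('a \<Rightarrow> 'a) \<Rightarrow> 'a set set \<Rightarrow> 'a set set"
  where "maxchain_action X x g = (\<lambda>M \<in> topspace (maxchain_space_at X x). (\<lambda>F. g ` F) ` M)"

section \<open>The Cantor set\<close>

definition cantor_space :: "(nat \<Rightarrow> bool) topology"
  where "cantor_space = product_topology (\<lambda>_. discrete_topology UNIV) UNIV"

section \<open>Basic facts\<close>

lemma topspace_vietoris [simp]: "topspace (vietoris X) = hyperspace X"
proof
  show "topspace (vietoris X) \<subseteq> hyperspace X"
    by (auto simp: vietoris_def topology_generated_by_topspace)
  show "hyperspace X \<subseteq> topspace (vietoris X)"
  proof
    fix F assume "F \<in> hyperspace X"
    then have "F \<in> {F \<in> hyperspace X. F \<subseteq> topspace X}"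
      by (simp add: hyperspace_def closedin_subset)
    then show "F \<in> topspace (vietoris X)"
      unfolding vietoris_def topology_generated_by_topspace
      by (rule UnionI [rotated]) (rule UnI1, rule CollectI, rule exI [of _ "topspace X"], rule conjI [OF refl openin_topspace])
  qed
qed

lemma topspace_compact_open_topology [simp]:
  "topspace (compact_open_topology E) = carrier (homeo_group E)"
proof
  show "topspace (compact_open_topology E) \<subseteq> carrier (homeo_group E)"
    by (auto simp: compact_open_topology_def topology_generated_by_topspace)
  show "carrier (homeo_group E) \<subseteq> topspace (compact_open_topology E)"
  proof
    fix g assume "g \<in> carrier (homeo_group E)"
    then have "g \<in> {g \<in> carrier (homeo_group E). g ` {} \<subseteq> {}}"
      by simp
    then show "g \<in> topspace (compact_open_topology E)"
      unfolding compact_open_topology_def topology_generated_by_topspace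
      by (rule UnionI [rotated]) (rule CollectI, rule exI [of _ "{}"], rule exI [of _ "{}"],
          rule conjI [OF refl conjI [OF compactin_empty openin_empty]])
  qed
qed

lemma topspace_homeo_topology_fixing [simp]:
  "topspace (homeo_topology_fixing E x) = carrier (homeo_group_fixing E x)"
  by (auto simp: homeo_topology_fixing_def homeo_group_fixing_def)

lemma inv_BijGroup:
  assumes "f \<in> Bij S"
  shows "inv\<^bsub>BijGroup S\<^esub> f = restrict (inv_into S f) S"
proof (rule group.inv_equality [OF group_BijGroup])
  show "restrict (inv_into S f) S \<otimes>\<^bsub>BijGroup S\<^esub> f = \<one>\<^bsub>BijGroup S\<^esub>"
    using assms restrict_inv_into_Bij [OF assms] Bij_compose_restrict_eq [OF assms]
    by (simp add: BijGroup_def)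
  show "f \<in> carrier (BijGroup S)"
    using assms by (simp add: BijGroup_def)
  show "restrict (inv_into S f) S \<in> carrier (BijGroup S)"
    using restrict_inv_into_Bij [OF assms] by (simp add: BijGroup_def)
qed

lemma subgroup_homeo_group: "subgroup (carrier (homeo_group E)) (BijGroup (topspace E))"
proof (rule group.subgroupI [OF group_BijGroup])
  show "carrier (homeo_group E) \<subseteq> carrier (BijGroup (topspace E))"
    by (auto simp: homeo_group_def BijGroup_def)
  have "homeomorphic_map E E (\<lambda>x\<in>topspace E. x)"
    by (rule homeomorphic_map_eq [OF homeomorphic_map_id [THEN iffD2, OF refl]]) auto
  then show "carrier (homeo_group E) \<noteq> {}"
    using id_Bij by (fastforce simp: homeo_group_def)
next
  fix g assume "g \<in> carrier (homeo_group E)"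
  then have g: "g \<in> Bij (topspace E)" "homeomorphic_map E E g"
    by (auto simp: homeo_group_def)
  then obtain h where h: "homeomorphic_maps E E g h"
    using homeomorphic_map_maps by blast
  have "homeomorphic_map E E (restrict (inv_into (topspace E) g) (topspace E))"
  proof (rule homeomorphic_map_eq)
    show "homeomorphic_map E E h"
      using h by (meson homeomorphic_maps_map)
    show "h y = restrict (inv_into (topspace E) g) (topspace E) y" if "y \<in> topspace E" for y
    proof -
      have "inj_on g (topspace E)"
        using g(1) by (simp add: Bij_def bij_betw_def)
      moreover have "h y \<in> topspace E" "g (h y) = y"
        using h that by (auto simp: homeomorphic_maps_def continuous_map_def)
      ultimately show ?thesis
        using that by (metis inv_into_f_f restrict_apply')
    qed
  qed
  then show "inv\<^bsub>BijGroup (topspace E)\<^esub> g \<in> carrier (homeo_group E)"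
    using restrict_inv_into_Bij [OF g(1)] by (simp add: homeo_group_def inv_BijGroup [OF g(1)])
next
  fix g h assume "g \<in> carrier (homeo_group E)" "h \<in> carrier (homeo_group E)"
  then have g: "g \<in> Bij (topspace E)" "homeomorphic_map E E g"
    and h: "h \<in> Bij (topspace E)" "homeomorphic_map E E h"
    by (auto simp: homeo_group_def)
  have "homeomorphic_map E E (compose (topspace E) g h)"
    by (rule homeomorphic_map_eq [OF homeomorphic_map_compose [OF h(2) g(2)]])
      (simp add: compose_def)
  then show "g \<otimes>\<^bsub>BijGroup (topspace E)\<^esub> h \<in> carrier (homeo_group E)"
    using g(1) h(1) compose_Bij [OF g(1) h(1)] by (simp add: homeo_group_def BijGroup_def)
qed

lemma group_homeo_group: "group (homeo_group E)"
  using group.subgroup_imp_group [OF group_BijGroup subgroup_homeo_group [of E]]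
  by (simp add: homeo_group_def)

end

theory Submission
  imports Defs
begin

text \<open>
  Write \<open>\<Phi>\<close> for the space of maximal chains containing \<open>{x}\<close> and \<open>G\<close> for the group of
  homeomorphisms fixing \<open>x\<close>. A maximal chain grows one point at a time. So if \<open>A\<close> and \<open>B\<close> are
  disjoint nonempty clopen sets, some member of the chain meets one of them and misses the other
  (\<open>maxchain_separates\<close>). The chain therefore orders the pieces of every clopen partition linearly,
  the piece containing \<open>x\<close> coming first because \<open>{x}\<close> belongs to the chain, and these orders determine
  the chain and its neighbourhoods (\<open>flags_separated\<close>, \<open>flag_nbhd_natural\<close>). Likewise a homeomorphism
  is close to the identity iff it preserves every piece of some fine partition
  (\<open>openin_preserving\<close>, \<open>homeo_topology_nbhd\<close>). The claim thus becomes one about finite partitions and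
  their orderings.

  A labelled partition is a coloring \<open>c\<close> of the space by \<open>{..<n}\<close> with \<open>c x = 0\<close>; the group acts on
  colorings by composition, and \<open>c\<close> is called natural for a chain if the chain orders the pieces by their
  labels. Nonempty clopen subsets of the Cantor set are homeomorphic, even with one prescribed value, so
  two colorings with the same number of labels differ by an element of \<open>G\<close> (\<open>coloring_transitive\<close>).
  Every chain has a natural coloring with any given positive number of labels. Hence all orbits in \<open>\<Phi>\<close> are
  dense (\<open>orbit_dense\<close>), and \<open>\<Phi>\<close> is minimal.

  For universality let \<open>Y\<close> be a minimal flow and fix a chain \<open>M\<close> in \<open>\<Phi>\<close>. The aim is a point \<open>z\<close> of \<open>Y\<close>
  such that \<open>k z\<close> depends uniformly continuously on \<open>k M\<close>: if \<open>k M\<close> and \<open>k' M\<close> induce the same order on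
  a sufficiently fine partition, then \<open>k z\<close> and \<open>k' z\<close> are not separated by given open sets. Every such
  requirement is a closed condition on \<open>z\<close>, so by compactness of \<open>Y\<close> finitely many of them may be
  considered. They involve finitely many colorings that are natural for \<open>M\<close>, and these factor through a
  single natural coloring \<open>d\<close> by rigid surjections, that is, by surjections whose values occur for the
  first time in increasing order. Now take any \<open>y\<close> in \<open>Y\<close> and a coloring \<open>b\<close> with many labels. A labelled
  partition \<open>c h\<close> gets one of two colors according to whether \<open>h\<close> can be chosen so as to move \<open>y\<close> into a
  given open set. By the Graham-Rothschild theorem some rigid quotient of \<open>b\<close>, with as many labels as
  \<open>d\<close>, has the property that the relevant quotients of it all get the same color. An element \<open>g\<close> of \<open>G\<close>
  carries this quotient to \<open>d\<close>, and \<open>g y\<close> satisfies the conditions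
  (\<open>finitely_many_obstructions_avoidable\<close>).

  The closure of the set of all pairs \<open>(k M, k z)\<close> in the product of \<open>\<Phi>\<close> and \<open>Y\<close> is then the graph of
  a continuous equivariant map. Its image is closed, invariant and nonempty, so it is all of \<open>Y\<close>
  (\<open>flow_factor_flags\<close>).

  The Graham-Rothschild theorem is proved for words with parameters by induction on the number of
  parameters. Without parameters it is the Hales-Jewett theorem, which is obtained by Shelah's argument.
\<close>

section \<open>Parameter words and the Graham-Rothschild theorem\<close>

text \<open>
  Restricted growth: reading a word when the letters below \<open>t\<close> have been used, every letter is either an
  old one or the least new one, and at the end exactly the letters below \<open>n\<close> have been used.
\<close>

fun growth :: "nat \<Rightarrow> nat \<Rightarrow> nat list \<Rightarrow> bool" where
  "growth t n [] \<longleftrightarrow> t = n"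
| "growth t n (a # w) \<longleftrightarrow> a < t \<and> growth t n w \<or> a = t \<and> growth (Suc t) n w"

text \<open>
  The Graham-Rothschild parameter words of length \<open>N\<close> with \<open>k\<close> parameters over an alphabet of \<open>t\<close>
  letters: \<open>t + j\<close> stands for the parameter number \<open>j\<close>. Prefixed with the word \<open>[0..<t]\<close> they are the
  rigid surjections from \<open>{..<t + N}\<close> onto \<open>{..<t + k}\<close> that fix all letters. Coding letters and
  parameters by one type lets a parameter become a letter of a larger alphabet.
\<close>

definition words :: "nat \<Rightarrow> nat \<Rightarrow> nat \<Rightarrow> nat list set" where
  "words t k N = {w. length w = N \<and> growth t (t + k) w}"

definition substitute :: "nat \<Rightarrow> nat list \<Rightarrow> nat list \<Rightarrow> nat list" where
  "substitute t g f = map (\<lambda>a. if a < t then a else g ! (a - t)) f"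

lemma growth_le: "growth t n w \<Longrightarrow> t \<le> n"
  by (induction w arbitrary: t) force+

lemma growth_set: "growth t n w \<Longrightarrow> set w \<subseteq> {..<n}"
proof (induction w arbitrary: t)
  case (Cons a w)
  then show ?case
    using growth_le[of t n w] growth_le[of "Suc t" n w] by auto
qed simp

lemma growth_append: "growth t n (u @ v) \<longleftrightarrow> (\<exists>m. growth t m u \<and> growth m n v)"
  by (induction u arbitrary: t) auto

lemma growth_letters: "growth t t w \<longleftrightarrow> set w \<subseteq> {..<t}"
  by (induction w) (auto dest: growth_le)

lemma words_0: "words t 0 N = {w. length w = N \<and> set w \<subseteq> {..<t}}"
  by (auto simp: words_def growth_letters)

lemma length_substitute [simp]: "length (substitute t g f) = length f"
  by (simp add: substitute_def)

lemma substitute_append [simp]: "substitute t g (u @ v) = substitute t g u @ substitute t g v"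
  by (simp add: substitute_def)

lemma substitute_Nil [simp]: "substitute t g [] = []"
  by (simp add: substitute_def)

lemma substitute_Cons [simp]: "substitute t g (a # f) = (if a < t then a else g ! (a - t)) # substitute t g f"
  by (simp add: substitute_def)

text \<open>
  Parameters of \<open>g\<close> first occur in \<open>substitute t g f\<close> in the order in which they occur in \<open>g\<close>,
  since those of \<open>f\<close> appear in increasing order. The induction follows \<open>f\<close> when \<open>j\<close> of its
  parameters have been met.
\<close>

lemma growth_substitute:
  assumes "growth (t + j) (t + m) f" "length g = m" "growth s n (drop j g)" "t \<le> s"
    "set (take j g) \<subseteq> {..<s}"
  shows "growth s n (substitute t g f)"
  using assms
proof (induction f arbitrary: j s)
  case Nil
  then show ?case by simp
next
  case (Cons a f)
  show ?case
  proof (cases "a < t + j")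
    case True
    then have gf: "growth (t + j) (t + m) f"
      using Cons.prems(1) by auto
    have jm: "j \<le> m" using growth_le[OF gf] by simp
    have "growth s n (substitute t g f)"
      using Cons.IH gf Cons.prems by blast
    moreover have "(if a < t then a else g ! (a - t)) < s"
    proof (cases "a < t")
      case True then show ?thesis using Cons.prems by auto
    next
      case False
      then have "a - t < j" using \<open>a < t + j\<close> by simp
      then have "g ! (a - t) \<in> set (take j g)"
        using jm Cons.prems(2) by (auto simp: in_set_conv_nth intro!: exI[of _ "a - t"])
      then show ?thesis using Cons.prems(5) False by auto
    qed
    ultimately show ?thesis by simp
  next
    case False
    then have a: "a = t + j" and gf: "growth (t + Suc j) (t + m) f"
      using Cons.prems(1) by auto
    have jm: "j < length g" using growth_le[OF gf] Cons.prems(2) by simp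
    have dr: "drop j g = g ! j # drop (Suc j) g"
      using jm by (simp add: Cons_nth_drop_Suc)
    have tk: "take (Suc j) g = take j g @ [g ! j]"
      using jm by (simp add: take_Suc_conv_app_nth)
    consider "g ! j < s" "growth s n (drop (Suc j) g)" | "g ! j = s" "growth (Suc s) n (drop (Suc j) g)"
      using Cons.prems(3) dr by auto
    then show ?thesis
    proof cases
      case 1
      have "growth s n (substitute t g f)"
        by (rule Cons.IH[OF gf]) (use 1 Cons.prems tk in auto)
      then show ?thesis using a 1 by simp
    next
      case 2
      have "growth (Suc s) n (substitute t g f)"
        by (rule Cons.IH[OF gf]) (use 2 Cons.prems tk in \<open>auto simp: less_Suc_eq\<close>)
      then show ?thesis using a 2 by simp
    qed
  qed
qed

lemma substitute_words: "f \<in> words t m N \<Longrightarrow> g \<in> words t k m \<Longrightarrow> substitute t g f \<in> words t k N"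
  using growth_substitute[of t 0 m f g t "t + k"] by (simp add: words_def)

lemma substitute_assoc:
  assumes "set f \<subseteq> {..<t + length g}"
  shows "substitute t h (substitute t g f) = substitute t (substitute t h g) f"
  using assms by (force simp: substitute_def)

lemma substitute_assoc_words:
  assumes "f \<in> words t m N" "length g = m"
  shows "substitute t h (substitute t g f) = substitute t (substitute t h g) f"
  using assms growth_set by (intro substitute_assoc) (auto simp: words_def)

lemma words_set: "w \<in> words t k N \<Longrightarrow> set w \<subseteq> {..<t + k}"
  using growth_set by (auto simp: words_def)

lemma finite_words: "finite (words t k N)"
  by (rule finite_subset[OF _ finite_lists_length_eq[of "{..<t + k}" N]])
    (use words_set in \<open>auto simp: words_def\<close>)

text \<open>
  The length \<open>N\<close> works in the Graham-Rothschild theorem for \<open>k\<close>-parameter words, target dimension \<open>m\<close>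
  and \<open>r\<close> colors.
\<close>

definition ramsey_length :: "nat \<Rightarrow> nat \<Rightarrow> nat \<Rightarrow> nat \<Rightarrow> nat \<Rightarrow> bool" where
  "ramsey_length t k m r N \<longleftrightarrow> (\<forall>\<kappa> :: nat list \<Rightarrow> nat. (\<forall>w\<in>words t k N. \<kappa> w < r) \<longrightarrow>
     (\<exists>f\<in>words t m N. \<exists>c. \<forall>g\<in>words t k m. \<kappa> (substitute t g f) = c))"

text \<open>
  Colors from an arbitrary finite set; in the applications a color is the vector of the colors that
  several colorings assign to a word.
\<close>

lemma ramsey_length_finite_colours:
  assumes ramsey_length: "ramsey_length t k m (card C) N" and C: "finite C" and \<kappa>: "\<And>w. w \<in> words t k N \<Longrightarrow> \<kappa> w \<in> C"
  obtains f c where "f \<in> words t m N" "\<And>g. g \<in> words t k m \<Longrightarrow> \<kappa> (substitute t g f) = c"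
proof -
  obtain e where e: "bij_betw e C {..<card C}"
    using ex_bij_betw_finite_nat[OF C] atLeast0LessThan by auto
  have "\<forall>w\<in>words t k N. (e \<circ> \<kappa>) w < card C"
    using e \<kappa> by (auto simp: bij_betw_def)
  then obtain f c where f: "f \<in> words t m N" "\<forall>g\<in>words t k m. (e \<circ> \<kappa>) (substitute t g f) = c"
    using ramsey_length unfolding ramsey_length_def by blast
  have "\<kappa> (substitute t g f) = inv_into C e c" if "g \<in> words t k m" for g
    using f that e \<kappa>[OF substitute_words[OF f(1) that]] by (auto simp: bij_betw_def)
  then show thesis using that f(1) by blast
qed

lemma card_vectors: "finite {v. set v \<subseteq> {..<r::nat} \<and> length v = p}"
  "card {v. set v \<subseteq> {..<r::nat} \<and> length v = p} = r ^ p"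
  by (simp_all add: finite_lists_length_eq card_lists_length_eq)

text \<open>
  Shelah's lemma for the Hales-Jewett theorem: on a subspace of large dimension a coloring does not
  distinguish the last two letters \<open>t - 1\<close> and \<open>t\<close> of the alphabet. The subspace is built one parameter
  at a time from the end of the word.
\<close>

lemma insensitive:
  assumes t: "t \<ge> 1"
  shows "\<exists>N. \<forall>\<kappa> :: nat list \<Rightarrow> nat. (\<forall>w\<in>words (Suc t) 0 N. \<kappa> w < r) \<longrightarrow>
    (\<exists>f\<in>words (Suc t) m N. \<forall>w\<in>words (Suc t) 0 m.
       \<kappa> (substitute (Suc t) w f) = \<kappa> (substitute (Suc t) (map (min (t - 1)) w) f))"
proof (induction m arbitrary: r)
  case 0
  then show ?case
    by (intro exI[of _ 0]) (auto simp: words_0 words_def intro!: exI[of _ "[]"])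
next
  case (Suc m)
  let ?T = "Suc t"
  obtain N where N: "\<forall>\<kappa> :: nat list \<Rightarrow> nat. (\<forall>w\<in>words ?T 0 N. \<kappa> w < r ^ ?T) \<longrightarrow>
    (\<exists>f\<in>words ?T m N. \<forall>w\<in>words ?T 0 m.
       \<kappa> (substitute ?T w f) = \<kappa> (substitute ?T (map (min (t - 1)) w) f))"
    by (rule exE[OF Suc.IH[of "r ^ ?T"]])
  let ?V = "{v. set v \<subseteq> {..<r} \<and> length v = ?T}"
  obtain e where e: "bij_betw e ?V {..<r ^ ?T}"
    using ex_bij_betw_finite_nat[OF card_vectors(1)[of r ?T]] card_vectors(2)[of r ?T]
      atLeast0LessThan by auto
  let ?FS = "words ?T 0 N \<rightarrow>\<^sub>E {..<r}"
  define l where "l = card ?FS"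
  have finFS: "finite ?FS" by (intro finite_PiE finite_words) simp
  show ?case
  proof (intro exI[of _ "N + l"] allI impI)
    fix \<kappa> :: "nat list \<Rightarrow> nat"
    assume \<kappa>: "\<forall>w\<in>words ?T 0 (N + l). \<kappa> w < r"
    (* By the pigeonhole principle two of the l + 1 words b j yield the same coloring of the words of
       length N in front of them. The new parameter occupies the positions where these two words differ. *)
    define b where "b j = replicate j (t - 1) @ replicate (l - j) t" for j
    have b: "set (b j) \<subseteq> {..<?T}" "j \<le> l \<Longrightarrow> length (b j) = l" for j
      using t by (auto simp: b_def)
    define F where "F j = restrict (\<lambda>u. \<kappa> (u @ b j)) (words ?T 0 N)" for j
    have "F ` {..l} \<subseteq> ?FS"
      using \<kappa> b by (auto simp: F_def words_0 intro!: restrict_PiE_iff[THEN iffD2])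
    then have "card (F ` {..l}) < card {..l}"
      using card_mono[OF finFS] by (simp add: l_def less_Suc_eq_le)
    from pigeonhole[OF this] obtain i0 j0 where "i0 \<le> l" "j0 \<le> l" "i0 \<noteq> j0" "F i0 = F j0"
      by (auto simp: inj_on_def)
    then obtain i j where ij: "i < j" "j \<le> l" "F i = F j"
      by (metis nat_neq_iff)
    define P where "P a = replicate i (t - 1) @ replicate (j - i) a @ replicate (l - j) t" for a
    have Pt: "P t = b i"
      using ij by (simp add: P_def b_def flip: replicate_add)
    have Pt1: "P (t - 1) = b j"
      using ij by (simp add: P_def b_def flip: replicate_add append_assoc)
    have Pl: "length (P a) = l" "set (P a) \<subseteq> insert a {..<?T}" for a
      using ij t by (auto simp: P_def)
    have F_eq: "\<kappa> (u @ P t) = \<kappa> (u @ P (t - 1))" if "u \<in> words ?T 0 N" for u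
      using fun_cong[OF ij(3), of u] that by (simp add: F_def Pt Pt1 del: One_nat_def)
    have val: "\<kappa> (u @ P a) < r" if "u \<in> words ?T 0 N" "a < ?T" for u a
    proof -
      have "u @ P a \<in> words ?T 0 (N + l)"
        using that Pl[of a] by (auto simp: words_0)
      then show ?thesis using \<kappa> by blast
    qed
    (* The colors for all values of the last parameter are recorded at once, so that the earlier
       parameters can be chosen independently of that value. *)
    define vec where "vec u = map (\<lambda>a. \<kappa> (u @ P a)) [0..<?T]" for u
    have vec: "vec u \<in> ?V" if "u \<in> words ?T 0 N" for u
      unfolding vec_def using val[OF that] by (auto simp del: upt_Suc)
    have "\<forall>w\<in>words ?T 0 N. (e \<circ> vec) w < r ^ ?T"
      using e vec by (auto simp: bij_betw_def)
    then obtain f where f: "f \<in> words ?T m N" and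
      fe: "\<forall>w\<in>words ?T 0 m. (e \<circ> vec) (substitute ?T w f) = (e \<circ> vec) (substitute ?T (map (min (t - 1)) w) f)"
      using N by blast
    have collapse: "map (min (t - 1)) w \<in> words ?T 0 n" if "w \<in> words ?T 0 n" for w n
      using that by (auto simp: words_0)
    have vec_eq: "vec (substitute ?T w f) = vec (substitute ?T (map (min (t - 1)) w) f)" if "w \<in> words ?T 0 m" for w
      using fe that e vec substitute_words[OF f] collapse unfolding bij_betw_def
      by (metis (no_types, lifting) comp_apply inj_on_eq_iff)
    have \<kappa>_eq: "\<kappa> (substitute ?T w f @ P a) = \<kappa> (substitute ?T (map (min (t - 1)) w) f @ P a)"
      if "w \<in> words ?T 0 m" "a < ?T" for w a
      using arg_cong[OF vec_eq[OF that(1)], of "\<lambda>v. v ! a"] that(2)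
      by (simp add: vec_def del: upt_Suc)
    have "growth (?T + m) (?T + Suc m) (P (?T + m))"
    proof -
      have "growth (?T + m) (?T + m) (replicate i (t - 1))"
        by (subst growth_letters) auto
      moreover have "growth (?T + Suc m) (?T + Suc m) (replicate (j - i - 1) (?T + m) @ replicate (l - j) t)"
        by (subst growth_letters) auto
      moreover have "P (?T + m) = replicate i (t - 1) @ (?T + m) # replicate (j - i - 1) (?T + m) @ replicate (l - j) t"
        using ij by (simp add: P_def Cons_replicate_eq flip: append_Cons replicate_Suc)
      ultimately show ?thesis by (auto simp: growth_append)
    qed
    then have fP: "f @ P (?T + m) \<in> words ?T (Suc m) (N + l)"
      using f Pl by (auto simp: words_def growth_append)
    show "\<exists>f\<in>words ?T (Suc m) (N + l). \<forall>w\<in>words ?T 0 (Suc m).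
      \<kappa> (substitute ?T w f) = \<kappa> (substitute ?T (map (min (t - 1)) w) f)"
    proof (rule bexI[OF _ fP], rule ballI)
      fix w assume "w \<in> words ?T 0 (Suc m)"
      then obtain w0 a where w: "w = w0 @ [a]" "w0 \<in> words ?T 0 m" "a < ?T"
        by (cases w rule: rev_cases) (auto simp: words_0)
      have sP: "substitute ?T (v @ [c]) (P (?T + m)) = P c" if "length v = m" for v c
        using t that by (auto simp: P_def substitute_def nth_append)
      have sf: "substitute ?T (v @ [c]) f = substitute ?T v f" if "length v = m" for v c
        using words_set[OF f] that by (auto simp: substitute_def nth_append)
      have lw: "length w0 = m" using w by (simp add: words_0)
      have "\<kappa> (substitute ?T w (f @ P (?T + m))) = \<kappa> (substitute ?T w0 f @ P a)"
        using w sP[OF lw] sf[OF lw] by simp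
      also have "\<dots> = \<kappa> (substitute ?T (map (min (t - 1)) w0) f @ P a)"
        using \<kappa>_eq w by blast
      also have "\<dots> = \<kappa> (substitute ?T (map (min (t - 1)) w0) f @ P (min (t - 1) a))"
      proof (cases "a = t")
        case True
        then show ?thesis using F_eq substitute_words[OF f] collapse w(2) by simp
      next
        case False
        then have "min (t - 1) a = a" using w(3) by simp
        then show ?thesis by simp
      qed
      also have "\<dots> = \<kappa> (substitute ?T (map (min (t - 1)) w) (f @ P (?T + m)))"
        using w sP[of "map (min (t - 1)) w0"] sf[of "map (min (t - 1)) w0"] lw by simp
      finally show "\<kappa> (substitute ?T w (f @ P (?T + m))) = \<kappa> (substitute ?T (map (min (t - 1)) w) (f @ P (?T + m)))" .
    qed
  qed
qed

lemma growth_upt: "growth t (t + m) [t..<t + m]"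
  by (induction m) (auto simp: growth_append)

lemma growth_shift: "growth s n h \<Longrightarrow> t \<le> s \<Longrightarrow> growth (Suc s) (Suc n) (map (\<lambda>a. if a < t then a else Suc a) h)"
  by (induction h arbitrary: s) auto

text \<open>
  Induction on the alphabet: on an insensitive subspace the colors depend only on the word in which the
  last letter is identified with its predecessor, which is a word over the smaller alphabet.
\<close>

theorem Hales_Jewett:
  assumes "t \<ge> 1"
  shows "\<exists>N. ramsey_length t 0 m r N"
  using assms
proof (induction t rule: dec_induct)
  case base
  have "w = replicate n 0" if "w \<in> words 1 0 n" for w n
    using that by (auto simp: words_0 subset_iff intro!: replicate_eqI)
  moreover have "[1..<Suc m] \<in> words 1 m m"
    using growth_upt[of 1 m] by (simp add: words_def)
  ultimately show ?case unfolding ramsey_length_def by (metis)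
next
  case (step t)
  let ?T = "Suc t"
  obtain M where M: "ramsey_length t 0 m r M" using step by blast
  obtain N where N: "\<forall>\<kappa> :: nat list \<Rightarrow> nat. (\<forall>w\<in>words ?T 0 N. \<kappa> w < r) \<longrightarrow>
    (\<exists>f\<in>words ?T M N. \<forall>w\<in>words ?T 0 M.
       \<kappa> (substitute ?T w f) = \<kappa> (substitute ?T (map (min (t - 1)) w) f))"
    by (rule exE[OF insensitive[OF step(1), of r M]])
  have "ramsey_length ?T 0 m r N"
    unfolding ramsey_length_def
  proof (intro allI impI)
    fix \<kappa> :: "nat list \<Rightarrow> nat" assume \<kappa>: "\<forall>w\<in>words ?T 0 N. \<kappa> w < r"
    then obtain f where f: "f \<in> words ?T M N" and
      ins: "\<And>w. w\<in>words ?T 0 M \<Longrightarrow> \<kappa> (substitute ?T w f) = \<kappa> (substitute ?T (map (min (t - 1)) w) f)"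
      using N by blast
    have sub: "words t 0 M \<subseteq> words ?T 0 M" by (auto simp: words_0)
    then have "\<forall>w\<in>words t 0 M. \<kappa> (substitute ?T w f) < r"
      using \<kappa> substitute_words[OF f] by blast
    then obtain h c where h: "h \<in> words t m M" and
      c: "\<And>g. g \<in> words t 0 m \<Longrightarrow> \<kappa> (substitute ?T (substitute t g h) f) = c"
      using M[unfolded ramsey_length_def, rule_format, of "\<lambda>w. \<kappa> (substitute ?T w f)"] by blast
    (* In the larger alphabet t is a letter, so the codes of the parameters move up by one. *)
    define h' where "h' = map (\<lambda>a. if a < t then a else Suc a) h"
    have h': "h' \<in> words ?T m M"
      using h growth_shift[of t "t + m" h t] by (simp add: words_def h'_def)
    show "\<exists>f\<in>words ?T m N. \<exists>c. \<forall>g\<in>words ?T 0 m. \<kappa> (substitute ?T g f) = c"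
    proof (intro bexI[OF _ substitute_words[OF f h']] exI[of _ c] ballI)
      fix g assume g: "g \<in> words ?T 0 m"
      have "map (min (t - 1)) (substitute ?T g h') = substitute t (map (min (t - 1)) g) h"
        using words_set[OF h] g step(1) by (auto simp: substitute_def h'_def words_0)
      moreover have "map (min (t - 1)) g \<in> words t 0 m"
        using g step(1) by (auto simp: words_0)
      ultimately have "\<kappa> (substitute ?T (substitute ?T g h') f) = c"
        using ins[OF substitute_words[OF h' g]] c by simp
      then show "\<kappa> (substitute ?T g (substitute ?T h' f)) = c"
        using substitute_assoc_words[OF f] h' by (simp add: words_def)
    qed
  qed
  then show ?case by blast
qed

text \<open>
  The part of a word before the first letter that is at least \<open>b\<close>. For a parameter word it ends at the
  first occurrence of the parameter coded by \<open>b\<close>.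
\<close>

abbreviation below :: "nat \<Rightarrow> nat list \<Rightarrow> nat list" where
  "below b \<equiv> takeWhile (\<lambda>a. a < b)"

lemma below_append: "set u \<subseteq> {..<b} \<Longrightarrow> below b (u @ b # v) = u" for b :: nat
  by (subst takeWhile_append2) auto

lemma growth_split:
  assumes "growth s n w" "s \<le> b" "b < n"
  obtains u v where "w = u @ b # v" "growth s b u" "below b w = u"
proof -
  have "\<exists>u v. w = u @ b # v \<and> growth s b u"
    using assms
  proof (induction w arbitrary: s)
    case (Cons a w)
    consider "a < s" "growth s n w" | "a = s" "s = b" | "a = s" "Suc s \<le> b" "growth (Suc s) n w"
      using Cons.prems by force
    then show ?case
    proof cases
      case 1
      then obtain u v where "w = u @ b # v" "growth s b u"
        using Cons.IH Cons.prems by blast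
      then show ?thesis using 1 by (rule_tac exI[of _ "a # u"], rule_tac exI[of _ v]) simp
    next
      case 2
      then show ?thesis by (rule_tac exI[of _ "[]"], rule_tac exI[of _ w]) simp
    next
      case 3
      then obtain u v where "w = u @ b # v" "growth (Suc s) b u"
        using Cons.IH Cons.prems by blast
      then show ?thesis using 3 by (rule_tac exI[of _ "a # u"], rule_tac exI[of _ v]) simp
    qed
  qed simp
  then obtain u v where uv: "w = u @ b # v" "growth s b u"
    by blast
  then have "below b w = u"
    using below_append[OF growth_set] by simp
  then show thesis using that uv by blast
qed

text \<open>
  The parameter \<open>t + i\<close> first occurs in \<open>substitute t g f\<close> where the parameter of \<open>f\<close> first occurs whose
  number is the position of \<open>t + i\<close> in \<open>g\<close>.
\<close>

lemma below_substitute: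
  assumes f: "f \<in> words t m N" and g: "g \<in> words t k m" and i: "i < k"
  defines "u \<equiv> below (t + i) g"
  shows "below (t + i) (substitute t g f) = substitute t u (below (t + length u) f)"
    and "length u < m"
proof -
  have "growth t (t + k) g" using g by (simp add: words_def)
  then obtain v where v: "g = u @ (t + i) # v" and gu: "growth t (t + i) u"
    unfolding u_def by (rule growth_split[where b = "t + i"]) (use i in auto)
  show j: "length u < m"
    using g v by (auto simp: words_def)
  have "growth t (t + m) f" using f by (simp add: words_def)
  then obtain w z where z: "f = w @ (t + length u) # z" and gw: "growth t (t + length u) w"
    and w: "below (t + length u) f = w"
    by (rule growth_split[where b = "t + length u"]) (use j in auto)
  have "g ! length u = t + i" by (simp add: v)
  then have "substitute t g f = substitute t g w @ (t + i) # substitute t g z"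
    by (simp add: z)
  also have "substitute t g w = substitute t u w"
    using growth_set[OF gw] by (auto simp: v substitute_def nth_append)
  finally have *: "substitute t g f = substitute t u w @ (t + i) # substitute t g z" .
  have "growth t (t + i) (substitute t u w)"
    using growth_substitute[of t 0 "length u" w u t "t + i"] gu gw by simp
  then show "below (t + i) (substitute t g f) = substitute t u (below (t + length u) f)"
    unfolding * w using growth_set by (intro below_append) blast
qed

text \<open>
  The first half of the step from \<open>k\<close> to \<open>Suc k\<close> parameters. Behind the first occurrence of the first
  parameter \<open>t\<close> a word is a \<open>k\<close>-parameter word over an alphabet that contains \<open>t\<close> as a further letter, so
  the hypothesis for \<open>Suc t\<close> letters removes the dependence on what follows. The index \<open>x\<close> lets finitely
  many colorings be treated at once, which the induction on \<open>M\<close> needs.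
\<close>

lemma tail_constant:
  assumes t: "t \<ge> 1" and GR: "\<And>m r. \<exists>N. ramsey_length (Suc t) k m r N"
  shows "\<exists>N. \<forall>\<kappa> :: nat \<Rightarrow> nat list \<Rightarrow> nat. (\<forall>x<p. \<forall>w\<in>words t (Suc k) N. \<kappa> x w < r) \<longrightarrow>
    (\<exists>f\<in>words t M N. \<forall>x<p. \<forall>g\<in>words t (Suc k) M. \<forall>g'\<in>words t (Suc k) M.
       below t g = below t g' \<longrightarrow>
       \<kappa> x (substitute t g f) = \<kappa> x (substitute t g' f))"
proof (induction M arbitrary: p)
  case 0
  have "words t (Suc k) 0 = {}" by (auto simp: words_def)
  moreover have "[] \<in> words t 0 0" by (simp add: words_def)
  ultimately show ?case by (intro exI[of _ 0]) auto
next
  case (Suc M)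
  obtain N' where N': "\<forall>\<kappa> :: nat \<Rightarrow> nat list \<Rightarrow> nat. (\<forall>x<p * t. \<forall>w\<in>words t (Suc k) N'. \<kappa> x w < r) \<longrightarrow>
    (\<exists>f\<in>words t M N'. \<forall>x<p * t. \<forall>g\<in>words t (Suc k) M. \<forall>g'\<in>words t (Suc k) M.
       below t g = below t g' \<longrightarrow>
       \<kappa> x (substitute t g f) = \<kappa> x (substitute t g' f))"
    by (rule exE[OF Suc.IH[of "p * t"]])
  let ?V = "{v. set v \<subseteq> {..<r} \<and> length v = p}"
  obtain K where K: "ramsey_length (Suc t) k N' (card ?V) K"
    using GR by blast
  show ?case
  proof (intro exI[of _ "Suc K"] allI impI)
    fix \<kappa> :: "nat \<Rightarrow> nat list \<Rightarrow> nat"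
    assume \<kappa>: "\<forall>x<p. \<forall>w\<in>words t (Suc k) (Suc K). \<kappa> x w < r"
    (* Words that start with the first parameter: one application of the hypothesis makes their color
       independent of the rest. *)
    define vec where "vec v = map (\<lambda>x. \<kappa> x (t # v)) [0..<p]" for v
    have vec_V: "vec v \<in> ?V" if "v \<in> words (Suc t) k K" for v
    proof -
      have "t # v \<in> words t (Suc k) (Suc K)" using that by (simp add: words_def)
      then show ?thesis using \<kappa> by (auto simp: vec_def)
    qed
    obtain h c where h: "h \<in> words (Suc t) N' K"
      and c: "\<And>g. g \<in> words (Suc t) k N' \<Longrightarrow> vec (substitute (Suc t) g h) = c"
      by (rule ramsey_length_finite_colours[where \<kappa> = vec, OF K card_vectors(1)]) (erule vec_V, blast)
    define e where "e = t # h"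
    have e: "e \<in> words t (Suc N') (Suc K)"
      using h by (simp add: e_def words_def)
    (* A word that starts with a letter a is replaced by its tail, and a joins the index x. The pair
       (x, a) is coded by x * t + a. *)
    define \<kappa>' where "\<kappa>' y w = \<kappa> (y div t) (substitute t ((y mod t) # w) e)" for y w
    have "\<forall>y<p * t. \<forall>w\<in>words t (Suc k) N'. \<kappa>' y w < r"
    proof (intro allI impI ballI)
      fix y w assume "y < p * t" "w \<in> words t (Suc k) N'"
      then have "y div t < p" "(y mod t) # w \<in> words t (Suc k) (Suc N')"
        using t by (auto simp: words_def less_mult_imp_div_less)
      then show "\<kappa>' y w < r"
        using \<kappa> substitute_words[OF e] by (simp add: \<kappa>'_def)
    qed
    then obtain f' where f': "f' \<in> words t M N'" and
      f'e: "\<And>x g g'. x<p * t \<Longrightarrow> g\<in>words t (Suc k) M \<Longrightarrow> g'\<in>words t (Suc k) M \<Longrightarrow>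
       below t g = below t g' \<Longrightarrow>
       \<kappa>' x (substitute t g f') = \<kappa>' x (substitute t g' f')"
      using N'[rule_format, of \<kappa>'] by blast
    define d where "d = t # map (\<lambda>a. if a < t then a else Suc a) f'"
    have d: "d \<in> words t (Suc M) (Suc N')"
      using f' growth_shift[of t "t + M" f' t] by (simp add: d_def words_def)
    have sd: "substitute t (a # w) d = a # substitute t w f'" for a w
      by (auto simp: d_def substitute_def Suc_diff_le)
    show "\<exists>f\<in>words t (Suc M) (Suc K). \<forall>x<p. \<forall>g\<in>words t (Suc k) (Suc M). \<forall>g'\<in>words t (Suc k) (Suc M).
       below t g = below t g' \<longrightarrow>
       \<kappa> x (substitute t g f) = \<kappa> x (substitute t g' f)"
    proof (intro bexI[OF _ substitute_words[OF e d]] allI impI ballI)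
      fix x g g'
      assume x: "x < p" and g: "g \<in> words t (Suc k) (Suc M)" "g' \<in> words t (Suc k) (Suc M)"
        and eq: "below t g = below t g'"
      obtain a w where aw: "g = a # w" using g by (cases g) (auto simp: words_def)
      obtain a' w' where aw': "g' = a' # w'" using g by (cases g') (auto simp: words_def)
      have red: "substitute t g (substitute t d e) = substitute t (a # substitute t w f') e"
        "substitute t g' (substitute t d e) = substitute t (a' # substitute t w' f') e"
        using substitute_assoc_words[OF e, of d] d by (simp_all add: words_def aw aw' sd)
      show "\<kappa> x (substitute t g (substitute t d e)) = \<kappa> x (substitute t g' (substitute t d e))"
      proof (cases "a < t")
        case True
        then have a': "a' = a" and w: "w \<in> words t (Suc k) M" "w' \<in> words t (Suc k) M"
          "below t w = below t w'"
          using eq g by (auto simp: aw aw' words_def split: if_splits)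
        have "x * t + a < p * t"
          using mult_le_mono1[of "Suc x" p t] x True by simp
        moreover have "(x * t + a) div t = x" "(x * t + a) mod t = a"
          using True by auto
        ultimately show ?thesis
          using f'e[of "x * t + a" w w'] w unfolding red a' by (simp add: \<kappa>'_def)
      next
        case False
        then have "a = t" "growth (Suc t) (Suc t + k) w" "a' = t" "growth (Suc t) (Suc t + k) w'"
          using eq g by (auto simp: aw aw' words_def split: if_splits)
        then have a: "a = t" "a' = t" and w: "w \<in> words (Suc t) k M" "w' \<in> words (Suc t) k M"
          using g by (auto simp: words_def aw aw')
        have const: "\<kappa> x (substitute t (t # substitute t v f') e) = c ! x" if "v \<in> words (Suc t) k M" for v
        proof -
          have "substitute t v f' \<in> words (Suc t) k N'"
            using f' that growth_substitute[of t 0 M f' v "Suc t" "Suc t + k"]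
            by (simp add: words_def)
          moreover have "substitute t (t # v') h = substitute (Suc t) v' h" for v'
            by (auto simp: substitute_def nth_Cons')
          ultimately show ?thesis
            using arg_cong[OF c, of "substitute t v f'" "\<lambda>v. v ! x"] x by (simp add: vec_def e_def)
        qed
        then show ?thesis unfolding red a using w by simp
      qed
    qed
  qed
qed

text \<open>
  The second half of that step concerns colorings of the words that precede the first parameter. They are
  words without parameters, and the Hales-Jewett theorem makes their color depend only on the number \<open>i\<close>
  of parameters of \<open>f\<close> that have been replaced by letters.
\<close>

lemma prefix_levels:
  assumes t: "t \<ge> 1"
  shows "\<exists>N. \<forall>\<kappa> :: nat list \<Rightarrow> nat. (\<forall>u. \<kappa> u < r) \<longrightarrow>
    (\<exists>f\<in>words t M N. \<forall>i<M. \<forall>u\<in>words t 0 i. \<forall>u'\<in>words t 0 i.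
       \<kappa> (substitute t u (below (t + i) f)) = \<kappa> (substitute t u' (below (t + i) f)))"
proof (induction M)
  case 0
  have "[] \<in> words t 0 0" by (simp add: words_def)
  then show ?case by (intro exI[of _ 0]) auto
next
  case (Suc M)
  obtain N' where N': "\<forall>\<kappa> :: nat list \<Rightarrow> nat. (\<forall>u. \<kappa> u < r) \<longrightarrow>
    (\<exists>f\<in>words t M N'. \<forall>i<M. \<forall>u\<in>words t 0 i. \<forall>u'\<in>words t 0 i.
       \<kappa> (substitute t u (below (t + i) f)) = \<kappa> (substitute t u' (below (t + i) f)))"
    by (rule exE[OF Suc.IH])
  obtain K where K: "ramsey_length t 0 N' r K"
    using Hales_Jewett[OF t] by blast
  show ?case
  proof (intro exI[of _ "Suc K"] allI impI)
    fix \<kappa> :: "nat list \<Rightarrow> nat"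
    assume \<kappa>: "\<forall>u. \<kappa> u < r"
    obtain h c where h: "h \<in> words t N' K" and c: "\<And>g. g\<in>words t 0 N' \<Longrightarrow> \<kappa> (substitute t g h) = c"
      using K[unfolded ramsey_length_def, rule_format, of \<kappa>] \<kappa> by blast
    (* The lower levels are colored through h; the substitution that treats them keeps the top level
       constant, because h makes all words of full length equal in color. *)
    define \<kappa>' where "\<kappa>' u = \<kappa> (substitute t u (below (t + length u) h))" for u
    have \<kappa>': "\<forall>u. \<kappa>' u < r"
      using \<kappa> by (simp add: \<kappa>'_def)
    obtain f' where f': "f' \<in> words t M N'" and
      f'e: "\<And>i u u'. i < M \<Longrightarrow> u \<in> words t 0 i \<Longrightarrow> u' \<in> words t 0 i \<Longrightarrow>
        \<kappa>' (substitute t u (below (t + i) f')) = \<kappa>' (substitute t u' (below (t + i) f'))"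
      using mp[OF spec[OF N', of \<kappa>']] \<kappa>' by blast
    define b where "b = substitute t f' h"
    have b: "b \<in> words t M K" using substitute_words[OF h f'] by (simp add: b_def)
    have f: "b @ [t + M] \<in> words t (Suc M) (Suc K)"
      using b by (auto simp: words_def growth_append)
    show "\<exists>f\<in>words t (Suc M) (Suc K). \<forall>i<Suc M. \<forall>u\<in>words t 0 i. \<forall>u'\<in>words t 0 i.
       \<kappa> (substitute t u (below (t + i) f)) = \<kappa> (substitute t u' (below (t + i) f))"
    proof (intro bexI[OF _ f] allI impI ballI)
      fix i u u' assume i: "i < Suc M" and u: "u \<in> words t 0 i" "u' \<in> words t 0 i"
      show "\<kappa> (substitute t u (below (t + i) (b @ [t + M]))) =
        \<kappa> (substitute t u' (below (t + i) (b @ [t + M])))"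
      proof (cases "i = M")
        case True
        have tb: "below (t + M) (b @ [t + M]) = b"
          using words_set[OF b] by (intro below_append) auto
        have "\<kappa> (substitute t v b) = c" if "v \<in> words t 0 M" for v
          using c[OF substitute_words[OF f' that]] substitute_assoc_words[OF h, of f' v] f'
          by (simp add: b_def words_def)
        then show ?thesis using u unfolding True tb by simp
      next
        case False
        then have iM: "i < M" using i by simp
        let ?P = "below (t + i) f'"
        let ?h = "below (t + length ?P) h"
        have "below (t + i) (b @ [t + M]) = below (t + i) b"
        proof -
          have "growth t (t + M) b" using b by (simp add: words_def)
          then have "t + i \<in> set b"
            by (rule growth_split[where b = "t + i"]) (use iM in auto)
          then show ?thesis by (intro takeWhile_append1) auto
        qed
        also have "\<dots> = substitute t ?P ?h"
          unfolding b_def by (rule below_substitute(1)[OF h f' iM])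
        finally have *: "below (t + i) (b @ [t + M]) = substitute t ?P ?h" .
        have "\<kappa> (substitute t v (substitute t ?P ?h)) = \<kappa>' (substitute t v ?P)" for v
          unfolding \<kappa>'_def length_substitute
          using set_takeWhileD[of _ "\<lambda>a. a < t + length ?P" h] by (subst substitute_assoc) auto
        then show ?thesis unfolding * using f'e[OF iM u] by simp
      qed
    qed
  qed
qed

text \<open>
  The witness \<open>g\<close> has its parameters at the positions in \<open>S\<close> and an arbitrary fixed letter elsewhere.
\<close>

lemma select_levels:
  assumes t: "t \<ge> 1"
  shows "\<exists>g\<in>words t (card (S \<inter> {..<M})) M. \<forall>j<card (S \<inter> {..<M}). length (below (t + j) g) \<in> S"
proof (induction M)
  case 0
  then show ?case by (auto simp: words_def)
next
  case (Suc M)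
  let ?c = "card (S \<inter> {..<M})"
  obtain g where g: "g \<in> words t ?c M" and gS: "\<forall>j<?c. length (below (t + j) g) \<in> S"
    using Suc by blast
  have keep: "below (t + j) (g @ v) = below (t + j) g" if "j < ?c" for j v
  proof -
    have "growth t (t + ?c) g" using g by (simp add: words_def)
    then have "t + j \<in> set g"
      by (rule growth_split[where b = "t + j"]) (use that in auto)
    then show ?thesis by (intro takeWhile_append1) auto
  qed
  show ?case
  proof (cases "M \<in> S")
    case True
    then have c: "card (S \<inter> {..<Suc M}) = Suc ?c"
      by (simp add: lessThan_Suc)
    have "below (t + ?c) (g @ [t + ?c]) = g"
      using words_set[OF g] by (intro below_append) auto
    then have "length (below (t + ?c) (g @ [t + ?c])) \<in> S"
      using True g by (simp add: words_def)
    then show ?thesis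
      unfolding c using g gS keep
      by (intro bexI[of _ "g @ [t + ?c]"]) (auto simp: less_Suc_eq words_def growth_append)
  next
    case False
    then have c: "S \<inter> {..<Suc M} = S \<inter> {..<M}"
      by (auto simp: less_Suc_eq)
    show ?thesis
      unfolding c using g gS keep t
      by (intro bexI[of _ "g @ [0]"]) (auto simp: words_def growth_append)
  qed
qed

lemma pigeonhole_level:
  assumes r: "r \<ge> 1" and "\<And>i. i < r * m \<Longrightarrow> col i < r"
  obtains c S where "S \<subseteq> {..<r * m}" "card S = m" "\<And>i. i \<in> S \<Longrightarrow> col i = (c::nat)"
proof -
  have "col \<in> {..<r * m} \<rightarrow> {..<r}" using assms by auto
  from pigeonhole_card[OF this] r obtain c where "card (col -` {c} \<inter> {..<r * m}) * r \<ge> r * m"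
    by (auto simp: lessThan_empty_iff)
  then have "m \<le> card (col -` {c} \<inter> {..<r * m})"
    using r by (simp add: mult.commute)
  then obtain S where "S \<subseteq> col -` {c} \<inter> {..<r * m}" "card S = m"
    by (meson obtain_subset_with_card_n)
  then show thesis using that by blast
qed

text \<open>
  Of \<open>r * m\<close> levels, \<open>m\<close> have the same color; the parameters of the other levels are replaced by a letter.
\<close>

lemma prefix_constant:
  assumes t: "t \<ge> 1" and r: "r \<ge> 1"
  shows "\<exists>N. \<forall>\<kappa> :: nat list \<Rightarrow> nat. (\<forall>u. \<kappa> u < r) \<longrightarrow>
    (\<exists>f\<in>words t m N. \<exists>c. \<forall>i<m. \<forall>u\<in>words t 0 i. \<kappa> (substitute t u (below (t + i) f)) = c)"
proof -
  let ?M = "r * m"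
  obtain N where N: "\<forall>\<kappa> :: nat list \<Rightarrow> nat. (\<forall>u. \<kappa> u < r) \<longrightarrow>
    (\<exists>f\<in>words t ?M N. \<forall>i<?M. \<forall>u\<in>words t 0 i. \<forall>u'\<in>words t 0 i.
       \<kappa> (substitute t u (below (t + i) f)) = \<kappa> (substitute t u' (below (t + i) f)))"
    by (rule exE[OF prefix_levels[OF t, of r ?M]])
  show ?thesis
  proof (intro exI[of _ N] allI impI)
    fix \<kappa> :: "nat list \<Rightarrow> nat"
    assume \<kappa>: "\<forall>u. \<kappa> u < r"
    obtain f where f: "f \<in> words t ?M N" and const: "\<And>i u u'. i < ?M \<Longrightarrow> u \<in> words t 0 i \<Longrightarrow> u' \<in> words t 0 i \<Longrightarrow>
      \<kappa> (substitute t u (below (t + i) f)) = \<kappa> (substitute t u' (below (t + i) f))"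
      using mp[OF spec[OF N, of \<kappa>] \<kappa>] by blast
    define col where "col i = \<kappa> (substitute t (replicate i 0) (below (t + i) f))" for i
    have "col i < r" for i using \<kappa> by (simp add: col_def)
    then obtain c S where S: "S \<subseteq> {..<?M}" "card S = m" and col: "\<And>i. i \<in> S \<Longrightarrow> col i = c"
      using pigeonhole_level[OF r, of m col] by blast
    have Sm: "card (S \<inter> {..<?M}) = m" using S by (simp add: inf_absorb1)
    obtain g where g: "g \<in> words t m ?M" and gS: "\<And>j. j < m \<Longrightarrow> length (below (t + j) g) \<in> S"
      using select_levels[OF t, of S ?M] unfolding Sm by blast
    show "\<exists>f\<in>words t m N. \<exists>c. \<forall>i<m. \<forall>u\<in>words t 0 i. \<kappa> (substitute t u (below (t + i) f)) = c"
    proof (intro bexI[OF _ substitute_words[OF f g]] exI[of _ c] allI impI ballI)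
      fix j u assume j: "j < m" and u: "u \<in> words t 0 j"
      let ?P = "below (t + j) g"
      let ?i = "length ?P"
      let ?f = "below (t + ?i) f"
      have eq: "below (t + j) (substitute t g f) = substitute t ?P ?f"
        by (rule below_substitute(1)[OF f g j])
      have "?i < ?M" by (rule below_substitute(2)[OF f g j])
      have "growth t (t + m) g" using g by (simp add: words_def)
      then have "growth t (t + j) ?P"
        by (rule growth_split[where b = "t + j"]) (use j in auto)
      then have "?P \<in> words t j ?i" by (simp add: words_def)
      then have uP: "substitute t u ?P \<in> words t 0 ?i" using substitute_words u by blast
      have "substitute t u (substitute t ?P ?f) = substitute t (substitute t u ?P) ?f"
        using set_takeWhileD[of _ "\<lambda>a. a < t + ?i" f] by (intro substitute_assoc) auto
      moreover have "replicate ?i 0 \<in> words t 0 ?i" using t by (auto simp: words_0)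
      ultimately have "\<kappa> (substitute t u (substitute t ?P ?f)) = col ?i"
        using const[OF \<open>?i < ?M\<close> uP] by (simp add: col_def)
      then show "\<kappa> (substitute t u (below (t + j) (substitute t g f))) = c"
        unfolding eq using col[OF gS[OF j]] by simp
    qed
  qed
qed

text \<open>
  After \<open>tail_constant\<close> the color of a word depends only on the part before its first parameter, and
  \<open>prefix_constant\<close> removes this dependence.
\<close>

theorem Graham_Rothschild:
  assumes "t \<ge> 1"
  shows "\<exists>N. ramsey_length t k m r N"
  using assms
proof (induction k arbitrary: t m r)
  case 0
  then show ?case by (rule Hales_Jewett)
next
  case (Suc k)
  note t = Suc.prems
  obtain M where M: "\<forall>\<kappa> :: nat list \<Rightarrow> nat. (\<forall>u. \<kappa> u < Suc r) \<longrightarrow>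
    (\<exists>f\<in>words t m M. \<exists>c. \<forall>i<m. \<forall>u\<in>words t 0 i. \<kappa> (substitute t u (below (t + i) f)) = c)"
    by (rule exE[OF prefix_constant[OF t, of "Suc r" m]]) auto
  have IH: "\<exists>N. ramsey_length (Suc t) k m r N" for m r
    using Suc.IH by simp
  obtain N where N: "\<forall>\<kappa> :: nat \<Rightarrow> nat list \<Rightarrow> nat. (\<forall>x<1. \<forall>w\<in>words t (Suc k) N. \<kappa> x w < r) \<longrightarrow>
    (\<exists>f\<in>words t M N. \<forall>x<1. \<forall>g\<in>words t (Suc k) M. \<forall>g'\<in>words t (Suc k) M.
       below t g = below t g' \<longrightarrow>
       \<kappa> x (substitute t g f) = \<kappa> x (substitute t g' f))"
    by (rule exE[OF tail_constant[OF t IH, of 1 r M]])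
  have "ramsey_length t (Suc k) m r N"
    unfolding ramsey_length_def
  proof (intro allI impI)
    fix \<kappa> :: "nat list \<Rightarrow> nat"
    assume \<kappa>: "\<forall>w\<in>words t (Suc k) N. \<kappa> w < r"
    obtain f where f: "f \<in> words t M N" and
      tail: "\<And>g g'. g\<in>words t (Suc k) M \<Longrightarrow> g'\<in>words t (Suc k) M \<Longrightarrow>
       below t g = below t g' \<Longrightarrow> \<kappa> (substitute t g f) = \<kappa> (substitute t g' f)"
      using spec[OF N, of "\<lambda>_. \<kappa>"] \<kappa> by auto
    (* The common color of the words with prefix u. Prefixes that do not occur get the default color 0,
       which is why prefix_constant is used with Suc r colors. *)
    define \<psi> where "\<psi> u = (if \<exists>g\<in>words t (Suc k) M. below t g = u
      then \<kappa> (substitute t (SOME g. g\<in>words t (Suc k) M \<and> below t g = u) f) else 0)" for u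
    have \<psi>: "\<psi> (below t g) = \<kappa> (substitute t g f)" if "g \<in> words t (Suc k) M" for g
    proof -
      let ?Q = "\<lambda>g'. g' \<in> words t (Suc k) M \<and> below t g' = below t g"
      have "?Q (SOME g'. ?Q g')" by (rule someI[of ?Q g]) (use that in simp)
      then show ?thesis
        using tail[of "SOME g'. ?Q g'" g] that unfolding \<psi>_def by auto
    qed
    have "\<psi> u < Suc r" for u
    proof (cases "\<exists>g\<in>words t (Suc k) M. below t g = u")
      case True
      then obtain g where "g \<in> words t (Suc k) M" "below t g = u" by blast
      then show ?thesis using \<psi>[of g] \<kappa> substitute_words[OF f] by (simp add: less_SucI)
    next
      case False
      then show ?thesis by (simp add: \<psi>_def)
    qed
    then obtain h c where h: "h \<in> words t m M" and
      hc: "\<And>i u. i < m \<Longrightarrow> u \<in> words t 0 i \<Longrightarrow> \<psi> (substitute t u (below (t + i) h)) = c"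
      using mp[OF spec[OF M, of \<psi>]] by blast
    show "\<exists>f\<in>words t m N. \<exists>c. \<forall>g\<in>words t (Suc k) m. \<kappa> (substitute t g f) = c"
    proof (intro bexI[OF _ substitute_words[OF f h]] exI[of _ c] ballI)
      fix g assume g: "g \<in> words t (Suc k) m"
      let ?u = "below t g"
      have "growth t (t + Suc k) g" using g by (simp add: words_def)
      then have "growth t t ?u"
        by (rule growth_split[where b = t]) auto
      then have u: "?u \<in> words t 0 (length ?u)" by (simp add: words_def)
      have len: "length ?u < m" and
        tw: "below t (substitute t g h) = substitute t ?u (below (t + length ?u) h)"
        using below_substitute[OF h g, of 0] by auto
      have "\<kappa> (substitute t (substitute t g h) f) = \<psi> (below t (substitute t g h))"
        using \<psi>[OF substitute_words[OF h g]] by simp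
      also have "\<dots> = c" unfolding tw by (rule hc[OF len u])
      finally show "\<kappa> (substitute t g (substitute t h f)) = c"
        using substitute_assoc_words[OF f, of h g] h by (simp add: words_def)
    qed
  qed
  then show ?case by blast
qed

text \<open>
  The colorings are made constant one after the other; a length that works for one of them is the target
  dimension for those that are treated before.
\<close>

lemma Graham_Rothschild_simultaneous:
  assumes t: "t \<ge> 1"
  shows "\<exists>N. \<forall>\<kappa> :: nat \<Rightarrow> nat list \<Rightarrow> bool. \<exists>f\<in>words t m N.
    \<forall>j<length ks. \<forall>g\<in>words t (ks ! j) m. \<forall>g'\<in>words t (ks ! j) m. \<kappa> j (substitute t g f) = \<kappa> j (substitute t g' f)"
proof (induction ks arbitrary: m)
  case Nil
  have "[t..<t + m] \<in> words t m m" using growth_upt by (simp add: words_def)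
  then show ?case by (intro exI[of _ m]) auto
next
  case (Cons k ks)
  obtain M where M: "ramsey_length t k m (card (UNIV :: bool set)) M"
    using Graham_Rothschild[OF t] by blast
  obtain N where N: "\<forall>\<kappa> :: nat \<Rightarrow> nat list \<Rightarrow> bool. \<exists>f\<in>words t M N.
    \<forall>j<length ks. \<forall>g\<in>words t (ks ! j) M. \<forall>g'\<in>words t (ks ! j) M. \<kappa> j (substitute t g f) = \<kappa> j (substitute t g' f)"
    by (rule exE[OF Cons.IH[of M]])
  show ?case
  proof (intro exI[of _ N] allI)
    fix \<kappa> :: "nat \<Rightarrow> nat list \<Rightarrow> bool"
    obtain f where f: "f \<in> words t M N" and
      fc: "\<And>j g g'. j < length ks \<Longrightarrow> g \<in> words t (ks ! j) M \<Longrightarrow> g' \<in> words t (ks ! j) M \<Longrightarrow>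
        \<kappa> (Suc j) (substitute t g f) = \<kappa> (Suc j) (substitute t g' f)"
      using spec[OF N, of "\<lambda>j. \<kappa> (Suc j)"] by blast
    obtain h c where h: "h \<in> words t m M" and hc: "\<And>g. g \<in> words t k m \<Longrightarrow> \<kappa> 0 (substitute t (substitute t g h) f) = c"
      by (rule ramsey_length_finite_colours[where \<kappa> = "\<lambda>w. \<kappa> 0 (substitute t w f)", OF M]) auto
    have assoc: "substitute t g (substitute t h f) = substitute t (substitute t g h) f" for g
      using substitute_assoc_words[OF f] h by (simp add: words_def)
    show "\<exists>f\<in>words t m N. \<forall>j<length (k # ks). \<forall>g\<in>words t ((k # ks) ! j) m. \<forall>g'\<in>words t ((k # ks) ! j) m.
      \<kappa> j (substitute t g f) = \<kappa> j (substitute t g' f)"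
    proof (intro bexI[OF _ substitute_words[OF f h]] allI impI ballI)
      fix j g g'
      assume j: "j < length (k # ks)" "g \<in> words t ((k # ks) ! j) m" "g' \<in> words t ((k # ks) ! j) m"
      show "\<kappa> j (substitute t g (substitute t h f)) = \<kappa> j (substitute t g' (substitute t h f))"
      proof (cases j)
        case 0
        then show ?thesis using hc j by (simp add: assoc)
      next
        case (Suc i)
        then show ?thesis using fc[of i "substitute t g h" "substitute t g' h"] j substitute_words[OF h] by (simp add: assoc)
      qed
    qed
  qed
qed

section \<open>The Vietoris topology\<close>

text \<open>
  Alexander's subbase theorem for a topology given by generators.
\<close>

lemma compact_space_generated_subbase:
  assumes fin: "\<And>\<C>. \<C> \<subseteq> \<B> \<Longrightarrow> \<Union>\<C> = \<Union>\<B> \<Longrightarrow> \<exists>\<F>. finite \<F> \<and> \<F> \<subseteq> \<C> \<and> \<Union>\<F> = \<Union>\<B>"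
  shows "compact_space (topology_generated_by \<B>)"
proof (rule Alexander_subbase)
  let ?P = "arbitrary union_of (finite intersection_of (\<lambda>x. x \<in> \<B>) relative_to \<Union>\<B>)"
  have "?P = generate_topology_on \<B>"
  proof (intro ext iffI)
    fix s assume "?P s"
    moreover have "generate_topology_on \<B> u"
      if u: "(finite intersection_of (\<lambda>x. x \<in> \<B>) relative_to \<Union>\<B>) u" for u
    proof -
      obtain \<F> where \<F>: "finite \<F>" "\<F> \<subseteq> \<B>" "u = \<Union>\<B> \<inter> \<Inter>\<F>"
        using u by (auto simp: relative_to_def intersection_of_def)
      have top: "generate_topology_on \<B> (\<Union>\<B>)"
        by (intro generate_topology_on.UN generate_topology_on.Basis)
      show ?thesis
      proof (cases "\<F> = {}")
        case True
        then show ?thesis using \<F> top by simp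
      next
        case False
        then have "generate_topology_on \<B> (\<Inter>\<F>)"
          using \<F> by (intro generate_topology_on_Inter) (auto intro: generate_topology_on.Basis)
        then show ?thesis using \<F> top by (auto intro: generate_topology_on.Int)
      qed
    qed
    ultimately show "generate_topology_on \<B> s"
      unfolding union_of_def by (auto intro: generate_topology_on.UN)
  next
    fix s assume "generate_topology_on \<B> s"
    then show "?P s"
    proof (rule generate_topology_on_coarsest[rotated -1])
      show "istopology ?P" by (rule istopology_subbase)
      fix s assume "s \<in> \<B>"
      then have "(finite intersection_of (\<lambda>x. x \<in> \<B>) relative_to \<Union>\<B>) (\<Union>\<B> \<inter> s)"
        by (intro relative_to_inc) (auto simp: intersection_of_def intro!: exI[of _ "{s}"])
      moreover have "\<Union>\<B> \<inter> s = s" using \<open>s \<in> \<B>\<close> by blast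
      ultimately show "?P s" by (metis arbitrary_union_of_inc)
    qed
  qed
  then show "topology ?P = topology_generated_by \<B>"
    by simp
qed (use fin in simp)

lemma vietoris_subbaseE:
  assumes "s \<in> {{F \<in> hyperspace X. F \<subseteq> U} | U. openin X U} \<union>
     {{F \<in> hyperspace X. F \<inter> U \<noteq> {}} | U. openin X U}"
  obtains (subset) U where "openin X U" "s = {F \<in> hyperspace X. F \<subseteq> U}"
    | (meets) U where "openin X U" "s = {F \<in> hyperspace X. F \<inter> U \<noteq> {}}"
  using assms by (elim UnE CollectE exE conjE) (erule that(1) that(2), assumption)+

lemma openin_vietoris_subset: "openin X U \<Longrightarrow> openin (vietoris X) {F \<in> hyperspace X. F \<subseteq> U}"
  unfolding vietoris_def by (rule topology_generated_by_Basis) blast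

lemma openin_vietoris_meets: "openin X U \<Longrightarrow> openin (vietoris X) {F \<in> hyperspace X. F \<inter> U \<noteq> {}}"
  unfolding vietoris_def by (rule topology_generated_by_Basis) blast

lemma Union_vietoris_subbase:
  "\<Union>({{F \<in> hyperspace X. F \<subseteq> U} | U. openin X U} \<union>
     {{F \<in> hyperspace X. F \<inter> U \<noteq> {}} | U. openin X U}) = hyperspace X"
  using topspace_vietoris[of X] unfolding vietoris_def topology_generated_by_topspace .

text \<open>
  Let a cover consist of sets \<open>F \<subseteq> U\<close> and \<open>F \<inter> V \<noteq> {}\<close>. The closed set \<open>K\<close> that remains after
  removing all \<open>V\<close> meets none of them, so if it is nonempty it lies in some \<open>U\<close> of the cover; finitely
  many \<open>V\<close> cover the complement of this \<open>U\<close>, and they suffice together with it.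
\<close>

lemma compact_space_vietoris:
  assumes X: "compact_space X"
  shows "compact_space (vietoris X)"
  unfolding vietoris_def
proof (rule compact_space_generated_subbase)
  let ?sub = "\<lambda>U. {F \<in> hyperspace X. F \<subseteq> U}" and ?meets = "\<lambda>U. {F \<in> hyperspace X. F \<inter> U \<noteq> {}}"
  let ?B = "{?sub U | U. openin X U} \<union> {?meets U | U. openin X U}"
  have UB: "\<Union>?B = hyperspace X"
    by (rule Union_vietoris_subbase)
  fix \<C> assume "\<C> \<subseteq> ?B" and cov: "\<Union>\<C> = \<Union>?B"
  have \<C>: "(\<exists>U. openin X U \<and> C = ?sub U) \<or> (\<exists>U. openin X U \<and> C = ?meets U)" if "C \<in> \<C>" for C
    by (rule vietoris_subbaseE[OF subsetD[OF \<open>\<C> \<subseteq> ?B\<close> that]]) blast+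
  define \<V> where "\<V> = {V. openin X V \<and> ?meets V \<in> \<C>}"
  define K where "K = topspace X - \<Union>\<V>"
  have K: "closedin X K"
    unfolding K_def by (intro closedin_diff closedin_topspace openin_Union) (simp add: \<V>_def)
  have "\<exists>U. openin X U \<and> K \<subseteq> U \<and> (?sub U \<in> \<C> \<or> U = {})"
  proof (cases "K = {}")
    case True
    then show ?thesis by (auto intro: exI[of _ "{}"])
  next
    case False
    then have "K \<in> \<Union>\<C>" using cov UB K by (simp add: hyperspace_def)
    then obtain C where "C \<in> \<C>" "K \<in> C" by blast
    have "\<exists>U. openin X U \<and> C = ?sub U"
    proof (rule ccontr)
      assume "\<not> ?thesis"
      then obtain V where "openin X V" "C = ?meets V" using \<C>[OF \<open>C \<in> \<C>\<close>] by blast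
      then have "V \<in> \<V>" "K \<inter> V \<noteq> {}" using \<open>C \<in> \<C>\<close> \<open>K \<in> C\<close> by (simp_all add: \<V>_def)
      then show False by (auto simp: K_def)
    qed
    then show ?thesis using \<open>C \<in> \<C>\<close> \<open>K \<in> C\<close> by blast
  qed
  then obtain U where U: "openin X U" "K \<subseteq> U" "?sub U \<in> \<C> \<or> U = {}" by blast
  have "compactin X (topspace X - U)"
    using X U(1) by (intro closedin_compact_space) auto
  moreover have "topspace X - U \<subseteq> \<Union>\<V>" using U(2) by (auto simp: K_def)
  ultimately obtain \<F> where \<F>: "finite \<F>" "\<F> \<subseteq> \<V>" "topspace X - U \<subseteq> \<Union>\<F>"
    using compactinD[of X "topspace X - U" \<V>] by (auto simp: \<V>_def)
  define \<G> where "\<G> = (if U = {} then {} else {?sub U}) \<union> ?meets ` \<F>"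
  have "\<G> \<subseteq> \<C>" using U(3) \<F>(2) by (auto simp: \<G>_def \<V>_def)
  moreover have "hyperspace X \<subseteq> \<Union>\<G>"
  proof
    fix F assume F: "F \<in> hyperspace X"
    show "F \<in> \<Union>\<G>"
    proof (cases "F \<subseteq> U")
      case True
      then have "U \<noteq> {}" using F by (auto simp: hyperspace_def)
      then have "?sub U \<in> \<G>" by (simp add: \<G>_def)
      then show ?thesis using F True by blast
    next
      case False
      then obtain y where y: "y \<in> F" "y \<in> topspace X - U"
        using F by (auto simp: hyperspace_def dest: closedin_subset)
      then obtain V where "V \<in> \<F>" "y \<in> V" using \<F>(3) by blast
      then have "?meets V \<in> \<G>" "F \<in> ?meets V" using F y by (auto simp: \<G>_def)
      then show ?thesis by blast
    qed
  qed
  moreover have "\<Union>\<G> \<subseteq> hyperspace X" by (auto simp: \<G>_def split: if_splits)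
  moreover have "finite \<G>" using \<F>(1) by (simp add: \<G>_def)
  ultimately show "\<exists>\<F>. finite \<F> \<and> \<F> \<subseteq> \<C> \<and> \<Union>\<F> = \<Union>?B"
    unfolding UB by (metis subset_antisym)
qed

lemma Hausdorff_space_vietoris:
  assumes X: "regular_space X"
  shows "Hausdorff_space (vietoris X)"
proof -
  have sep: "\<exists>U V. openin (vietoris X) U \<and> openin (vietoris X) V \<and> F \<in> U \<and> F' \<in> V \<and> disjnt U V"
    if F: "F \<in> hyperspace X" "F' \<in> hyperspace X" and a: "a \<in> F" "a \<notin> F'" for F F' a
  proof -
    have "a \<in> topspace X - F'" "closedin X F'"
      using F a by (auto simp: hyperspace_def dest: closedin_subset)
    then obtain U V where UV: "openin X U" "openin X V" "a \<in> U" "F' \<subseteq> V" "disjnt U V"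
      using X[unfolded regular_space_def, rule_format, of F' a] by blast
    show ?thesis
    proof (intro exI conjI)
      show "openin (vietoris X) {F \<in> hyperspace X. F \<inter> U \<noteq> {}}" by (rule openin_vietoris_meets[OF UV(1)])
      show "openin (vietoris X) {F \<in> hyperspace X. F \<subseteq> V}" by (rule openin_vietoris_subset[OF UV(2)])
    qed (use F a UV in \<open>auto simp: disjnt_def\<close>)
  qed
  show ?thesis
    unfolding Hausdorff_space_def topspace_vietoris
  proof (intro allI impI, elim conjE)
    fix F F' assume F: "F \<in> hyperspace X" "F' \<in> hyperspace X" "F \<noteq> F'"
    then consider a where "a \<in> F" "a \<notin> F'" | a where "a \<in> F'" "a \<notin> F" by blast
    then show "\<exists>U V. openin (vietoris X) U \<and> openin (vietoris X) V \<and> F \<in> U \<and> F' \<in> V \<and> disjnt U V"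
    proof cases
      case 1 then show ?thesis by (rule sep[OF F(1,2)])
    next
      case 2 then show ?thesis using sep[OF F(2,1) 2] disjnt_sym by blast
    qed
  qed
qed

lemma subset_maxchain_iff:
  "subset.maxchain \<A> M \<longleftrightarrow> M \<subseteq> \<A> \<and> (\<forall>F\<in>M. \<forall>N\<in>M. F \<subseteq> N \<or> N \<subseteq> F) \<and>
    (\<forall>F\<in>\<A>. (\<forall>N\<in>M. F \<subseteq> N \<or> N \<subseteq> F) \<longrightarrow> F \<in> M)"
proof (intro iffI conjI ballI impI)
  assume M: "subset.maxchain \<A> M"
  then have c: "subset.chain \<A> M" and max: "\<And>S. subset.chain \<A> S \<Longrightarrow> \<not> M \<subset> S"
    by (auto simp: subset.maxchain_def)
  show "M \<subseteq> \<A>" using c by (simp add: subset_chain_def)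
  show "F \<subseteq> N \<or> N \<subseteq> F" if "F \<in> M" "N \<in> M" for F N
    using c that by (auto simp: subset_chain_def)
  fix F assume "F \<in> \<A>" "\<forall>N\<in>M. F \<subseteq> N \<or> N \<subseteq> F"
  then have "subset.chain \<A> (insert F M)"
    using c by (auto simp: subset_chain_insert)
  then show "F \<in> M" using max by blast
next
  assume M: "M \<subseteq> \<A> \<and> (\<forall>F\<in>M. \<forall>N\<in>M. F \<subseteq> N \<or> N \<subseteq> F) \<and>
    (\<forall>F\<in>\<A>. (\<forall>N\<in>M. F \<subseteq> N \<or> N \<subseteq> F) \<longrightarrow> F \<in> M)"
  have "\<not> M \<subset> S" if "subset.chain \<A> S" for S
  proof
    assume "M \<subset> S"
    then obtain F where F: "F \<in> S" "F \<notin> M" by blast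
    have "F \<in> \<A>" using that F(1) by (auto simp: subset_chain_def)
    moreover have "F \<subseteq> N \<or> N \<subseteq> F" if "N \<in> M" for N
    proof -
      have "N \<in> S" using that \<open>M \<subset> S\<close> by blast
      then show ?thesis using \<open>subset.chain \<A> S\<close> F(1) unfolding subset_chain_def by simp
    qed
    ultimately have "F \<in> M" using M by simp
    then show False using F(2) by simp
  qed
  moreover have "subset.chain \<A> M" using M by (simp add: subset_chain_def)
  ultimately show "subset.maxchain \<A> M"
    unfolding subset.maxchain_def by simp
qed

lemma compact_chain_Inter_nonempty:
  assumes "compact_space X" "\<C> \<noteq> {}" and cl: "\<And>C. C \<in> \<C> \<Longrightarrow> closedin X C \<and> C \<noteq> {}"
    and ch: "\<And>C D. C \<in> \<C> \<Longrightarrow> D \<in> \<C> \<Longrightarrow> C \<subseteq> D \<or> D \<subseteq> C"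
  shows "\<Inter>\<C> \<noteq> {}"
proof -
  have "\<Inter>\<F> \<noteq> {}" if "finite \<F>" "\<F> \<subseteq> \<C>" for \<F>
  proof (cases "\<F> = {}")
    case False
    have "subset.chain UNIV \<F>" using ch that by (auto simp: subset_chain_def)
    then have "\<Inter>\<F> \<in> \<F>" using that False by (intro Inter_in_chain)
    then show ?thesis using cl that by blast
  qed simp
  then show ?thesis
    using assms(1)[unfolded compact_space_fip, rule_format, of \<C>] cl by simp
qed

text \<open>
  Membership of limits of monotone nets of closed sets. The relation \<open>prec\<close> directs the net; convergence
  has to be checked on the subbase only, because a totally ordered net eventually enters intersections of
  sets that it eventually enters.
\<close>

lemma closed_vietoris_limit:
  assumes M: "closedin (vietoris X) M" and N: "\<N> \<subseteq> M" "\<N> \<noteq> {}"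
    and total: "\<And>C D. C \<in> \<N> \<Longrightarrow> D \<in> \<N> \<Longrightarrow> prec C D \<or> prec D C"
    and trans: "\<And>C D F. prec C D \<Longrightarrow> prec D F \<Longrightarrow> prec C F"
    and L: "L \<in> hyperspace X"
    and subset: "\<And>U. openin X U \<Longrightarrow> L \<subseteq> U \<Longrightarrow> \<exists>N\<in>\<N>. \<forall>D\<in>\<N>. prec N D \<longrightarrow> D \<subseteq> U"
    and meets: "\<And>U. openin X U \<Longrightarrow> L \<inter> U \<noteq> {} \<Longrightarrow> \<exists>N\<in>\<N>. \<forall>D\<in>\<N>. prec N D \<longrightarrow> D \<inter> U \<noteq> {}"
  shows "L \<in> M"
proof (rule ccontr)
  assume nL: "L \<notin> M"
  have hyp: "\<N> \<subseteq> hyperspace X" using N closedin_subset[OF M] by auto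
  have *: "\<exists>N\<in>\<N>. \<forall>D\<in>\<N>. prec N D \<longrightarrow> D \<in> W" if "openin (vietoris X) W" "L \<in> W" for W
  proof -
    have "generate_topology_on ({{F \<in> hyperspace X. F \<subseteq> U} | U. openin X U} \<union>
     {{F \<in> hyperspace X. F \<inter> U \<noteq> {}} | U. openin X U}) W"
      using that(1) unfolding vietoris_def by (rule openin_topology_generated_by)
    then show ?thesis using that(2)
    proof induction
      case (Int a b)
      have L: "L \<in> a" "L \<in> b" using Int.prems by simp_all
      obtain N where N: "N \<in> \<N>" "\<forall>D\<in>\<N>. prec N D \<longrightarrow> D \<in> a" by (rule bexE[OF Int.IH(1)[OF L(1)]])
      obtain N' where N': "N' \<in> \<N>" "\<forall>D\<in>\<N>. prec N' D \<longrightarrow> D \<in> b" by (rule bexE[OF Int.IH(2)[OF L(2)]])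
      from total[OF N(1) N'(1)] show ?case
      proof
        assume "prec N N'"
        then show ?thesis using N N' trans[OF \<open>prec N N'\<close>] by (intro bexI[of _ "N'"]) simp_all
      next
        assume "prec N' N"
        then show ?thesis using N N' trans[OF \<open>prec N' N\<close>] by (intro bexI[of _ "N"]) simp_all
      qed
    next
      case (UN \<K>)
      obtain k where k: "k \<in> \<K>" "L \<in> k" using UN.prems by blast
      obtain N where "N \<in> \<N>" "\<forall>D\<in>\<N>. prec N D \<longrightarrow> D \<in> k" by (rule bexE[OF UN.IH[OF k]])
      then show ?case using k(1) by (intro bexI[of _ N]) auto
    next
      case (Basis s)
      from Basis.hyps show ?case
      proof (cases rule: vietoris_subbaseE)
        case (subset U)
        then have "L \<subseteq> U" using Basis.prems by simp
        obtain N where "N \<in> \<N>" "\<forall>D\<in>\<N>. prec N D \<longrightarrow> D \<subseteq> U"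
          by (rule bexE[OF assms(7)[OF subset(1) \<open>L \<subseteq> U\<close>]])
        then show ?thesis using subset(2) hyp by (intro bexI[of _ N]) auto
      next
        case (meets U)
        then have "L \<inter> U \<noteq> {}" using Basis.prems by simp
        obtain N where "N \<in> \<N>" "\<forall>D\<in>\<N>. prec N D \<longrightarrow> D \<inter> U \<noteq> {}"
          by (rule bexE[OF assms(8)[OF meets(1) \<open>L \<inter> U \<noteq> {}\<close>]])
        then show ?thesis using meets(2) hyp by (intro bexI[of _ N]) auto
      qed
    qed simp
  qed
  have "openin (vietoris X) (topspace (vietoris X) - M)" "L \<in> topspace (vietoris X) - M"
    using openin_diff[OF openin_topspace M] nL L by simp_all
  from *[OF this] obtain N where N': "N \<in> \<N>" "\<forall>D\<in>\<N>. prec N D \<longrightarrow> D \<in> topspace (vietoris X) - M"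
    by (elim bexE)
  have "prec N N" using total[OF N'(1) N'(1)] by simp
  then show False using N' N(1) by blast
qed

lemma closed_hyperspace_chain_Union:
  assumes M: "closedin (vietoris X) M" and N: "\<N> \<subseteq> M" "\<N> \<noteq> {}"
    and ch: "\<And>C D. C \<in> \<N> \<Longrightarrow> D \<in> \<N> \<Longrightarrow> C \<subseteq> D \<or> D \<subseteq> C"
  shows "X closure_of \<Union>\<N> \<in> M"
proof (rule closed_vietoris_limit[OF M N, where prec = "(\<subseteq>)"])
  have hyp: "\<N> \<subseteq> hyperspace X" using N closedin_subset[OF M] by auto
  then have "\<Union>\<N> \<subseteq> topspace X" by (auto simp: hyperspace_def dest: closedin_subset)
  then have incl: "\<Union>\<N> \<subseteq> X closure_of \<Union>\<N>" by (rule closure_of_subset)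
  obtain N0 where N0: "N0 \<in> \<N>" "N0 \<noteq> {}" using N(2) hyp by (auto simp: hyperspace_def)
  then have "X closure_of \<Union>\<N> \<noteq> {}" using incl by blast
  then show "X closure_of \<Union>\<N> \<in> hyperspace X" by (simp add: hyperspace_def)
  fix U assume U: "openin X U"
  show "\<exists>N\<in>\<N>. \<forall>D\<in>\<N>. N \<subseteq> D \<longrightarrow> D \<subseteq> U" if "X closure_of \<Union>\<N> \<subseteq> U"
  proof -
    have "D \<subseteq> U" if "D \<in> \<N>" for D using \<open>X closure_of \<Union>\<N> \<subseteq> U\<close> incl that by auto
    then show ?thesis using N0(1) by auto
  qed
  show "\<exists>N\<in>\<N>. \<forall>D\<in>\<N>. N \<subseteq> D \<longrightarrow> D \<inter> U \<noteq> {}" if "X closure_of \<Union>\<N> \<inter> U \<noteq> {}"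
  proof -
    have "U \<inter> \<Union>\<N> \<noteq> {}" using that openin_Int_closure_of_eq_empty[OF U, of "\<Union>\<N>"] by auto
    then obtain N where "N \<in> \<N>" "N \<inter> U \<noteq> {}" by blast
    then show ?thesis by (intro bexI[of _ N]) auto
  qed
qed (use ch in auto)

lemma closed_hyperspace_chain_Inter:
  assumes X: "compact_space X" and M: "closedin (vietoris X) M" and N: "\<N> \<subseteq> M" "\<N> \<noteq> {}"
    and ch: "\<And>C D. C \<in> \<N> \<Longrightarrow> D \<in> \<N> \<Longrightarrow> C \<subseteq> D \<or> D \<subseteq> C"
  shows "\<Inter>\<N> \<in> M"
proof (rule closed_vietoris_limit[OF M N, where prec = "\<lambda>C D. D \<subseteq> C"])
  have hyp: "\<N> \<subseteq> hyperspace X" using N closedin_subset[OF M] by auto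
  then have cl: "C \<in> \<N> \<Longrightarrow> closedin X C \<and> C \<noteq> {}" for C by (auto simp: hyperspace_def)
  then show "\<Inter>\<N> \<in> hyperspace X"
    using compact_chain_Inter_nonempty[OF X N(2) cl ch] N(2)
    by (auto simp: hyperspace_def intro: closedin_Inter)
  fix U assume U: "openin X U"
  show "\<exists>N\<in>\<N>. \<forall>D\<in>\<N>. D \<subseteq> N \<longrightarrow> D \<subseteq> U" if "\<Inter>\<N> \<subseteq> U"
  proof -
    have "\<exists>N\<in>\<N>. N \<subseteq> U"
    proof (rule ccontr)
      assume no: "\<not> ?thesis"
      let ?C = "(\<lambda>N. N - U) ` \<N>"
      have "\<Inter>?C \<noteq> {}"
      proof (rule compact_chain_Inter_nonempty[OF X])
        show "C \<in> ?C \<Longrightarrow> closedin X C \<and> C \<noteq> {}" for C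
          using cl U no by (auto intro: closedin_diff)
        show "C \<subseteq> D \<or> D \<subseteq> C" if "C \<in> ?C" "D \<in> ?C" for C D
          using that ch by blast
      qed (use N in simp)
      then show False using that N(2) by auto
    qed
    then obtain N where "N \<in> \<N>" "N \<subseteq> U" by blast
    then show ?thesis by (intro bexI[of _ N]) auto
  qed
  show "\<exists>N\<in>\<N>. \<forall>D\<in>\<N>. D \<subseteq> N \<longrightarrow> D \<inter> U \<noteq> {}" if "\<Inter>\<N> \<inter> U \<noteq> {}"
  proof -
    have "D \<inter> U \<noteq> {}" if "D \<in> \<N>" for D using \<open>\<Inter>\<N> \<inter> U \<noteq> {}\<close> that by auto
    then show ?thesis using N(2) by auto
  qed
qed (use ch in auto)

section \<open>Maximal chains of closed sets\<close>

definition clopenin :: "'a topology \<Rightarrow> 'a set \<Rightarrow> bool" where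
  "clopenin X A \<longleftrightarrow> openin X A \<and> closedin X A"

lemma clopenin_subset: "clopenin X A \<Longrightarrow> A \<subseteq> topspace X"
  by (simp add: clopenin_def openin_subset)

lemma clopenin_Diff: "clopenin X A \<Longrightarrow> clopenin X B \<Longrightarrow> clopenin X (A - B)"
  by (simp add: clopenin_def openin_diff closedin_diff)

lemma clopenin_Int: "clopenin X A \<Longrightarrow> clopenin X B \<Longrightarrow> clopenin X (A \<inter> B)"
  by (simp add: clopenin_def openin_Int closedin_Int)

lemma clopenin_topspace [simp]: "clopenin X (topspace X)"
  by (simp add: clopenin_def)

lemma clopenin_Union: "finite \<A> \<Longrightarrow> (\<And>A. A \<in> \<A> \<Longrightarrow> clopenin X A) \<Longrightarrow> clopenin X (\<Union>\<A>)"
  by (auto simp: clopenin_def intro: closedin_Union)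

definition before :: "'a set set \<Rightarrow> 'a set \<Rightarrow> 'a set \<Rightarrow> bool" where
  "before M A B \<longleftrightarrow> (\<exists>F\<in>M. F \<inter> A \<noteq> {} \<and> F \<inter> B = {})"

text \<open>
  Of two members of a chain the smaller one misses all that the larger one misses.
\<close>

lemma before_antisym:
  assumes "subset.maxchain \<A> M" "before M A B"
  shows "\<not> before M B A"
proof
  assume "before M B A"
  then obtain F where F: "F \<in> M" "F \<inter> B \<noteq> {}" "F \<inter> A = {}" by (auto simp: before_def)
  obtain N where N: "N \<in> M" "N \<inter> A \<noteq> {}" "N \<inter> B = {}" using assms(2) by (auto simp: before_def)
  have "F \<subseteq> N \<or> N \<subseteq> F" using assms(1) F(1) N(1) by (simp add: subset_maxchain_iff)
  then show False using F N by blast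
qed

lemma before_trans:
  assumes "subset.maxchain \<A> M" "before M A B" "before M B C"
  shows "before M A C"
proof -
  obtain F where F: "F \<in> M" "F \<inter> A \<noteq> {}" "F \<inter> B = {}" using assms(2) by (auto simp: before_def)
  obtain N where N: "N \<in> M" "N \<inter> B \<noteq> {}" "N \<inter> C = {}" using assms(3) by (auto simp: before_def)
  have "F \<subseteq> N \<or> N \<subseteq> F" using assms(1) F(1) N(1) by (simp add: subset_maxchain_iff)
  then have "F \<subseteq> N" using F N by blast
  then have "N \<inter> A \<noteq> {}" using F(2) by blast
  then show ?thesis using N by (auto simp: before_def)
qed

definition hits_misses :: "'a topology \<Rightarrow> 'a set \<Rightarrow> 'a set \<Rightarrow> 'a set set" where
  "hits_misses X A B = {F \<in> hyperspace X. F \<inter> A \<noteq> {} \<and> F \<inter> B = {}}"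

lemma hyperspace_subset: "F \<in> hyperspace X \<Longrightarrow> F \<subseteq> topspace X"
  by (simp add: hyperspace_def closedin_subset)

lemma clopenin_hits_misses:
  assumes "clopenin X A" "clopenin X B"
  shows "clopenin (vietoris X) (hits_misses X A B)"
  unfolding clopenin_def
proof
  have o: "openin X A" "openin X B" "openin X (topspace X - A)" "openin X (topspace X - B)"
    using assms by (auto simp: clopenin_def)
  have eq: "hits_misses X A B = {F \<in> hyperspace X. F \<inter> A \<noteq> {}} \<inter> {F \<in> hyperspace X. F \<subseteq> topspace X - B}"
    unfolding hits_misses_def using hyperspace_subset by fast
  show "openin (vietoris X) (hits_misses X A B)"
    unfolding eq by (intro openin_Int openin_vietoris_meets openin_vietoris_subset o)
  have eq': "topspace (vietoris X) - hits_misses X A B =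
      {F \<in> hyperspace X. F \<inter> B \<noteq> {}} \<union> {F \<in> hyperspace X. F \<subseteq> topspace X - A}"
    unfolding hits_misses_def topspace_vietoris using hyperspace_subset by fast
  have "openin (vietoris X) (topspace (vietoris X) - hits_misses X A B)"
    unfolding eq' by (intro openin_Un openin_vietoris_meets openin_vietoris_subset o)
  moreover have "hits_misses X A B \<subseteq> topspace (vietoris X)" by (simp add: hits_misses_def)
  ultimately show "closedin (vietoris X) (hits_misses X A B)" by (simp only: closedin_def)
qed

lemma before_iff_hits_misses:
  assumes "M \<subseteq> hyperspace X"
  shows "before M A B \<longleftrightarrow> M \<inter> hits_misses X A B \<noteq> {}"
  using assms by (auto simp: before_def hits_misses_def set_eq_iff dest: subsetD)

locale perfect_stone =
  fixes E :: "'a topology"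
  assumes compact: "compact_space E" and Hausdorff: "Hausdorff_space E"
    and clopen_nbhd: "openin E U \<Longrightarrow> y \<in> U \<Longrightarrow> \<exists>A. clopenin E A \<and> y \<in> A \<and> A \<subseteq> U"
    and no_isolated: "openin E U \<Longrightarrow> y \<in> U \<Longrightarrow> \<exists>z\<in>U. z \<noteq> y"
begin

lemma clopen_avoiding:
  assumes "closedin E K" "a \<in> topspace E" "a \<notin> K"
  obtains A where "clopenin E A" "a \<in> A" "A \<inter> K = {}"
  using clopen_nbhd[of "topspace E - K" a] assms by blast

lemma incomparable_clopens:
  assumes F: "F \<in> hyperspace E" and N: "N \<in> hyperspace E" and inc: "\<not> F \<subseteq> N" "\<not> N \<subseteq> F"
  obtains A B where "clopenin E A" "clopenin E B" "A \<inter> B = {}"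
    "F \<inter> A \<noteq> {}" "F \<inter> B = {}" "N \<inter> B \<noteq> {}" "N \<inter> A = {}"
proof -
  obtain a b where a: "a \<in> F" "a \<notin> N" and b: "b \<in> N" "b \<notin> F" using inc by blast
  have cl: "closedin E F" "closedin E N" using F N by (auto simp: hyperspace_def)
  have "a \<in> topspace E" "b \<in> topspace E" using a b F N hyperspace_subset by blast+
  then obtain A B where A: "clopenin E A" "a \<in> A" "A \<inter> N = {}" and B: "clopenin E B" "b \<in> B" "B \<inter> F = {}"
    using clopen_avoiding[OF cl(2) _ a(2)] clopen_avoiding[OF cl(1) _ b(2)] by metis
  show thesis
  proof (rule that[of "A - B" B])
    show "clopenin E (A - B)" using A B by (simp add: clopenin_Diff)
    show "F \<inter> (A - B) \<noteq> {}" using a A B by blast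
    show "N \<inter> B \<noteq> {}" using b B by blast
  qed (use A B in auto)
qed

text \<open>
  A closed set outside a maximal chain is incomparable with some member, and by \<open>incomparable_clopens\<close>
  the same member is incomparable with all sets nearby. So \<open>maxchain_space\<close> omits no maximal chain.
\<close>

lemma maxchain_closed:
  assumes M: "subset.maxchain (hyperspace E) M"
  shows "closedin (vietoris E) M"
proof -
  have Mh: "M \<subseteq> hyperspace E" and ch: "\<And>F N. F \<in> M \<Longrightarrow> N \<in> M \<Longrightarrow> F \<subseteq> N \<or> N \<subseteq> F"
    and max: "\<And>F. F \<in> hyperspace E \<Longrightarrow> (\<forall>N\<in>M. F \<subseteq> N \<or> N \<subseteq> F) \<Longrightarrow> F \<in> M"
    using M unfolding subset_maxchain_iff by auto
  have "openin (vietoris E) (hyperspace E - M)"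
  proof (subst openin_subopen, intro ballI)
    fix F assume F: "F \<in> hyperspace E - M"
    then obtain N where N: "N \<in> M" "\<not> F \<subseteq> N" "\<not> N \<subseteq> F" using max[of F] by auto
    have Nh: "N \<in> hyperspace E" using N(1) Mh by auto
    obtain A B where AB: "clopenin E A" "clopenin E B" "A \<inter> B = {}"
      "F \<inter> A \<noteq> {}" "F \<inter> B = {}" "N \<inter> B \<noteq> {}" "N \<inter> A = {}"
      using incomparable_clopens[OF _ Nh N(2,3)] F by auto
    have "F' \<notin> M" if "F' \<in> hits_misses E A B" for F'
    proof
      assume "F' \<in> M"
      with ch[OF this N(1)] that AB show False unfolding hits_misses_def by blast
    qed
    moreover have "openin (vietoris E) (hits_misses E A B)"
      using clopenin_hits_misses[OF AB(1,2)] by (simp add: clopenin_def)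
    moreover have "F \<in> hits_misses E A B" using F AB by (simp add: hits_misses_def)
    moreover have "hits_misses E A B \<subseteq> hyperspace E" by (simp add: hits_misses_def)
    ultimately show "\<exists>T. openin (vietoris E) T \<and> F \<in> T \<and> T \<subseteq> hyperspace E - M"
      by (intro exI[of _ "hits_misses E A B"]) auto
  qed
  then show ?thesis using Mh by (simp add: closedin_def)
qed

text \<open>
  If no member separated \<open>A\<close> from \<open>B\<close>, then the smallest member that meets \<open>A\<close> would also meet \<open>B\<close>,
  and removing \<open>B\<close> from it would give a set comparable with the whole chain.
\<close>

lemma maxchain_separates:
  assumes M: "subset.maxchain (hyperspace E) M"
    and A: "clopenin E A" "A \<noteq> {}" and B: "clopenin E B" and disj: "A \<inter> B = {}"
  shows "before M A B \<or> before M B A"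
proof (rule ccontr)
  assume no: "\<not> ?thesis"
  have Mh: "M \<subseteq> hyperspace E" and ch: "\<And>F N. F \<in> M \<Longrightarrow> N \<in> M \<Longrightarrow> F \<subseteq> N \<or> N \<subseteq> F"
    and max: "\<And>F. F \<in> hyperspace E \<Longrightarrow> (\<forall>N\<in>M. F \<subseteq> N \<or> N \<subseteq> F) \<Longrightarrow> F \<in> M"
    using M unfolding subset_maxchain_iff by auto
  have iff: "F \<inter> A \<noteq> {} \<longleftrightarrow> F \<inter> B \<noteq> {}" if "F \<in> M" for F
    using no that by (auto simp: before_def)
  have cl: "closedin E F" if "F \<in> M" for F using that Mh by (auto simp: hyperspace_def)
  (* The intersection of this family meets A by compactness, and it is the least member that meets A. *)
  define \<U> where "\<U> = {N \<in> M. N \<inter> A \<noteq> {}}"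
  have "topspace E \<in> M"
  proof (rule max)
    show "topspace E \<in> hyperspace E" using A clopenin_subset by (fastforce simp: hyperspace_def)
  qed (use Mh hyperspace_subset in blast)
  then have "topspace E \<in> \<U>" using A clopenin_subset by (fastforce simp: \<U>_def)
  then have ne: "\<U> \<noteq> {}" by blast
  have "\<Inter>((\<lambda>N. N \<inter> A) ` \<U>) \<noteq> {}"
  proof (rule compact_chain_Inter_nonempty[OF compact])
    show "closedin E C \<and> C \<noteq> {}" if "C \<in> (\<lambda>N. N \<inter> A) ` \<U>" for C
      using that cl A by (auto simp: \<U>_def clopenin_def)
    show "C \<subseteq> D \<or> D \<subseteq> C" if CD: "C \<in> (\<lambda>N. N \<inter> A) ` \<U>" "D \<in> (\<lambda>N. N \<inter> A) ` \<U>" for C D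
    proof -
      obtain N N' where "N \<in> M" "N' \<in> M" "C = N \<inter> A" "D = N' \<inter> A" using CD by (auto simp: \<U>_def)
      then show ?thesis using ch[of N N'] by auto
    qed
  qed (use ne in simp)
  then have UA: "\<Inter>\<U> \<inter> A \<noteq> {}" using ne by auto
  have Ucl: "closedin E (\<Inter>\<U>)" using ne cl by (intro closedin_Inter) (auto simp: \<U>_def)
  define F where "F = \<Inter>\<U> - B"
  have FA: "F \<inter> A \<noteq> {}" using UA disj by (auto simp: F_def)
  have "F \<in> M"
  proof (rule max)
    show "F \<in> hyperspace E" using FA Ucl B by (auto simp: F_def hyperspace_def clopenin_def)
    show "\<forall>N\<in>M. F \<subseteq> N \<or> N \<subseteq> F"
    proof
      fix N assume N: "N \<in> M"
      show "F \<subseteq> N \<or> N \<subseteq> F"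
      proof (cases "N \<inter> A = {}")
        case False
        then show ?thesis using N by (auto simp: F_def \<U>_def)
      next
        case True
        then have NB: "N \<inter> B = {}" using iff[OF N] by simp
        have "N \<subseteq> N'" if N': "N' \<in> \<U>" for N'
        proof -
          have "N' \<in> M" "N' \<inter> A \<noteq> {}" using N' by (auto simp: \<U>_def)
          then show ?thesis using ch[OF N, of N'] True by blast
        qed
        then show ?thesis using NB by (auto simp: F_def)
      qed
    qed
  qed
  then show False using iff[of F] FA by (auto simp: F_def)
qed

text \<open>
  Together with \<open>maxchain_separates\<close> this characterises the maximal chains among the closed chains by
  conditions that are closed in the hyperspace of the hyperspace.
\<close>

lemma separating_chain_maximal:
  assumes M: "closedin (vietoris E) M" and ch: "\<And>F N. F \<in> M \<Longrightarrow> N \<in> M \<Longrightarrow> F \<subseteq> N \<or> N \<subseteq> F"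
    and sep: "\<And>A B. clopenin E A \<Longrightarrow> clopenin E B \<Longrightarrow> A \<noteq> {} \<Longrightarrow> B \<noteq> {} \<Longrightarrow> A \<inter> B = {} \<Longrightarrow>
      before M A B \<or> before M B A"
  shows "subset.maxchain (hyperspace E) M"
proof -
  have Mh: "M \<subseteq> hyperspace E" using closedin_subset[OF M] by simp
  have "F \<in> M" if F: "F \<in> hyperspace E" and comp: "\<forall>N\<in>M. F \<subseteq> N \<or> N \<subseteq> F" for F
  proof (rule ccontr)
    assume nF: "F \<notin> M"
    have Fcl: "closedin E F" and Fne: "F \<noteq> {}" using F by (auto simp: hyperspace_def)
    (* Since F is not in M, it properly contains the closure L of the union of the members below it; so
       a point a of F is not in L. Suitable clopen neighbourhoods of a and of a second point are then met
       by the same members of M. *)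
    define \<N> where "\<N> = {N \<in> M. N \<subseteq> F}"
    define L where "L = E closure_of \<Union>\<N>"
    have Lcl: "closedin E L" by (simp add: L_def)
    have LF: "L \<subseteq> F" unfolding L_def by (rule closure_of_minimal[OF _ Fcl]) (auto simp: \<N>_def)
    have "L \<noteq> F"
    proof (cases "\<N> = {}")
      case True then show ?thesis using Fne by (simp add: L_def)
    next
      case False
      have "L \<in> M" unfolding L_def
        by (rule closed_hyperspace_chain_Union[OF M _ False]) (use ch in \<open>auto simp: \<N>_def\<close>)
      then show ?thesis using nF by auto
    qed
    then obtain a where a: "a \<in> F" "a \<notin> L" using LF by blast
    have aE: "a \<in> topspace E" using a F hyperspace_subset by blast
    have NL: "N \<subseteq> L" if "N \<in> M" "N \<subseteq> F" for N
    proof -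
      have "\<Union>\<N> \<subseteq> topspace E" using Mh hyperspace_subset by (force simp: \<N>_def)
      then have "\<Union>\<N> \<subseteq> L" unfolding L_def by (rule closure_of_subset)
      moreover have "N \<in> \<N>" using that by (simp add: \<N>_def)
      ultimately show ?thesis by blast
    qed
    show False
    proof (cases "F = topspace E")
      case True
      have allL: "N \<subseteq> L" if "N \<in> M" for N
      proof -
        have "N \<subseteq> F" using that Mh hyperspace_subset True by blast
        then show ?thesis using NL that by blast
      qed
      (* Every member lies in L, so two points outside L will do; the second one exists because no point
         is isolated. *)
      have "openin E (topspace E - L)" using Lcl by blast
      then obtain z where z: "z \<in> topspace E - L" "z \<noteq> a" using no_isolated[of "topspace E - L" a] a aE by blast
      have "closedin E (insert z L)"
        using closedin_Un[OF closedin_Hausdorff_singleton[OF Hausdorff, of z] Lcl] z by simp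
      then obtain A where A: "clopenin E A" "a \<in> A" "A \<inter> insert z L = {}"
        using clopen_avoiding[of "insert z L" a] aE a z by blast
      have "closedin E (A \<union> L)" using A Lcl by (simp add: clopenin_def closedin_Un)
      then obtain B where B: "clopenin E B" "z \<in> B" "B \<inter> (A \<union> L) = {}"
        using clopen_avoiding[of "A \<union> L" z] A z by blast
      have "before M A B \<or> before M B A" by (rule sep) (use A B in auto)
      then obtain N where "N \<in> M" "N \<inter> A \<noteq> {} \<or> N \<inter> B \<noteq> {}" by (auto simp: before_def)
      then show False using allL[of N] A B by blast
    next
      case False
      (* The second point is outside F but in all members above F. Members below F miss both
         neighbourhoods, and members above F meet both. *)
      define U where "U = topspace E \<inter> \<Inter>{N \<in> M. F \<subseteq> N}"
      have FU: "F \<subseteq> U" using F hyperspace_subset by (auto simp: U_def)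
      have "U \<noteq> F"
      proof (cases "{N \<in> M. F \<subseteq> N} = {}")
        case True
        then have "U = topspace E" unfolding U_def by (simp only: Inter_empty Int_UNIV_right)
        then show ?thesis using False by simp
      next
        case ne: False
        have UM: "\<Inter>{N \<in> M. F \<subseteq> N} \<in> M"
          by (rule closed_hyperspace_chain_Inter[OF compact M _ ne]) (use ch in auto)
        then have "U = \<Inter>{N \<in> M. F \<subseteq> N}" unfolding U_def using Mh hyperspace_subset by blast
        then show ?thesis using UM nF by auto
      qed
      then obtain b where b: "b \<in> U" "b \<notin> F" using FU by blast
      have bE: "b \<in> topspace E" using b by (simp add: U_def)
      obtain A where A: "clopenin E A" "a \<in> A" "A \<inter> L = {}" by (rule clopen_avoiding[OF Lcl aE a(2)])
      obtain B where B: "clopenin E B" "b \<in> B" "B \<inter> F = {}" by (rule clopen_avoiding[OF Fcl bE b(2)])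
      have aB: "a \<in> A - B" using A B a by blast
      have "before M (A - B) B \<or> before M B (A - B)"
        by (rule sep) (use A B aB clopenin_Diff in auto)
      then obtain N where N: "N \<in> M" "N \<inter> (A - B) \<noteq> {} \<and> N \<inter> B = {} \<or> N \<inter> B \<noteq> {} \<and> N \<inter> (A - B) = {}"
        by (auto simp: before_def)
      show False
      proof (cases "F \<subseteq> N")
        case True
        then have "U \<subseteq> N" using N(1) by (auto simp: U_def)
        then show False using True N(2) b B a aB by blast
      next
        case False
        then have "N \<subseteq> F" using comp N(1) by blast
        then show False using NL[OF N(1)] N(2) A B by blast
      qed
    qed
  qed
  then show ?thesis using Mh ch by (simp add: subset_maxchain_iff)
qed

lemma topspace_flags:
  "topspace (maxchain_space_at E x) = {M. subset.maxchain (hyperspace E) M \<and> {x} \<in> M}"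
proof -
  have "M \<in> hyperspace (vietoris E)" if "subset.maxchain (hyperspace E) M" "{x} \<in> M" for M
    using maxchain_closed[OF that(1)] that(2) by (auto simp: hyperspace_def)
  then show ?thesis
    unfolding maxchain_space_at_def maxchain_space_def topspace_subtopology topspace_vietoris by auto
qed

lemma flag_space_subtopology:
  "maxchain_space_at E x = subtopology (vietoris (vietoris E)) (topspace (maxchain_space_at E x))"
  unfolding maxchain_space_at_def maxchain_space_def subtopology_subtopology
  by (metis subtopology_restrict topspace_subtopology)

lemma Hausdorff_vietoris: "Hausdorff_space (vietoris E)"
  by (intro Hausdorff_space_vietoris compact_Hausdorff_imp_regular_space compact Hausdorff)

lemma Hausdorff_vietoris_vietoris: "Hausdorff_space (vietoris (vietoris E))"
  by (intro Hausdorff_space_vietoris compact_Hausdorff_imp_regular_space compact_space_vietoris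
    compact Hausdorff_vietoris)

text \<open>
  Each way of not being such a chain persists nearby: missing \<open>{x}\<close>, having two incomparable members, or
  failing to separate two clopen sets.
\<close>

lemma closedin_flags:
  assumes x: "x \<in> topspace E"
  shows "closedin (vietoris (vietoris E)) (topspace (maxchain_space_at E x))" (is "closedin ?V ?\<Phi>")
proof -
  have "openin ?V (hyperspace (vietoris E) - ?\<Phi>)"
  proof (subst openin_subopen, intro ballI)
    fix M assume M: "M \<in> hyperspace (vietoris E) - ?\<Phi>"
    then have Mcl: "closedin (vietoris E) M" and Mh: "M \<subseteq> hyperspace E"
      using hyperspace_subset[of M "vietoris E"] by (auto simp: hyperspace_def)
    have intro: "\<exists>T. openin ?V T \<and> M \<in> T \<and> T \<subseteq> hyperspace (vietoris E) - ?\<Phi>"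
      if "openin ?V T" "M \<in> T" "\<And>N. N \<in> T \<Longrightarrow> subset.maxchain (hyperspace E) N \<Longrightarrow> {x} \<in> N \<Longrightarrow> False" for T
    proof -
      have "T \<subseteq> hyperspace (vietoris E)" using openin_subset[OF that(1)] by simp
      then show ?thesis using that unfolding topspace_flags by blast
    qed
    have "\<not> subset.maxchain (hyperspace E) M \<or> {x} \<notin> M" using M unfolding topspace_flags by blast
    then consider "{x} \<notin> M"
      | F N where "F \<in> M" "N \<in> M" "\<not> F \<subseteq> N" "\<not> N \<subseteq> F"
      | A B where "clopenin E A" "clopenin E B" "A \<noteq> {}" "A \<inter> B = {}" "\<not> before M A B" "\<not> before M B A"
      using separating_chain_maximal[OF Mcl] by metis
    then show "\<exists>T. openin ?V T \<and> M \<in> T \<and> T \<subseteq> hyperspace (vietoris E) - ?\<Phi>"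
    proof cases
      case 1
      have "{x} \<in> hyperspace E" using x closedin_Hausdorff_singleton[OF Hausdorff] by (simp add: hyperspace_def)
      then have o: "openin (vietoris E) (topspace (vietoris E) - {{x}})"
        using closedin_Hausdorff_singleton[OF Hausdorff_vietoris, of "{x}"]
        by (intro openin_diff[OF openin_topspace]) simp
      show ?thesis
        by (rule intro[OF openin_vietoris_subset[OF o]]) (use 1 M Mh in auto)
    next
      case (2 F N)
      have h: "F \<in> hyperspace E" "N \<in> hyperspace E" using Mh 2 by auto
      obtain A B where AB: "clopenin E A" "clopenin E B" "A \<inter> B = {}"
        "F \<inter> A \<noteq> {}" "F \<inter> B = {}" "N \<inter> B \<noteq> {}" "N \<inter> A = {}"
        by (rule incomparable_clopens[OF h 2(3,4)])
      let ?T = "\<lambda>A B. {M \<in> hyperspace (vietoris E). M \<inter> hits_misses E A B \<noteq> {}}"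
      show ?thesis
      proof (rule intro)
        show "openin ?V (?T A B \<inter> ?T B A)"
          using clopenin_hits_misses AB by (intro openin_Int openin_vietoris_meets) (auto simp: clopenin_def)
        have "F \<in> M \<inter> hits_misses E A B" "N \<in> M \<inter> hits_misses E B A"
          using AB h 2 by (auto simp: hits_misses_def)
        then show "M \<in> ?T A B \<inter> ?T B A" using M by blast
        fix N assume N: "N \<in> ?T A B \<inter> ?T B A" "subset.maxchain (hyperspace E) N"
        then have "before N A B" "before N B A"
          using before_iff_hits_misses[of N E] by (auto simp: subset_maxchain_iff)
        then show False using before_antisym[OF N(2)] by blast
      qed
    next
      case (3 A B)
      let ?S = "topspace (vietoris E) - hits_misses E A B - hits_misses E B A"
      show ?thesis
      proof (rule intro[OF openin_vietoris_subset])
        show "openin (vietoris E) ?S"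
          using clopenin_hits_misses 3(1,2) by (intro openin_diff openin_topspace) (auto simp: clopenin_def)
        have "M \<subseteq> ?S" using 3(5,6) Mh unfolding before_iff_hits_misses[OF Mh] by auto
        then show "M \<in> {F \<in> hyperspace (vietoris E). F \<subseteq> ?S}" using M by simp
        fix N assume N: "N \<in> {F \<in> hyperspace (vietoris E). F \<subseteq> ?S}" "subset.maxchain (hyperspace E) N"
        then have "N \<subseteq> hyperspace E" by (simp add: subset_maxchain_iff)
        then have "\<not> before N A B" "\<not> before N B A"
          using N(1) before_iff_hits_misses[of N E] by auto
        then show False using maxchain_separates[OF N(2) 3(1,3,2,4)] by simp
      qed
    qed
  qed
  moreover have "?\<Phi> \<subseteq> hyperspace (vietoris E)"
    using topspace_subtopology_subset by (auto simp: maxchain_space_at_def maxchain_space_def)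
  ultimately show ?thesis by (simp add: closedin_def)
qed

lemma compact_flags: "x \<in> topspace E \<Longrightarrow> compact_space (maxchain_space_at E x)"
  by (subst flag_space_subtopology)
    (intro compact_space_subtopology closedin_compact_space compact_space_vietoris compact closedin_flags)

lemma Hausdorff_flags: "Hausdorff_space (maxchain_space_at E x)"
  by (subst flag_space_subtopology) (intro Hausdorff_space_subtopology Hausdorff_vietoris_vietoris)

lemma openin_before:
  assumes "clopenin E A" "clopenin E B"
  shows "openin (maxchain_space_at E x) {M \<in> topspace (maxchain_space_at E x). before M A B}"
proof -
  let ?\<Phi> = "topspace (maxchain_space_at E x)"
  define T where "T = {M \<in> hyperspace (vietoris E). M \<inter> hits_misses E A B \<noteq> {}}"
  have "openin (vietoris (vietoris E)) T"
    unfolding T_def using clopenin_hits_misses[OF assms]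
    by (intro openin_vietoris_meets) (simp add: clopenin_def)
  moreover have "{M \<in> ?\<Phi>. before M A B} = T \<inter> ?\<Phi>"
  proof -
    have "before M A B \<longleftrightarrow> M \<in> T" if M: "M \<in> ?\<Phi>" for M
    proof -
      have "M \<in> hyperspace (vietoris E)"
        using M by (simp add: maxchain_space_at_def maxchain_space_def)
      moreover have "M \<subseteq> hyperspace E" using M unfolding topspace_flags by (simp add: subset_maxchain_iff)
      ultimately show ?thesis using before_iff_hits_misses[of M E A B] by (simp add: T_def)
    qed
    then show ?thesis by auto
  qed
  ultimately show ?thesis by (subst flag_space_subtopology) (auto simp: openin_subtopology)
qed

lemma flags_separated:
  assumes M: "subset.maxchain (hyperspace E) M" and N: "subset.maxchain (hyperspace E) N" and "M \<noteq> N"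
  obtains A B where "clopenin E A" "clopenin E B" "before M A B" "before N B A"
proof -
  have "\<not> M \<subseteq> N"
  proof
    assume "M \<subseteq> N"
    have "F \<in> M" if F: "F \<in> N" for F
    proof -
      have ch: "\<forall>F\<in>N. \<forall>F'\<in>N. F \<subseteq> F' \<or> F' \<subseteq> F" and "N \<subseteq> hyperspace E"
        using N by (simp_all add: subset_maxchain_iff)
      then have "F \<in> hyperspace E" using F by blast
      moreover have "F \<subseteq> F' \<or> F' \<subseteq> F" if "F' \<in> M" for F'
      proof -
        have "F' \<in> N" using that \<open>M \<subseteq> N\<close> by blast
        then show ?thesis using ch F by simp
      qed
      ultimately have "F \<in> hyperspace E" "\<forall>F'\<in>M. F \<subseteq> F' \<or> F' \<subseteq> F" by auto
      then show ?thesis using M unfolding subset_maxchain_iff by simp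
    qed
    then show False using \<open>M \<subseteq> N\<close> \<open>M \<noteq> N\<close> by auto
  qed
  then obtain F where F: "F \<in> M" "F \<notin> N" by blast
  have Fh: "F \<in> hyperspace E" using M F(1) by (auto simp: subset_maxchain_iff)
  then obtain F' where F': "F' \<in> N" "\<not> F \<subseteq> F'" "\<not> F' \<subseteq> F"
    using N F(2) unfolding subset_maxchain_iff by metis
  have "F' \<in> hyperspace E" using N F'(1) by (auto simp: subset_maxchain_iff)
  from incomparable_clopens[OF Fh this F'(2,3)] show thesis
    using that F(1) F'(1) unfolding before_def by metis
qed

text \<open>
  The clopen conditions \<open>before M A B\<close> separate points of a compact space, so their finite intersections
  form a neighbourhood base.
\<close>

lemma flag_nbhd:
  assumes x: "x \<in> topspace E" and U: "openin (maxchain_space_at E x) U" and N: "N \<in> U"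
  obtains \<P> where "finite \<P>"
    "\<And>A B. (A, B) \<in> \<P> \<Longrightarrow> clopenin E A \<and> clopenin E B \<and> B \<noteq> {} \<and> before N A B"
    "\<And>M. M \<in> topspace (maxchain_space_at E x) \<Longrightarrow> (\<And>A B. (A, B) \<in> \<P> \<Longrightarrow> before M A B) \<Longrightarrow> M \<in> U"
proof -
  let ?\<Phi> = "maxchain_space_at E x"
  have N\<Phi>: "N \<in> topspace ?\<Phi>" using openin_subset[OF U] N by blast
  have K: "compactin ?\<Phi> (topspace ?\<Phi> - U)"
    using U by (intro closedin_compact_space compact_flags x) auto
  define S where "S = {(A, B). clopenin E A \<and> clopenin E B \<and> B \<noteq> {} \<and> before N A B}"
  define v where "v = (\<lambda>(A, B). {M \<in> topspace ?\<Phi>. before M B A})"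
  have "\<exists>\<F>. finite \<F> \<and> \<F> \<subseteq> v ` S \<and> topspace ?\<Phi> - U \<subseteq> \<Union>\<F>"
  proof (rule compactinD[OF K])
    show "openin ?\<Phi> V" if "V \<in> v ` S" for V
      using that openin_before by (auto simp: v_def S_def)
    show "topspace ?\<Phi> - U \<subseteq> \<Union>(v ` S)"
    proof
      fix M assume M: "M \<in> topspace ?\<Phi> - U"
      then have "N \<noteq> M" using N by auto
      then obtain A B where "clopenin E A" "clopenin E B" "before N A B" "before M B A"
        using flags_separated[of N M] M N\<Phi> unfolding topspace_flags by blast
      moreover have "B \<noteq> {}" using \<open>before M B A\<close> by (auto simp: before_def)
      ultimately have "(A, B) \<in> S" "M \<in> v (A, B)" using M by (auto simp: S_def v_def)
      then show "M \<in> \<Union>(v ` S)" by blast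
    qed
  qed
  then obtain \<F> where \<F>: "finite \<F>" "\<F> \<subseteq> v ` S" "topspace ?\<Phi> - U \<subseteq> \<Union>\<F>" by blast
  then obtain \<P> where \<P>: "finite \<P>" "\<P> \<subseteq> S" "\<F> = v ` \<P>" by (meson finite_subset_image)
  show thesis
  proof (rule that[OF \<P>(1)])
    show "clopenin E A \<and> clopenin E B \<and> B \<noteq> {} \<and> before N A B" if "(A, B) \<in> \<P>" for A B
      using that \<P>(2) by (auto simp: S_def)
    fix M assume M: "M \<in> topspace ?\<Phi>" and bef: "\<And>A B. (A, B) \<in> \<P> \<Longrightarrow> before M A B"
    show "M \<in> U"
    proof (rule ccontr)
      assume "M \<notin> U"
      then obtain A B where "(A, B) \<in> \<P>" "before M B A"
        using M \<F>(3) unfolding \<P>(3) by (auto simp: v_def)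
      moreover have "subset.maxchain (hyperspace E) M" using M unfolding topspace_flags by simp
      ultimately show False using bef before_antisym by blast
    qed
  qed
qed

text \<open>
  A maximal chain among the closed sets containing \<open>x\<close> is also maximal among all closed sets, because
  a nonempty set comparable with \<open>{x}\<close> contains \<open>x\<close>.
\<close>

lemma flags_nonempty:
  assumes x: "x \<in> topspace E"
  shows "topspace (maxchain_space_at E x) \<noteq> {}"
proof -
  let ?A = "{F \<in> hyperspace E. x \<in> F}"
  obtain M where M: "subset.maxchain ?A M" using subset.Hausdorff by blast
  have sx: "{x} \<in> hyperspace E" using x closedin_Hausdorff_singleton[OF Hausdorff] by (simp add: hyperspace_def)
  have Mh: "M \<subseteq> ?A" and ch: "\<And>F N. F \<in> M \<Longrightarrow> N \<in> M \<Longrightarrow> F \<subseteq> N \<or> N \<subseteq> F"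
    and max: "\<And>F. F \<in> ?A \<Longrightarrow> (\<forall>N\<in>M. F \<subseteq> N \<or> N \<subseteq> F) \<Longrightarrow> F \<in> M"
    using M unfolding subset_maxchain_iff by auto
  have xM: "{x} \<in> M" by (rule max) (use sx Mh in auto)
  have "F \<in> M" if F: "F \<in> hyperspace E" "\<forall>N\<in>M. F \<subseteq> N \<or> N \<subseteq> F" for F
  proof -
    have "F \<subseteq> {x} \<or> {x} \<subseteq> F" "F \<noteq> {}" using F xM by (auto simp: hyperspace_def)
    then have "x \<in> F" by blast
    then show ?thesis using max F by simp
  qed
  then have "subset.maxchain (hyperspace E) M" using Mh ch unfolding subset_maxchain_iff by auto
  then show ?thesis using xM unfolding topspace_flags by blast
qed

end

section \<open>Homeomorphisms fixing a point\<close>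

lemma homeo_group_fixing_carrier:
  "g \<in> carrier (homeo_group_fixing E x) \<longleftrightarrow> g \<in> Bij (topspace E) \<and> homeomorphic_map E E g \<and> g x = x"
  by (auto simp: homeo_group_fixing_def homeo_group_def)

lemma homeo_group_fixing_ext:
  assumes "g \<in> carrier (homeo_group_fixing E x)" "h \<in> carrier (homeo_group_fixing E x)"
    and "\<And>y. y \<in> topspace E \<Longrightarrow> g y = h y"
  shows "g = h"
  using assms by (intro extensionalityI[of g "topspace E" h]) (auto simp: homeo_group_fixing_carrier Bij_def)

lemma homeo_group_fixing_mapsto:
  "g \<in> carrier (homeo_group_fixing E x) \<Longrightarrow> y \<in> topspace E \<Longrightarrow> g y \<in> topspace E"
  using Bij_imp_funcset by (fastforce simp: homeo_group_fixing_carrier)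

lemma homeo_group_fixing_mult:
  assumes "g \<in> carrier (homeo_group_fixing E x)" "h \<in> carrier (homeo_group_fixing E x)" "x \<in> topspace E"
  shows "g \<otimes>\<^bsub>homeo_group_fixing E x\<^esub> h \<in> carrier (homeo_group_fixing E x)"
    and "y \<in> topspace E \<Longrightarrow> (g \<otimes>\<^bsub>homeo_group_fixing E x\<^esub> h) y = g (h y)"
proof -
  have B: "g \<in> Bij (topspace E)" "h \<in> Bij (topspace E)" using assms by (auto simp: homeo_group_fixing_carrier)
  have eq: "g \<otimes>\<^bsub>homeo_group_fixing E x\<^esub> h = compose (topspace E) g h"
    using B by (simp add: homeo_group_fixing_def homeo_group_def BijGroup_def)
  have "homeomorphic_map E E (compose (topspace E) g h)"
  proof (rule homeomorphic_map_eq)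
    show "homeomorphic_map E E (g \<circ> h)"
      using assms by (intro homeomorphic_map_compose) (auto simp: homeo_group_fixing_carrier)
  qed (simp add: compose_def)
  then show "g \<otimes>\<^bsub>homeo_group_fixing E x\<^esub> h \<in> carrier (homeo_group_fixing E x)"
    unfolding eq using assms compose_Bij[OF B] by (simp add: homeo_group_fixing_carrier compose_def)
  show "y \<in> topspace E \<Longrightarrow> (g \<otimes>\<^bsub>homeo_group_fixing E x\<^esub> h) y = g (h y)"
    unfolding eq by (simp add: compose_def)
qed

lemma homeo_group_fixing_one: "\<one>\<^bsub>homeo_group_fixing E x\<^esub> = (\<lambda>y\<in>topspace E. y)"
  by (simp add: homeo_group_fixing_def homeo_group_def BijGroup_def)

lemma homeo_group_fixing_one_carrier:
  "x \<in> topspace E \<Longrightarrow> (\<lambda>y\<in>topspace E. y) \<in> carrier (homeo_group_fixing E x)"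
  using homeomorphic_map_eq[OF homeomorphic_map_id[THEN iffD2, OF refl], of E "\<lambda>y\<in>topspace E. y"] id_Bij
  by (fastforce simp: homeo_group_fixing_carrier)

lemma homeo_group_fixing_inverse:
  assumes g: "g \<in> carrier (homeo_group_fixing E x)" and x: "x \<in> topspace E"
  shows "\<exists>h\<in>carrier (homeo_group_fixing E x). \<forall>y\<in>topspace E. h (g y) = y \<and> g (h y) = y"
proof -
  have B: "g \<in> Bij (topspace E)" "g x = x" using g by (auto simp: homeo_group_fixing_carrier)
  have gH: "g \<in> carrier (homeo_group E)" using g by (simp add: homeo_group_fixing_def)
  have bij: "bij_betw g (topspace E) (topspace E)" using B by (simp add: Bij_def)
  define h where "h = restrict (inv_into (topspace E) g) (topspace E)"
  have "h \<in> carrier (homeo_group E)"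
    using subgroup.m_inv_closed[OF subgroup_homeo_group gH] by (simp add: inv_BijGroup[OF B(1)] h_def)
  moreover have hg: "h (g y) = y" if "y \<in> topspace E" for y
    using bij that by (auto simp: h_def bij_betw_def)
  moreover have gh: "g (h y) = y" if "y \<in> topspace E" for y
    using bij that by (auto simp: h_def bij_betw_def f_inv_into_f)
  moreover have "h x = x" using hg[OF x] B(2) by simp
  ultimately show ?thesis by (intro bexI[of _ h]) (simp_all add: homeo_group_fixing_def)
qed

lemma group_homeo_group_fixing:
  assumes x: "x \<in> topspace E"
  shows "group (homeo_group_fixing E x)"
proof (rule groupI)
  let ?G = "homeo_group_fixing E x"
  note mult = homeo_group_fixing_mult[OF _ _ x]
  show one: "\<one>\<^bsub>?G\<^esub> \<in> carrier ?G" by (simp add: homeo_group_fixing_one homeo_group_fixing_one_carrier x)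
  have one_apply: "\<one>\<^bsub>?G\<^esub> y = y" if "y \<in> topspace E" for y
    using that by (simp add: homeo_group_fixing_one)
  fix g assume g: "g \<in> carrier ?G"
  show "\<one>\<^bsub>?G\<^esub> \<otimes>\<^bsub>?G\<^esub> g = g"
    by (rule homeo_group_fixing_ext[OF mult(1)[OF one g] g])
      (simp add: mult(2)[OF one g] one_apply homeo_group_fixing_mapsto[OF g])
  obtain h where h: "h \<in> carrier ?G" "\<forall>y\<in>topspace E. h (g y) = y \<and> g (h y) = y"
    by (rule bexE[OF homeo_group_fixing_inverse[OF g x]])
  have "h \<otimes>\<^bsub>?G\<^esub> g = \<one>\<^bsub>?G\<^esub>"
    by (rule homeo_group_fixing_ext[OF mult(1)[OF h(1) g] one])
      (simp add: mult(2)[OF h(1) g] h(2) one_apply)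
  then show "\<exists>h\<in>carrier ?G. h \<otimes>\<^bsub>?G\<^esub> g = \<one>\<^bsub>?G\<^esub>" using h(1) by blast
  fix h assume h: "h \<in> carrier ?G"
  show "g \<otimes>\<^bsub>?G\<^esub> h \<in> carrier ?G" by (rule mult(1)[OF g h])
  fix k assume k: "k \<in> carrier ?G"
  show "g \<otimes>\<^bsub>?G\<^esub> h \<otimes>\<^bsub>?G\<^esub> k = g \<otimes>\<^bsub>?G\<^esub> (h \<otimes>\<^bsub>?G\<^esub> k)"
    by (rule homeo_group_fixing_ext[OF mult(1)[OF mult(1)[OF g h] k] mult(1)[OF g mult(1)[OF h k]]])
      (simp add: mult[OF mult(1)[OF g h] k] mult[OF g h] mult[OF g mult(1)[OF h k]] mult[OF h k]
        homeo_group_fixing_mapsto[OF k])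
qed

lemma homeo_group_fixing_inv:
  assumes g: "g \<in> carrier (homeo_group_fixing E x)" and x: "x \<in> topspace E" and y: "y \<in> topspace E"
  shows "(inv\<^bsub>homeo_group_fixing E x\<^esub> g) (g y) = y" "g ((inv\<^bsub>homeo_group_fixing E x\<^esub> g) y) = y"
proof -
  interpret group "homeo_group_fixing E x" by (rule group_homeo_group_fixing[OF x])
  note i = inv_closed[OF g]
  show "(inv\<^bsub>homeo_group_fixing E x\<^esub> g) (g y) = y"
    using homeo_group_fixing_mult(2)[OF i g x y] l_inv[OF g] y by (simp add: homeo_group_fixing_one)
  show "g ((inv\<^bsub>homeo_group_fixing E x\<^esub> g) y) = y"
    using homeo_group_fixing_mult(2)[OF g i x y] r_inv[OF g] y by (simp add: homeo_group_fixing_one)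
qed

lemma homeo_group_fixing_continuous:
  "g \<in> carrier (homeo_group_fixing E x) \<Longrightarrow> continuous_map E E g"
  by (simp add: homeo_group_fixing_carrier homeomorphic_imp_continuous_map)

lemma clopenin_vimage:
  "continuous_map X Y g \<Longrightarrow> clopenin Y A \<Longrightarrow> clopenin X {y \<in> topspace X. g y \<in> A}"
  by (auto simp: clopenin_def intro: openin_continuous_map_preimage closedin_continuous_map_preimage)

text \<open>
  The action of \<open>maxchain_action\<close>, as a function that is not cut off outside the space of chains.
\<close>

definition flag_image :: "('a \<Rightarrow> 'a) \<Rightarrow> 'a set set \<Rightarrow> 'a set set" where
  "flag_image g M = (\<lambda>F. g ` F) ` M"

lemma before_flag_image:
  assumes "M \<subseteq> hyperspace E"
  shows "before (flag_image g M) A B \<longleftrightarrow> before M {y \<in> topspace E. g y \<in> A} {y \<in> topspace E. g y \<in> B}"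
proof -
  have "g ` F \<inter> A = {} \<longleftrightarrow> F \<inter> {y \<in> topspace E. g y \<in> A} = {}" if "F \<in> M" for F A
    using hyperspace_subset[of F E] assms that by blast
  then show ?thesis by (simp add: before_def flag_image_def)
qed

lemma hyperspace_image:
  assumes g: "g \<in> carrier (homeo_group_fixing E x)" and F: "F \<in> hyperspace E"
  shows "g ` F \<in> hyperspace E"
  using F homeomorphic_map_closedness[of E E g F] g hyperspace_subset[OF F]
  by (auto simp: hyperspace_def homeo_group_fixing_carrier)

lemma flag_image_mult:
  assumes g: "g \<in> carrier (homeo_group_fixing E x)" and h: "h \<in> carrier (homeo_group_fixing E x)"
    and x: "x \<in> topspace E" and M: "M \<subseteq> hyperspace E"
  shows "flag_image (g \<otimes>\<^bsub>homeo_group_fixing E x\<^esub> h) M = flag_image g (flag_image h M)"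
  unfolding flag_image_def image_image
proof (rule image_cong[OF refl])
  fix F assume "F \<in> M"
  then have "F \<subseteq> topspace E" using M hyperspace_subset by blast
  then show "(g \<otimes>\<^bsub>homeo_group_fixing E x\<^esub> h) ` F = (\<lambda>y. g (h y)) ` F"
    using homeo_group_fixing_mult(2)[OF g h x] by (intro image_cong) auto
qed

lemma flag_image_ident:
  assumes "M \<subseteq> hyperspace E" and "\<And>y. y \<in> topspace E \<Longrightarrow> g y = y"
  shows "flag_image g M = M"
proof -
  have "g ` F = F" if "F \<in> M" for F
    using hyperspace_subset[of F E] assms that by (force simp: image_iff)
  then show ?thesis by (simp add: flag_image_def)
qed

lemma flag_image_inverse:
  assumes "M \<subseteq> hyperspace E" and "\<And>y. y \<in> topspace E \<Longrightarrow> h (g y) = y"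
  shows "flag_image h (flag_image g M) = M"
proof -
  have "flag_image h (flag_image g M) = flag_image (\<lambda>y. h (g y)) M"
    by (simp add: flag_image_def image_image)
  then show ?thesis using flag_image_ident[OF assms(1), of "\<lambda>y. h (g y)"] assms(2) by simp
qed

lemma maxchain_flag_image:
  assumes g: "g \<in> carrier (homeo_group_fixing E x)" and x: "x \<in> topspace E"
    and M: "subset.maxchain (hyperspace E) M"
  shows "subset.maxchain (hyperspace E) (flag_image g M)"
proof -
  obtain h where h: "h \<in> carrier (homeo_group_fixing E x)"
    "\<forall>y\<in>topspace E. h (g y) = y \<and> g (h y) = y"
    by (rule bexE[OF homeo_group_fixing_inverse[OF g x]])
  have Mh: "M \<subseteq> hyperspace E" and ch: "\<And>F N. F \<in> M \<Longrightarrow> N \<in> M \<Longrightarrow> F \<subseteq> N \<or> N \<subseteq> F"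
    and max: "\<And>F. F \<in> hyperspace E \<Longrightarrow> (\<And>N. N \<in> M \<Longrightarrow> F \<subseteq> N \<or> N \<subseteq> F) \<Longrightarrow> F \<in> M"
    using M unfolding subset_maxchain_iff by auto
  show ?thesis
    unfolding subset_maxchain_iff
  proof (intro conjI ballI impI)
    show "flag_image g M \<subseteq> hyperspace E"
      using hyperspace_image[OF g] Mh by (auto simp: flag_image_def)
    show "F \<subseteq> N \<or> N \<subseteq> F" if FN: "F \<in> flag_image g M" "N \<in> flag_image g M" for F N
    proof -
      obtain F' N' where "F' \<in> M" "F = g ` F'" "N' \<in> M" "N = g ` N'" using FN by (auto simp: flag_image_def)
      then show ?thesis using ch[of F' N'] image_mono[of _ _ g] by auto
    qed
    fix F assume F: "F \<in> hyperspace E" and comp: "\<forall>N\<in>flag_image g M. F \<subseteq> N \<or> N \<subseteq> F"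
    have ghF: "g ` h ` F = F"
      using h(2) hyperspace_subset[OF F] by (force simp: image_image image_iff)
    have "h ` F \<in> M"
    proof (rule max[OF hyperspace_image[OF h(1) F]])
      fix N assume N: "N \<in> M"
      have hgN: "h ` g ` N = N"
        using h(2) hyperspace_subset[of N E] N Mh by (force simp: image_image image_iff)
      have "F \<subseteq> g ` N \<or> g ` N \<subseteq> F" using comp N by (simp add: flag_image_def)
      then have "h ` F \<subseteq> h ` g ` N \<or> h ` g ` N \<subseteq> h ` F" using image_mono[of _ _ h] by blast
      then show "h ` F \<subseteq> N \<or> N \<subseteq> h ` F" unfolding hgN .
    qed
    then show "F \<in> flag_image g M" unfolding flag_image_def using ghF by (metis image_eqI)
  qed
qed

section \<open>Ordered clopen partitions\<close>

definition piece :: "'a topology \<Rightarrow> ('a \<Rightarrow> 'b) \<Rightarrow> 'b \<Rightarrow> 'a set" where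
  "piece E c i = {y \<in> topspace E. c y = i}"

text \<open>
  A partition into \<open>n\<close> nonempty clopen pieces labelled by \<open>{..<n}\<close>, the piece containing \<open>x\<close> being number
  \<open>0\<close>. As a function it can be composed with homeomorphisms and with maps between label sets.
\<close>

definition coloring :: "'a topology \<Rightarrow> 'a \<Rightarrow> nat \<Rightarrow> ('a \<Rightarrow> nat) \<Rightarrow> bool" where
  "coloring E x n c \<longleftrightarrow> (\<forall>i. clopenin E (piece E c i)) \<and> c ` topspace E = {..<n} \<and> c x = 0"

definition natural :: "'a topology \<Rightarrow> 'a set set \<Rightarrow> nat \<Rightarrow> ('a \<Rightarrow> nat) \<Rightarrow> bool" where
  "natural E M n c \<longleftrightarrow> (\<forall>i j. i < j \<longrightarrow> j < n \<longrightarrow> before M (piece E c i) (piece E c j))"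

lemma coloring_bound: "coloring E x n c \<Longrightarrow> y \<in> topspace E \<Longrightarrow> c y < n"
  by (auto simp: coloring_def)

lemma piece_cong: "(\<And>y. y \<in> topspace E \<Longrightarrow> c y = d y) \<Longrightarrow> piece E c i = piece E d i"
  by (auto simp: piece_def)

lemma natural_cong:
  assumes "\<And>y. y \<in> topspace E \<Longrightarrow> c y = d y"
  shows "natural E M n c \<longleftrightarrow> natural E M n d"
  unfolding natural_def using piece_cong[of E c d] assms by simp

lemma piece_comp:
  assumes "g \<in> carrier (homeo_group_fixing E x)"
  shows "piece E (\<lambda>y. c (g y)) i = {y \<in> topspace E. g y \<in> piece E c i}"
  using homeo_group_fixing_mapsto[OF assms] by (auto simp: piece_def)

lemma coloring_comp:
  assumes c: "coloring E x n c" and g: "g \<in> carrier (homeo_group_fixing E x)"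
  shows "coloring E x n (\<lambda>y. c (g y))"
proof -
  have "g ` topspace E = topspace E" and gx: "g x = x"
    using g by (auto simp: homeo_group_fixing_carrier Bij_def bij_betw_def)
  then have "(\<lambda>y. c (g y)) ` topspace E = c ` topspace E" by (metis image_image)
  then show ?thesis
    using c gx clopenin_vimage[OF homeo_group_fixing_continuous[OF g]]
    unfolding coloring_def piece_comp[OF g] by simp
qed

lemma natural_flag_image:
  assumes g: "g \<in> carrier (homeo_group_fixing E x)" and M: "M \<subseteq> hyperspace E"
  shows "natural E (flag_image g M) n c \<longleftrightarrow> natural E M n (\<lambda>y. c (g y))"
  unfolding natural_def before_flag_image[OF M] piece_comp[OF g] ..

text \<open>
  A clopen set that is a union of pieces is reached together with its piece of least label, so the
  labels alone decide which of two such sets is reached first.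
\<close>

lemma natural_determines_before:
  assumes M: "subset.maxchain \<A> M" and N: "subset.maxchain \<B> N"
    and c: "coloring E x n c" and natM: "natural E M n c" and natN: "natural E N n c"
    and A: "A \<subseteq> topspace E" and B: "B \<subseteq> topspace E" "B \<noteq> {}"
    and satA: "\<And>y z. y \<in> topspace E \<Longrightarrow> z \<in> topspace E \<Longrightarrow> c y = c z \<Longrightarrow> y \<in> A \<Longrightarrow> z \<in> A"
    and satB: "\<And>y z. y \<in> topspace E \<Longrightarrow> z \<in> topspace E \<Longrightarrow> c y = c z \<Longrightarrow> y \<in> B \<Longrightarrow> z \<in> B"
    and bef: "before N A B"
  shows "before M A B"
proof -
  obtain F y where F: "F \<in> N" "y \<in> F" "y \<in> A" "F \<inter> B = {}" using bef by (auto simp: before_def)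
  have yE: "y \<in> topspace E" using F A by blast
  have less: "c y < c z" if z: "z \<in> B" for z
  proof -
    have zE: "z \<in> topspace E" using z B by blast
    have pB: "piece E c (c z) \<subseteq> B" using satB[OF zE] z by (auto simp: piece_def)
    have "before N (piece E c (c y)) (piece E c (c z))"
      unfolding before_def using F yE pB by (intro bexI[of _ F]) (auto simp: piece_def)
    moreover have "y \<in> piece E c (c y)" using yE by (simp add: piece_def)
    ultimately have "c z \<noteq> c y" "\<not> before N (piece E c (c z)) (piece E c (c y))"
      using before_antisym[OF N] pB F by auto
    moreover have "c z < c y \<Longrightarrow> before N (piece E c (c z)) (piece E c (c y))"
      using natN coloring_bound[OF c yE] by (simp add: natural_def)
    ultimately show ?thesis by linarith
  qed
  have fin: "finite (c ` B)" using c B by (intro finite_subset[of "c ` B" "{..<n}"]) (auto simp: coloring_def)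
  (* The member of M that reaches the piece of y before the piece of label j misses all of B, because
     the other pieces of B have larger labels. *)
  define j where "j = Min (c ` B)"
  have jB: "j \<in> c ` B" unfolding j_def using fin B by (intro Min_in) auto
  have jn: "j < n" "c y < j" using jB less coloring_bound[OF c] B by auto
  have "before M (piece E c (c y)) (piece E c j)" using natM jn by (simp add: natural_def)
  then obtain K where K: "K \<in> M" "K \<inter> piece E c (c y) \<noteq> {}" "K \<inter> piece E c j = {}"
    unfolding before_def by blast
  have "K \<inter> B = {}"
  proof (rule ccontr)
    assume "K \<inter> B \<noteq> {}"
    then obtain z where z: "z \<in> K" "z \<in> B" by blast
    have zE: "z \<in> topspace E" using z B by blast
    then have zp: "z \<in> piece E c (c z)" by (simp add: piece_def)
    have "j \<le> c z" unfolding j_def using fin z by (intro Min_le) auto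
    moreover have "j \<noteq> c z" using K(3) z(1) zp by auto
    ultimately have "before M (piece E c j) (piece E c (c z))"
      using natM coloring_bound[OF c zE] by (simp add: natural_def)
    then obtain L where L: "L \<in> M" "L \<inter> piece E c j \<noteq> {}" "L \<inter> piece E c (c z) = {}"
      unfolding before_def by blast
    have "K \<subseteq> L \<or> L \<subseteq> K" using M K(1) L(1) by (simp add: subset_maxchain_iff)
    then show False using K L z zp by blast
  qed
  moreover have "K \<inter> A \<noteq> {}"
  proof -
    obtain z where "z \<in> K" "z \<in> piece E c (c y)" using K(2) by blast
    then have "z \<in> A" using satA[OF yE, of z] F(3) by (simp add: piece_def)
    then show ?thesis using \<open>z \<in> K\<close> by blast
  qed
  ultimately show ?thesis unfolding before_def using K(1) by blast
qed

lemma growth_rigid: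
  assumes rig: "\<And>s i. s < m \<Longrightarrow> i < \<rho> s \<Longrightarrow> \<exists>s'<s. \<rho> s' = i" and im: "\<rho> ` {..<m} = {..<n}"
  shows "s \<le> m \<Longrightarrow> \<rho> ` {..<s} = {..<t} \<Longrightarrow> growth t n (map \<rho> [s..<m])"
proof (induction "m - s" arbitrary: s t)
  case 0
  then show ?case using im by simp
next
  case (Suc k)
  then have s: "s < m" by simp
  have list: "[s..<m] = s # [Suc s..<m]" using s by (simp add: upt_conv_Cons)
  have im': "\<rho> ` {..<Suc s} = insert (\<rho> s) {..<t}" using Suc.prems by (simp add: lessThan_Suc)
  have "\<not> \<rho> s > t"
  proof
    assume "t < \<rho> s"
    then obtain s' where "s' < s" "\<rho> s' = t" using rig[OF s] by blast
    then have "t \<in> \<rho> ` {..<s}" by auto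
    then show False using Suc.prems by simp
  qed
  then consider "\<rho> s < t" | "\<rho> s = t" by linarith
  then show ?case
  proof cases
    case 1
    then have "\<rho> ` {..<Suc s} = {..<t}" using im' by auto
    then have "growth t n (map \<rho> [Suc s..<m])" using Suc.hyps(1)[of "Suc s" t] Suc.hyps(2) s by simp
    then show ?thesis using 1 by (simp add: list)
  next
    case 2
    then have "\<rho> ` {..<Suc s} = {..<Suc t}" using im' by auto
    then have "growth (Suc t) n (map \<rho> [Suc s..<m])" using Suc.hyps(1)[of "Suc s" "Suc t"] Suc.hyps(2) s by simp
    then show ?thesis using 2 by (simp add: list)
  qed
qed

lemma growth_covers: "growth t n w \<Longrightarrow> {t..<n} \<subseteq> set w"
proof (induction w arbitrary: t)
  case (Cons a w)
  then consider "a < t" "growth t n w" | "a = t" "growth (Suc t) n w" by auto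
  then show ?case
  proof cases
    case 1 then show ?thesis using Cons.IH by auto
  next
    case 2
    then have "{Suc t..<n} \<subseteq> set w" using Cons.IH by blast
    moreover have "{t..<n} \<subseteq> insert t {Suc t..<n}" by auto
    ultimately show ?thesis using 2 by auto
  qed
qed simp

text \<open>
  A union of pieces is reached with its first piece. So if \<open>c\<close> and \<open>d\<close> are both labelled in the order
  of \<open>M\<close>, the labels of \<open>c\<close> must first occur in increasing order along the labels of \<open>d\<close>. As \<open>x\<close> has
  label \<open>0\<close> in both, \<open>0\<close> is a letter and the other labels are parameters.
\<close>

lemma natural_refinement_word:
  assumes M: "subset.maxchain \<A> M" and x: "x \<in> topspace E"
    and c: "coloring E x n c" "natural E M n c" and d: "coloring E x m d" "natural E M m d"
    and \<rho>: "\<And>y. y \<in> topspace E \<Longrightarrow> c y = \<rho> (d y)"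
  shows "\<exists>w\<in>words 1 (n - 1) (m - 1). \<forall>y\<in>topspace E. c y = (0 # w) ! d y"
proof -
  have dim: "d ` topspace E = {..<m}" "c ` topspace E = {..<n}" using c d by (auto simp: coloring_def)
  have im: "\<rho> ` {..<m} = {..<n}"
    using \<rho> unfolding dim[symmetric] image_image by (intro image_cong) auto
  have nm: "n \<ge> 1" "m \<ge> 1" using coloring_bound[OF c(1) x] coloring_bound[OF d(1) x] by auto
  have \<rho>0: "\<rho> 0 = 0" using \<rho>[OF x] c d by (simp add: coloring_def)
  have rig: "\<exists>s'<s. \<rho> s' = i" if s: "s < m" and i: "i < \<rho> s" for s i
  proof -
    have "\<rho> s < n" using im s by auto
    then have "before M (piece E c i) (piece E c (\<rho> s))" using c(2) i by (simp add: natural_def)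
    then obtain F y where F: "F \<in> M" "y \<in> F" "y \<in> piece E c i" "F \<inter> piece E c (\<rho> s) = {}"
      unfolding before_def by blast
    have yE: "y \<in> topspace E" and cy: "\<rho> (d y) = i" using F(3) \<rho> by (auto simp: piece_def)
    have sub: "piece E d s \<subseteq> piece E c (\<rho> s)" using \<rho> by (auto simp: piece_def)
    have "d y < s"
    proof (rule ccontr)
      assume "\<not> d y < s"
      moreover have "d y \<noteq> s" using cy i by auto
      ultimately have "before M (piece E d s) (piece E d (d y))"
        using d(2) coloring_bound[OF d(1) yE] by (simp add: natural_def)
      then obtain L where L: "L \<in> M" "L \<inter> piece E d s \<noteq> {}" "L \<inter> piece E d (d y) = {}"
        unfolding before_def by blast
      have "y \<in> piece E d (d y)" using yE by (simp add: piece_def)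
      moreover have "F \<subseteq> L \<or> L \<subseteq> F" using M F(1) L(1) by (simp add: subset_maxchain_iff)
      ultimately show False using F L sub by blast
    qed
    then show ?thesis using cy by blast
  qed
  have "growth 1 n (map \<rho> [1..<m])"
    by (rule growth_rigid[OF rig im]) (use nm \<rho>0 in \<open>auto simp: lessThan_Suc\<close>)
  then have "map \<rho> [1..<m] \<in> words 1 (n - 1) (m - 1)" using nm by (simp add: words_def)
  moreover have "c y = (0 # map \<rho> [1..<m]) ! d y" if "y \<in> topspace E" for y
    using \<rho>[OF that] \<rho>0 coloring_bound[OF d(1) that] by (cases "d y") auto
  ultimately show ?thesis by (intro bexI[of _ "map \<rho> [1..<m]"] ballI)
qed

lemma coloring_word:
  assumes d: "coloring E x (Suc m) d" and w: "w \<in> words 1 k m"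
  shows "coloring E x (Suc k) (\<lambda>y. (0 # w) ! d y)"
proof -
  have dim: "d ` topspace E = {..<Suc m}" and d0: "d x = 0" and cl: "\<And>i. clopenin E (piece E d i)"
    using d by (auto simp: coloring_def)
  have len: "length w = m" and gw: "growth 1 (Suc k) w" using w by (auto simp: words_def)
  have "(\<lambda>y. (0 # w) ! d y) ` topspace E = (\<lambda>i. (0 # w) ! i) ` {..<Suc m}"
    unfolding dim[symmetric] image_image ..
  also have "\<dots> = set (0 # w)" using len by (subst set_conv_nth) auto
  also have "\<dots> = {..<Suc k}"
  proof
    show "set (0 # w) \<subseteq> {..<Suc k}" using growth_set[OF gw] by auto
    have "{1..<Suc k} \<subseteq> set w" by (rule growth_covers[OF gw])
    moreover have "{..<Suc k} \<subseteq> insert 0 {1..<Suc k}" by auto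
    ultimately show "{..<Suc k} \<subseteq> set (0 # w)" by auto
  qed
  finally have im: "(\<lambda>y. (0 # w) ! d y) ` topspace E = {..<Suc k}" .
  have "clopenin E (piece E (\<lambda>y. (0 # w) ! d y) i)" for i
  proof -
    have "piece E (\<lambda>y. (0 # w) ! d y) i = \<Union>(piece E d ` {j. j < Suc m \<and> (0 # w) ! j = i})"
      using coloring_bound[OF d] by (fastforce simp: piece_def)
    then show ?thesis using cl by (auto intro: clopenin_Union)
  qed
  then show ?thesis using im d0 by (simp add: coloring_def)
qed

lemma clopenin_INT: "finite I \<Longrightarrow> (\<And>i. i \<in> I \<Longrightarrow> clopenin X (f i)) \<Longrightarrow> clopenin X (topspace X \<inter> (\<Inter>i\<in>I. f i))"
proof (induction I rule: finite_induct)
  case (insert i I)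
  have "topspace X \<inter> (\<Inter>i\<in>insert i I. f i) = f i \<inter> (topspace X \<inter> (\<Inter>i\<in>I. f i))" by auto
  moreover have "clopenin X (f i \<inter> (topspace X \<inter> (\<Inter>i\<in>I. f i)))"
    by (intro clopenin_Int insert.IH insert.prems) auto
  ultimately show ?case by simp
qed simp

context perfect_stone
begin

text \<open>
  The values of a locally constant function can be relabelled in the order in which the chain reaches
  them. The label \<open>0\<close> goes to the value at \<open>x\<close> because \<open>{x}\<close> is a member of the chain.
\<close>

lemma natural_coloring_exists:
  assumes x: "x \<in> topspace E" and M: "subset.maxchain (hyperspace E) M" "{x} \<in> M"
    and fin: "finite (\<tau> ` topspace E)" and cl: "\<And>v. clopenin E (piece E \<tau> v)"
  obtains n e where "inj_on e (\<tau> ` topspace E)" "coloring E x n (\<lambda>y. e (\<tau> y))" "natural E M n (\<lambda>y. e (\<tau> y))"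
proof -
  let ?V = "\<tau> ` topspace E"
  define lt where "lt u v \<longleftrightarrow> before M (piece E \<tau> u) (piece E \<tau> v)" for u v
  have asym: "lt u v \<Longrightarrow> \<not> lt v u" for u v unfolding lt_def by (rule before_antisym[OF M(1)])
  have trans: "lt u v \<Longrightarrow> lt v w \<Longrightarrow> lt u w" for u v w unfolding lt_def by (rule before_trans[OF M(1)])
  have total: "lt u v \<or> lt v u" if "u \<in> ?V" "u \<noteq> v" for u v
    unfolding lt_def by (rule maxchain_separates[OF M(1) cl _ cl]) (use that in \<open>auto simp: piece_def\<close>)
  (* The new label of v is its rank, the number of values that are reached before it. *)
  define e where "e v = card {u \<in> ?V. lt u v}" for v
  have mono: "e u < e v" if "lt u v" "u \<in> ?V" for u v
  proof -
    have "{w \<in> ?V. lt w u} \<subseteq> {w \<in> ?V. lt w v}" using trans[OF _ that(1)] by blast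
    moreover have "u \<in> {w \<in> ?V. lt w v}" "u \<notin> {w \<in> ?V. lt w u}" using that asym by auto
    ultimately show ?thesis unfolding e_def using fin by (intro psubset_card_mono) auto
  qed
  have inj: "inj_on e ?V"
  proof (rule inj_onI)
    fix u v assume uv: "u \<in> ?V" "v \<in> ?V" "e u = e v"
    show "u = v"
    proof (rule ccontr)
      assume "u \<noteq> v"
      then have "lt u v \<or> lt v u" using total uv by blast
      then show False using mono[of u v] mono[of v u] uv by auto
    qed
  qed
  define n where "n = card ?V"
  have eV: "e ` ?V = {..<n}"
  proof (rule card_subset_eq)
    show "e ` ?V \<subseteq> {..<n}"
    proof
      fix i assume "i \<in> e ` ?V"
      then obtain v where v: "v \<in> ?V" "i = e v" by blast
      have "{u \<in> ?V. lt u v} \<subset> ?V" using v asym by blast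
      then show "i \<in> {..<n}" unfolding v(2) e_def n_def using fin by (simp add: psubset_card_mono)
    qed
    show "card (e ` ?V) = card {..<n}" using card_image[OF inj] by (simp add: n_def)
  qed simp
  have e0: "e (\<tau> x) = 0"
  proof -
    have "\<not> lt u (\<tau> x)" for u
    proof
      assume "lt u (\<tau> x)"
      then obtain F where F: "F \<in> M" "F \<inter> piece E \<tau> u \<noteq> {}" "F \<inter> piece E \<tau> (\<tau> x) = {}"
        unfolding lt_def before_def by blast
      have "\<forall>F\<in>M. \<forall>N\<in>M. F \<subseteq> N \<or> N \<subseteq> F" using M(1) unfolding subset_maxchain_iff by (elim conjE)
      from bspec[OF bspec[OF this F(1)] M(2)] have "F \<subseteq> {x} \<or> {x} \<subseteq> F" .
      then have "x \<in> F" using F(2) by blast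
      then show False using F(3) x by (auto simp: piece_def)
    qed
    then show ?thesis by (simp add: e_def)
  qed
  have piece: "piece E (\<lambda>y. e (\<tau> y)) (e v) = piece E \<tau> v" if "v \<in> ?V" for v
    using inj that by (auto simp: piece_def inj_on_eq_iff)
  have out: "piece E (\<lambda>y. e (\<tau> y)) i = {}" if "i \<notin> e ` ?V" for i
    using that by (auto simp: piece_def)
  show thesis
  proof (rule that[OF inj])
    show "coloring E x n (\<lambda>y. e (\<tau> y))"
      unfolding coloring_def
    proof (intro conjI allI)
      show "clopenin E (piece E (\<lambda>y. e (\<tau> y)) i)" for i
      proof (cases "i \<in> e ` ?V")
        case True
        then show ?thesis using piece cl by auto
      next
        case False
        then show ?thesis using out by (simp add: clopenin_def)
      qed
      show "(\<lambda>y. e (\<tau> y)) ` topspace E = {..<n}" using eV by (simp add: image_image)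
    qed (rule e0)
    show "natural E M n (\<lambda>y. e (\<tau> y))"
      unfolding natural_def
    proof (intro allI impI)
      fix i j :: nat assume ij: "i < j" "j < n"
      then have "i \<in> e ` ?V" "j \<in> e ` ?V" using eV by auto
      then obtain u v where u: "u \<in> ?V" "i = e u" and v: "v \<in> ?V" "j = e v" by blast
      have "\<not> lt v u" "u \<noteq> v" using mono[of v u] ij u v by auto
      then have "lt u v" using total u by blast
      then show "before M (piece E (\<lambda>y. e (\<tau> y)) i) (piece E (\<lambda>y. e (\<tau> y)) j)"
        using piece u v by (simp add: lt_def)
    qed
  qed
qed

text \<open>
  The fibres of the map into the product form a common refinement; they are relabelled in the order of
  the chain.
\<close>

lemma natural_coloring_of_functions:
  assumes x: "x \<in> topspace E" and M: "subset.maxchain (hyperspace E) M" "{x} \<in> M" and J: "finite J"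
    and fin: "\<And>j. j \<in> J \<Longrightarrow> finite (f j ` topspace E)" and cl: "\<And>j v. j \<in> J \<Longrightarrow> clopenin E (piece E (f j) v)"
  obtains n c where "coloring E x n c" "natural E M n c"
    "\<forall>j\<in>J. \<exists>\<rho>. \<forall>y\<in>topspace E. f j y = \<rho> (c y)"
proof -
  define \<tau> where "\<tau> y = restrict (\<lambda>j. f j y) J" for y
  have "\<tau> ` topspace E \<subseteq> (\<Pi>\<^sub>E j\<in>J. f j ` topspace E)" by (auto simp: \<tau>_def)
  then have fin\<tau>: "finite (\<tau> ` topspace E)"
    using finite_PiE[OF J, of "\<lambda>j. f j ` topspace E"] fin finite_subset by blast
  have cl\<tau>: "clopenin E (piece E \<tau> v)" for v
  proof (cases "v \<in> extensional J")
    case True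
    have "\<tau> y = v \<longleftrightarrow> (\<forall>j\<in>J. f j y = v j)" for y
    proof
      assume "\<tau> y = v"
      then show "\<forall>j\<in>J. f j y = v j" unfolding \<tau>_def by (metis restrict_apply')
    next
      assume *: "\<forall>j\<in>J. f j y = v j"
      show "\<tau> y = v" by (rule extensionalityI[OF _ True]) (use * in \<open>auto simp: \<tau>_def\<close>)
    qed
    then have "piece E \<tau> v = topspace E \<inter> (\<Inter>j\<in>J. piece E (f j) (v j))"
      by (auto simp: piece_def)
    then show ?thesis using clopenin_INT[OF J, of E "\<lambda>j. piece E (f j) (v j)"] cl by simp
  next
    case False
    have "\<tau> y \<noteq> v" for y using False by (auto simp: \<tau>_def)
    then have "piece E \<tau> v = {}" by (simp add: piece_def)
    then show ?thesis by (simp add: clopenin_def)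
  qed
  obtain n e where e: "inj_on e (\<tau> ` topspace E)" "coloring E x n (\<lambda>y. e (\<tau> y))" "natural E M n (\<lambda>y. e (\<tau> y))"
    by (rule natural_coloring_exists[OF x M fin\<tau> cl\<tau>])
  show thesis
  proof (rule that[OF e(2,3)], rule ballI)
    fix j assume j: "j \<in> J"
    have "f j y = (inv_into (\<tau> ` topspace E) e (e (\<tau> y))) j" if "y \<in> topspace E" for y
      using that j inv_into_f_f[OF e(1), of "\<tau> y"] by (simp add: \<tau>_def)
    then show "\<exists>\<rho>. \<forall>y\<in>topspace E. f j y = \<rho> (e (\<tau> y))"
      by (intro exI[of _ "\<lambda>i. inv_into (\<tau> ` topspace E) e i j"]) simp
  qed
qed

lemma natural_coloring_of_sets:
  assumes x: "x \<in> topspace E" and M: "subset.maxchain (hyperspace E) M" "{x} \<in> M"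
    and fin: "finite \<A>" and cl: "\<And>A. A \<in> \<A> \<Longrightarrow> clopenin E A"
  obtains n c where "coloring E x n c" "natural E M n c"
    "\<And>A y z. A \<in> \<A> \<Longrightarrow> y \<in> topspace E \<Longrightarrow> z \<in> topspace E \<Longrightarrow> c y = c z \<Longrightarrow> y \<in> A \<Longrightarrow> z \<in> A"
proof -
  have mem: "clopenin E (piece E (\<lambda>y. y \<in> A) v)" if "A \<in> \<A>" for A v
  proof (cases v)
    case True
    then have "piece E (\<lambda>y. y \<in> A) v = A" using clopenin_subset[OF cl[OF that]] by (auto simp: piece_def)
    then show ?thesis using cl that by simp
  next
    case False
    then have "piece E (\<lambda>y. y \<in> A) v = topspace E - A" by (auto simp: piece_def)
    then show ?thesis using cl that by (simp add: clopenin_Diff)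
  qed
  have "finite ((\<lambda>y. y \<in> A) ` topspace E)" for A by simp
  then obtain n c where c: "coloring E x n c" "natural E M n c"
    and \<rho>: "\<forall>A\<in>\<A>. \<exists>\<rho>. \<forall>y\<in>topspace E. (y \<in> A) = \<rho> (c y)"
    by (rule natural_coloring_of_functions[OF x M fin, OF _ mem])
  show thesis
  proof (rule that[OF c])
    fix A y z assume *: "A \<in> \<A>" "y \<in> topspace E" "z \<in> topspace E" "c y = c z" "y \<in> A"
    obtain \<rho> where "\<forall>y\<in>topspace E. (y \<in> A) = \<rho> (c y)" using bspec[OF \<rho> *(1)] by blast
    then show "z \<in> A" using * by metis
  qed
qed

lemma flag_nbhd_natural:
  assumes x: "x \<in> topspace E" and U: "openin (maxchain_space_at E x) U" and N: "N \<in> U"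
  obtains n c where "coloring E x n c" "natural E N n c"
    "\<And>M. M \<in> topspace (maxchain_space_at E x) \<Longrightarrow> natural E M n c \<Longrightarrow> M \<in> U"
proof -
  have "N \<in> topspace (maxchain_space_at E x)" using openin_subset[OF U] N by blast
  then have Nm: "subset.maxchain (hyperspace E) N" "{x} \<in> N" unfolding topspace_flags by auto
  obtain \<P> where \<P>: "finite \<P>"
    "\<And>A B. (A, B) \<in> \<P> \<Longrightarrow> clopenin E A \<and> clopenin E B \<and> B \<noteq> {} \<and> before N A B"
    "\<And>M. M \<in> topspace (maxchain_space_at E x) \<Longrightarrow> (\<And>A B. (A, B) \<in> \<P> \<Longrightarrow> before M A B) \<Longrightarrow> M \<in> U"
    using flag_nbhd[OF x U N] by metis
  have "finite (fst ` \<P> \<union> snd ` \<P>)" "\<And>A. A \<in> fst ` \<P> \<union> snd ` \<P> \<Longrightarrow> clopenin E A"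
    using \<P>(1,2) by auto
  from natural_coloring_of_sets[OF x Nm this] obtain n c where c: "coloring E x n c" "natural E N n c" and
    sat: "\<And>A y z. A \<in> fst ` \<P> \<union> snd ` \<P> \<Longrightarrow> y \<in> topspace E \<Longrightarrow> z \<in> topspace E \<Longrightarrow> c y = c z \<Longrightarrow> y \<in> A \<Longrightarrow> z \<in> A"
    by metis
  show thesis
  proof (rule that[OF c])
    fix M assume M: "M \<in> topspace (maxchain_space_at E x)" "natural E M n c"
    then have Mm: "subset.maxchain (hyperspace E) M" unfolding topspace_flags by auto
    show "M \<in> U"
    proof (rule \<P>(3)[OF M(1)])
      fix A B assume AB: "(A, B) \<in> \<P>"
      have mem: "A \<in> fst ` \<P> \<union> snd ` \<P>" "B \<in> fst ` \<P> \<union> snd ` \<P>" using AB by force+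
      note p = \<P>(2)[OF AB]
      show "before M A B"
      proof (rule natural_determines_before[OF Mm Nm(1) c(1) M(2) c(2)])
        show "A \<subseteq> topspace E" "B \<subseteq> topspace E" using p by (simp_all add: clopenin_subset)
        show "B \<noteq> {}" "before N A B" using p by auto
        show "z \<in> A" if "y \<in> topspace E" "z \<in> topspace E" "c y = c z" "y \<in> A" for y z
          by (rule sat[OF mem(1) that])
        show "z \<in> B" if "y \<in> topspace E" "z \<in> topspace E" "c y = c z" "y \<in> B" for y z
          by (rule sat[OF mem(2) that])
      qed
    qed
  qed
qed

lemma openin_natural:
  assumes "coloring E x n c"
  shows "openin (maxchain_space_at E x) {M \<in> topspace (maxchain_space_at E x). natural E M n c}"
proof -
  let ?\<Phi> = "maxchain_space_at E x"
  let ?I = "{(i, j). i < j \<and> j < n}"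
  have "finite ?I" by (rule finite_subset[of _ "{..<n} \<times> {..<n}"]) auto
  moreover have "openin ?\<Phi> {M \<in> topspace ?\<Phi>. before M (piece E c i) (piece E c j)}" for i j
    using assms by (intro openin_before) (auto simp: coloring_def)
  ultimately have "openin ?\<Phi> ((\<Inter>(i, j)\<in>?I. {M \<in> topspace ?\<Phi>. before M (piece E c i) (piece E c j)}) \<inter> topspace ?\<Phi>)"
    by (intro openin_INT) auto
  moreover have "{M \<in> topspace ?\<Phi>. natural E M n c} =
    (\<Inter>(i, j)\<in>?I. {M \<in> topspace ?\<Phi>. before M (piece E c i) (piece E c j)}) \<inter> topspace ?\<Phi>"
    unfolding natural_def by auto
  ultimately show ?thesis by simp
qed

end

section \<open>The flow of maximal chains\<close>

lemma homeomorphic_maps_glue: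
  assumes c: "\<And>i. openin X (piece X c i)" and d: "\<And>i. openin Y (piece Y d i)"
    and hom: "\<And>i. homeomorphic_maps (subtopology X (piece X c i)) (subtopology Y (piece Y d i)) (f i) (g i)"
  shows "homeomorphic_maps X Y (\<lambda>y. f (c y) y) (\<lambda>z. g (d z) z)"
    and "\<And>y. y \<in> topspace X \<Longrightarrow> d (f (c y) y) = c y"
proof -
  have pX: "topspace (subtopology X (piece X c i)) = piece X c i" for i by (auto simp: piece_def)
  have pY: "topspace (subtopology Y (piece Y d i)) = piece Y d i" for i by (auto simp: piece_def)
  have f: "continuous_map (subtopology X (piece X c i)) (subtopology Y (piece Y d i)) (f i)"
    and g: "continuous_map (subtopology Y (piece Y d i)) (subtopology X (piece X c i)) (g i)"
    and gf: "\<forall>y\<in>piece X c i. g i (f i y) = y" and fg: "\<forall>y\<in>piece Y d i. f i (g i y) = y" for i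
    using hom[of i] unfolding homeomorphic_maps_def pX pY by auto
  have fm: "f i y \<in> piece Y d i" if "y \<in> piece X c i" for i y
    using continuous_map_funspace[OF f[of i]] that unfolding pX pY by blast
  have gm: "g i y \<in> piece X c i" if "y \<in> piece Y d i" for i y
    using continuous_map_funspace[OF g[of i]] that unfolding pX pY by blast
  have inp: "y \<in> piece X c (c y)" if "y \<in> topspace X" for y using that by (simp add: piece_def)
  have inpY: "y \<in> piece Y d (d y)" if "y \<in> topspace Y" for y using that by (simp add: piece_def)
  show df: "d (f (c y) y) = c y" if "y \<in> topspace X" for y
    using fm[OF inp[OF that]] by (simp add: piece_def)
  have cg: "c (g (d y) y) = d y" if "y \<in> topspace Y" for y
    using gm[OF inpY[OF that]] by (simp add: piece_def)
  have cf: "continuous_map X Y (\<lambda>y. f (c y) y)"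
  proof (rule pasting_lemma[where I = UNIV and T = "piece X c" and f = f])
    show "continuous_map (subtopology X (piece X c i)) Y (f i)" for i
      using f by (rule continuous_map_into_fulltopology)
    show "f i y = f j y" if "y \<in> topspace X \<inter> piece X c i \<inter> piece X c j" for i j y
      using that by (auto simp: piece_def)
    show "\<exists>j. j \<in> UNIV \<and> y \<in> piece X c j \<and> f (c y) y = f j y" if "y \<in> topspace X" for y
      using inp[OF that] by (intro exI[of _ "c y"]) simp
  qed (rule c)
  have cgc: "continuous_map Y X (\<lambda>y. g (d y) y)"
  proof (rule pasting_lemma[where I = UNIV and T = "piece Y d" and f = g])
    show "continuous_map (subtopology Y (piece Y d i)) X (g i)" for i
      using g by (rule continuous_map_into_fulltopology)
    show "g i y = g j y" if "y \<in> topspace Y \<inter> piece Y d i \<inter> piece Y d j" for i j y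
      using that by (auto simp: piece_def)
    show "\<exists>j. j \<in> UNIV \<and> y \<in> piece Y d j \<and> g (d y) y = g j y" if "y \<in> topspace Y" for y
      using inpY[OF that] by (intro exI[of _ "d y"]) simp
  qed (rule d)
  show "homeomorphic_maps X Y (\<lambda>y. f (c y) y) (\<lambda>z. g (d z) z)"
    unfolding homeomorphic_maps_def
    using cf cgc gf fg inp inpY df cg by simp
qed

context perfect_stone
begin

text \<open>
  A piece can always be split, because the space has no isolated points.
\<close>

lemma coloring_exists:
  assumes x: "x \<in> topspace E"
  shows "\<exists>c. coloring E x (Suc n) c"
proof (induction n)
  case 0
  have "piece E (\<lambda>_. 0::nat) i = (if i = 0 then topspace E else {})" for i by (auto simp: piece_def)
  moreover have "(\<lambda>_. 0::nat) ` topspace E = {0}" using x by auto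
  ultimately have "coloring E x (Suc 0) (\<lambda>_. 0)"
    by (simp add: coloring_def clopenin_def lessThan_Suc)
  then show ?case by blast
next
  case (Suc n)
  then obtain c where c: "coloring E x (Suc n) c" by blast
  then have cl: "\<And>i. clopenin E (piece E c i)" and im: "c ` topspace E = {..<Suc n}" and c0: "c x = 0"
    by (auto simp: coloring_def)
  have op: "openin E (piece E c 0)" using cl by (simp add: clopenin_def)
  have xp: "x \<in> piece E c 0" using x c0 by (simp add: piece_def)
  obtain z where z: "z \<in> piece E c 0" "z \<noteq> x" using no_isolated[OF op xp] by blast
  have zE: "z \<in> topspace E" using z by (simp add: piece_def)
  have "openin E (piece E c 0 - {x})"
    using op closedin_Hausdorff_singleton[OF Hausdorff x] by (intro openin_diff)
  then obtain A where A: "clopenin E A" "z \<in> A" "A \<subseteq> piece E c 0 - {x}"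
    using clopen_nbhd[of "piece E c 0 - {x}" z] z by blast
  define d where "d y = (if y \<in> A then Suc n else c y)" for y
  have "piece E d i = (if i = Suc n then A \<union> piece E c i else piece E c i - A)" for i
    using A(3) by (auto simp: piece_def d_def)
  moreover have "clopenin E (A \<union> piece E c i)" for i
    using A(1) cl by (simp add: clopenin_def closedin_Un openin_Un)
  moreover have "clopenin E (piece E c i - A)" for i by (rule clopenin_Diff[OF cl A(1)])
  ultimately have "clopenin E (piece E d i)" for i by simp
  moreover have "d ` topspace E = {..<Suc (Suc n)}"
  proof
    show "d ` topspace E \<subseteq> {..<Suc (Suc n)}"
      using coloring_bound[OF c] by (auto simp: d_def less_Suc_eq)
    show "{..<Suc (Suc n)} \<subseteq> d ` topspace E"
    proof
      fix i assume "i \<in> {..<Suc (Suc n)}"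
      then consider "i = Suc n" | "i = 0" | "i < Suc n" "i \<noteq> 0" by (auto simp: less_Suc_eq)
      then show "i \<in> d ` topspace E"
      proof cases
        case 1
        then show ?thesis using zE A(2) by (intro image_eqI[of _ _ z]) (simp_all add: d_def)
      next
        case 2
        then show ?thesis using x A(3) c0 by (intro image_eqI[of _ _ x]) (auto simp: d_def)
      next
        case 3
        then obtain y where y: "y \<in> topspace E" "i = c y" using im by auto
        then have "y \<notin> A" using A(3) 3 by (auto simp: piece_def)
        then show ?thesis using y by (intro image_eqI[of _ _ y]) (simp_all add: d_def)
      qed
    qed
  qed
  moreover have "d x = 0" using A(3) c0 by (auto simp: d_def)
  ultimately show ?case unfolding coloring_def by blast
qed

lemma coloring_of_sets:
  assumes x: "x \<in> topspace E" and fin: "finite \<A>" and cl: "\<And>A. A \<in> \<A> \<Longrightarrow> clopenin E A"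
  obtains n c where "coloring E x n c"
    "\<And>A y z. A \<in> \<A> \<Longrightarrow> y \<in> topspace E \<Longrightarrow> z \<in> topspace E \<Longrightarrow> c y = c z \<Longrightarrow> y \<in> A \<Longrightarrow> z \<in> A"
proof -
  obtain M where "M \<in> topspace (maxchain_space_at E x)" using flags_nonempty[OF x] by blast
  then have "subset.maxchain (hyperspace E) M" "{x} \<in> M" unfolding topspace_flags by auto
  from natural_coloring_of_sets[OF x this fin cl] show thesis using that by metis
qed

lemma clopen_between:
  assumes K: "compactin E K" and U: "openin E U" and KU: "K \<subseteq> U"
  obtains A where "clopenin E A" "K \<subseteq> A" "A \<subseteq> U"
proof -
  have "\<exists>\<F>. finite \<F> \<and> \<F> \<subseteq> {A. clopenin E A \<and> A \<subseteq> U} \<and> K \<subseteq> \<Union>\<F>"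
  proof (rule compactinD[OF K])
    show "K \<subseteq> \<Union>{A. clopenin E A \<and> A \<subseteq> U}"
      using clopen_nbhd[OF U] KU by blast
  qed (simp add: clopenin_def)
  then obtain \<F> where \<F>: "finite \<F>" "\<F> \<subseteq> {A. clopenin E A \<and> A \<subseteq> U}" "K \<subseteq> \<Union>\<F>" by blast
  show thesis
  proof (rule that)
    show "clopenin E (\<Union>\<F>)" using \<F> by (intro clopenin_Union) auto
  qed (use \<F> in auto)
qed

text \<open>
  With \<open>homeo_topology_nbhd\<close>: neighbourhoods of \<open>g\<close> in the compact-open topology are given by the
  homeomorphisms that agree with \<open>g\<close> after composition with a coloring.
\<close>

lemma openin_preserving:
  assumes c: "coloring E x n c" and g: "g \<in> carrier (homeo_group_fixing E x)"
  shows "openin (homeo_topology_fixing E x)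
    {v \<in> carrier (homeo_group_fixing E x). \<forall>y\<in>topspace E. c (v y) = c (g y)}"
proof -
  let ?G = "carrier (homeo_group_fixing E x)" and ?H = "carrier (homeo_group E)"
  let ?d = "\<lambda>y. c (g y)"
  have d: "coloring E x n ?d" by (rule coloring_comp[OF c g])
  define W where "W i = {v \<in> ?H. v ` piece E ?d i \<subseteq> piece E c i}" for i
  have "openin (compact_open_topology E) (W i)" for i
  proof -
    have "compactin E (piece E ?d i)" "openin E (piece E c i)"
      using c d by (auto simp: coloring_def clopenin_def intro: closedin_compact_space[OF compact])
    then show ?thesis unfolding compact_open_topology_def W_def
      by (intro topology_generated_by_Basis) blast
  qed
  then have "openin (compact_open_topology E) ((\<Inter>i\<in>{..<n}. W i) \<inter> topspace (compact_open_topology E))"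
    by (intro openin_INT) auto
  moreover have "{v \<in> ?G. \<forall>y\<in>topspace E. c (v y) = c (g y)} =
    ((\<Inter>i\<in>{..<n}. W i) \<inter> topspace (compact_open_topology E)) \<inter> ?G"
  proof (rule equalityI; rule subsetI)
    fix v assume v: "v \<in> {v \<in> ?G. \<forall>y\<in>topspace E. c (v y) = c (g y)}"
    then have vG: "v \<in> ?G" and vH: "v \<in> ?H" by (auto simp: homeo_group_fixing_def)
    have "v \<in> W i" for i
      using v vH homeo_group_fixing_mapsto[OF vG] by (auto simp: W_def piece_def)
    then show "v \<in> ((\<Inter>i\<in>{..<n}. W i) \<inter> topspace (compact_open_topology E)) \<inter> ?G"
      using vG vH by simp
  next
    fix v assume v: "v \<in> ((\<Inter>i\<in>{..<n}. W i) \<inter> topspace (compact_open_topology E)) \<inter> ?G"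
    have "c (v y) = c (g y)" if y: "y \<in> topspace E" for y
    proof -
      have "v \<in> W (c (g y))" using v coloring_bound[OF d y] by simp
      then have "v ` piece E ?d (c (g y)) \<subseteq> piece E c (c (g y))" by (simp add: W_def)
      moreover have "y \<in> piece E ?d (c (g y))" using y by (simp add: piece_def)
      ultimately have "v y \<in> piece E c (c (g y))" by blast
      then show ?thesis by (simp add: piece_def)
    qed
    then show "v \<in> {v \<in> ?G. \<forall>y\<in>topspace E. c (v y) = c (g y)}" using v by simp
  qed
  ultimately show ?thesis unfolding homeo_topology_fixing_def openin_subtopology by blast
qed

text \<open>
  A compact set that is mapped into an open set is mapped into a clopen subset of it, so only finitely
  many clopen sets matter, and these are unions of pieces of one coloring.
\<close>

lemma homeo_topology_nbhd:
  assumes x: "x \<in> topspace E" and W: "openin (homeo_topology_fixing E x) W" and g: "g \<in> W"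
  obtains n c where "coloring E x n c"
    "\<And>v. v \<in> carrier (homeo_group_fixing E x) \<Longrightarrow> (\<And>y. y \<in> topspace E \<Longrightarrow> c (v y) = c (g y)) \<Longrightarrow> v \<in> W"
proof -
  let ?G = "carrier (homeo_group_fixing E x)" and ?H = "carrier (homeo_group E)"
  obtain W' where W': "openin (compact_open_topology E) W'" "W = W' \<inter> ?G"
    using W unfolding homeo_topology_fixing_def openin_subtopology by blast
  have gG: "g \<in> ?G" "g \<in> W'" using g W' by auto
  have "generate_topology_on {{g \<in> ?H. g ` K \<subseteq> U} | K U. compactin E K \<and> openin E U} W'"
    using W'(1) unfolding compact_open_topology_def by (rule openin_topology_generated_by)
  then have "\<exists>\<A>. finite \<A> \<and> (\<forall>A\<in>\<A>. clopenin E A) \<and>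
    (\<forall>v\<in>?G. (\<forall>A\<in>\<A>. \<forall>y\<in>topspace E. g y \<in> A \<longrightarrow> v y \<in> A) \<longrightarrow> v \<in> W')"
    using gG(2)
  proof induction
    case (Int a b)
    have ab: "g \<in> a" "g \<in> b" using Int.prems by auto
    obtain \<A> where A: "finite \<A>" "\<forall>A\<in>\<A>. clopenin E A"
      "\<forall>v\<in>?G. (\<forall>A\<in>\<A>. \<forall>y\<in>topspace E. g y \<in> A \<longrightarrow> v y \<in> A) \<longrightarrow> v \<in> a"
      using Int.IH(1)[OF ab(1)] by (elim exE conjE)
    obtain \<B> where B: "finite \<B>" "\<forall>A\<in>\<B>. clopenin E A"
      "\<forall>v\<in>?G. (\<forall>A\<in>\<B>. \<forall>y\<in>topspace E. g y \<in> A \<longrightarrow> v y \<in> A) \<longrightarrow> v \<in> b"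
      using Int.IH(2)[OF ab(2)] by (elim exE conjE)
    show ?case
      using A B by (intro exI[of _ "\<A> \<union> \<B>"]) auto
  next
    case (UN \<K>)
    obtain k where k: "k \<in> \<K>" "g \<in> k" using UN.prems by auto
    obtain \<A> where A: "finite \<A>" "\<forall>A\<in>\<A>. clopenin E A"
      "\<forall>v\<in>?G. (\<forall>A\<in>\<A>. \<forall>y\<in>topspace E. g y \<in> A \<longrightarrow> v y \<in> A) \<longrightarrow> v \<in> k"
      using UN.IH[OF k] by (elim exE conjE)
    show ?case
      using A k(1) by (intro exI[of _ \<A>]) auto
  next
    case (Basis s)
    obtain K U where KU: "compactin E K" "openin E U" and s: "s = {g \<in> ?H. g ` K \<subseteq> U}"
      using Basis.hyps by (elim CollectE exE conjE)
    have gK: "g ` K \<subseteq> U" using Basis.prems s by auto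
    have "compactin E (g ` K)"
      by (rule image_compactin[OF KU(1) homeo_group_fixing_continuous[OF gG(1)]])
    then obtain A where A: "clopenin E A" "g ` K \<subseteq> A" "A \<subseteq> U"
      by (rule clopen_between[OF _ KU(2) gK])
    have KE: "K \<subseteq> topspace E" using KU(1) by (rule compactin_subset_topspace)
    have "v \<in> s" if v: "v \<in> ?G" "\<forall>y\<in>topspace E. g y \<in> A \<longrightarrow> v y \<in> A" for v
    proof -
      have "v ` K \<subseteq> U" using v(2) A KE by blast
      then show ?thesis using v(1) s by (simp add: homeo_group_fixing_def)
    qed
    then show ?case using A(1) by (intro exI[of _ "{A}"]) auto
  qed simp
  then obtain \<A> where A: "finite \<A>" "\<forall>A\<in>\<A>. clopenin E A"
    "\<forall>v\<in>?G. (\<forall>A\<in>\<A>. \<forall>y\<in>topspace E. g y \<in> A \<longrightarrow> v y \<in> A) \<longrightarrow> v \<in> W'"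
    by (elim exE conjE)
  obtain n c where c: "coloring E x n c" and
    sat: "\<And>A y z. A \<in> \<A> \<Longrightarrow> y \<in> topspace E \<Longrightarrow> z \<in> topspace E \<Longrightarrow> c y = c z \<Longrightarrow> y \<in> A \<Longrightarrow> z \<in> A"
    using coloring_of_sets[OF x A(1)] A(2) by metis
  show thesis
  proof (rule that[OF c])
    fix v assume v: "v \<in> ?G" "\<And>y. y \<in> topspace E \<Longrightarrow> c (v y) = c (g y)"
    have "v y \<in> A" if "A \<in> \<A>" "y \<in> topspace E" "g y \<in> A" for A y
      by (rule sat[OF that(1) _ _ _ that(3)])
        (use that v homeo_group_fixing_mapsto gG in auto)
    then show "v \<in> W" using A(3) v(1) W'(2) by simp
  qed
qed

lemma continuous_map_into_homeo_topology:
  assumes x: "x \<in> topspace E" and f: "\<And>p. p \<in> topspace X \<Longrightarrow> f p \<in> carrier (homeo_group_fixing E x)"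
    and loc: "\<And>p n c. p \<in> topspace X \<Longrightarrow> coloring E x n c \<Longrightarrow>
      \<exists>P. openin X P \<and> p \<in> P \<and> (\<forall>q\<in>P. \<forall>y\<in>topspace E. c (f q y) = c (f p y))"
  shows "continuous_map X (homeo_topology_fixing E x) f"
  unfolding continuous_map_def
proof (intro conjI allI impI)
  show "f \<in> topspace X \<rightarrow> topspace (homeo_topology_fixing E x)" using f by simp
  fix W assume W: "openin (homeo_topology_fixing E x) W"
  show "openin X {p \<in> topspace X. f p \<in> W}"
  proof (subst openin_subopen, intro ballI)
    fix p assume p: "p \<in> {p \<in> topspace X. f p \<in> W}"
    obtain n c where c: "coloring E x n c"
      and cW: "\<And>v. v \<in> carrier (homeo_group_fixing E x) \<Longrightarrow> (\<And>y. y \<in> topspace E \<Longrightarrow> c (v y) = c (f p y)) \<Longrightarrow> v \<in> W"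
      using homeo_topology_nbhd[OF x W] p by blast
    obtain P where P: "openin X P" "p \<in> P" "\<forall>q\<in>P. \<forall>y\<in>topspace E. c (f q y) = c (f p y)"
      using loc[OF _ c] p by blast
    have "P \<subseteq> {p \<in> topspace X. f p \<in> W}"
    proof
      fix q assume q: "q \<in> P"
      then have qX: "q \<in> topspace X" using openin_subset[OF P(1)] by blast
      have "f q \<in> W" by (rule cW[OF f[OF qX]]) (use P(3) q in blast)
      then show "q \<in> {p \<in> topspace X. f p \<in> W}" using qX by simp
    qed
    then show "\<exists>T. openin X T \<and> p \<in> T \<and> T \<subseteq> {p \<in> topspace X. f p \<in> W}"
      using P by blast
  qed
qed

text \<open>
  Neighbourhoods for \<open>g h\<close> come from \<open>c (g (h y))\<close>: keep \<open>c\<close> after \<open>g\<close>, and the coloring \<open>c g\<close> after \<open>h\<close>.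
  For the inverse of \<open>g\<close> use the coloring obtained by composing \<open>c\<close> with that inverse.
\<close>

lemma topological_group_homeo_fixing:
  assumes x: "x \<in> topspace E"
  shows "topological_group (homeo_group_fixing E x) (homeo_topology_fixing E x)"
proof -
  let ?G = "homeo_group_fixing E x" and ?T = "homeo_topology_fixing E x"
  interpret group ?G by (rule group_homeo_group_fixing[OF x])
  note mult = homeo_group_fixing_mult[OF _ _ x]
  show ?thesis
  proof unfold_locales
    show "topspace ?T = carrier ?G" by simp
    show "continuous_map (prod_topology ?T ?T) ?T (\<lambda>(g, h). g \<otimes>\<^bsub>?G\<^esub> h)"
    proof (rule continuous_map_into_homeo_topology[OF x])
      show "(\<lambda>(g, h). g \<otimes>\<^bsub>?G\<^esub> h) p \<in> carrier ?G" if "p \<in> topspace (prod_topology ?T ?T)" for p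
        using that by auto
      fix p n c assume p: "p \<in> topspace (prod_topology ?T ?T)" and c: "coloring E x n c"
      obtain g h where gh: "p = (g, h)" "g \<in> carrier ?G" "h \<in> carrier ?G" using p by auto
      define P where "P = {v \<in> carrier ?G. \<forall>y\<in>topspace E. c (v y) = c (g y)} \<times>
        {v \<in> carrier ?G. \<forall>y\<in>topspace E. c (g (v y)) = c (g (h y))}"
      have P: "openin (prod_topology ?T ?T) P"
        unfolding P_def openin_prod_Times_iff
        using openin_preserving[OF c gh(2)] openin_preserving[OF coloring_comp[OF c gh(2)] gh(3)] by simp
      have pP: "p \<in> P" using gh by (simp add: P_def)
      have Pc: "c ((\<lambda>(g, h). g \<otimes>\<^bsub>?G\<^esub> h) q y) = c ((\<lambda>(g, h). g \<otimes>\<^bsub>?G\<^esub> h) p y)"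
        if q: "q \<in> P" and y: "y \<in> topspace E" for q y
      proof -
        obtain g' h' where q': "q = (g', h')" "g' \<in> carrier ?G" "h' \<in> carrier ?G"
          "\<forall>y\<in>topspace E. c (g' y) = c (g y)" "\<forall>y\<in>topspace E. c (g (h' y)) = c (g (h y))"
          using q by (auto simp: P_def)
        have "c (g' (h' y)) = c (g (h y))"
          using q' y homeo_group_fixing_mapsto[OF q'(3) y] by simp
        then show ?thesis using q' gh y by (simp add: mult)
      qed
      show "\<exists>P. openin (prod_topology ?T ?T) P \<and> p \<in> P \<and>
        (\<forall>q\<in>P. \<forall>y\<in>topspace E. c ((\<lambda>(g, h). g \<otimes>\<^bsub>?G\<^esub> h) q y) = c ((\<lambda>(g, h). g \<otimes>\<^bsub>?G\<^esub> h) p y))"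
        by (intro exI[of _ P] conjI ballI P pP Pc)
    qed
    show "continuous_map ?T ?T (\<lambda>g. inv\<^bsub>?G\<^esub> g)"
    proof (rule continuous_map_into_homeo_topology[OF x])
      show "inv\<^bsub>?G\<^esub> p \<in> carrier ?G" if "p \<in> topspace ?T" for p using that by simp
      fix g n c assume "g \<in> topspace ?T" and c: "coloring E x n c"
      then have g: "g \<in> carrier ?G" by simp
      let ?d = "\<lambda>y. c ((inv\<^bsub>?G\<^esub> g) y)"
      have d: "coloring E x n ?d" by (rule coloring_comp[OF c inv_closed[OF g]])
      let ?P = "{v \<in> carrier ?G. \<forall>y\<in>topspace E. ?d (v y) = ?d (g y)}"
      have Pc: "c ((inv\<^bsub>?G\<^esub> v) y) = c ((inv\<^bsub>?G\<^esub> g) y)" if v: "v \<in> ?P" and y: "y \<in> topspace E" for v y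
      proof -
        have vG: "v \<in> carrier ?G" using v by simp
        let ?z = "(inv\<^bsub>?G\<^esub> v) y"
        have z: "?z \<in> topspace E" using homeo_group_fixing_mapsto[OF inv_closed[OF vG] y] .
        have "?d (v ?z) = ?d (g ?z)" using v z by simp
        then show ?thesis
          using homeo_group_fixing_inv(2)[OF vG x y] homeo_group_fixing_inv(1)[OF g x z] by simp
      qed
      have "g \<in> ?P" using g by simp
      then show "\<exists>P. openin ?T P \<and> g \<in> P \<and> (\<forall>q\<in>P. \<forall>y\<in>topspace E. c ((inv\<^bsub>?G\<^esub> q) y) = c ((inv\<^bsub>?G\<^esub> g) y))"
        by (intro exI[of _ ?P] conjI ballI openin_preserving[OF d g] Pc)
    qed
  qed
qed

lemma maxchain_action_eq:
  "M \<in> topspace (maxchain_space_at E x) \<Longrightarrow> maxchain_action E x g M = flag_image g M"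
  by (simp add: maxchain_action_def flag_image_def)

lemma flag_image_mem:
  assumes g: "g \<in> carrier (homeo_group_fixing E x)" and x: "x \<in> topspace E"
    and M: "M \<in> topspace (maxchain_space_at E x)"
  shows "flag_image g M \<in> topspace (maxchain_space_at E x)"
proof -
  have "g ` {x} = {x}" using g by (simp add: homeo_group_fixing_carrier)
  then have "{x} \<in> M \<Longrightarrow> {x} \<in> flag_image g M" unfolding flag_image_def by (metis image_eqI)
  then show ?thesis using M maxchain_flag_image[OF g x] unfolding topspace_flags by simp
qed

lemma flags_hyperspace: "M \<in> topspace (maxchain_space_at E x) \<Longrightarrow> M \<subseteq> hyperspace E"
  unfolding topspace_flags by (simp add: subset_maxchain_iff)

lemma group_action_flags:
  assumes x: "x \<in> topspace E"
  shows "group_action (homeo_group_fixing E x) (topspace (maxchain_space_at E x)) (maxchain_action E x)"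
proof -
  let ?G = "homeo_group_fixing E x" and ?\<Phi> = "topspace (maxchain_space_at E x)" and ?a = "maxchain_action E x"
  have Bij: "?a g \<in> Bij ?\<Phi>" if g: "g \<in> carrier ?G" for g
  proof -
    obtain h where h: "h \<in> carrier ?G" "\<forall>y\<in>topspace E. h (g y) = y \<and> g (h y) = y"
      by (rule bexE[OF homeo_group_fixing_inverse[OF g x]])
    have "bij_betw (?a g) ?\<Phi> ?\<Phi>"
    proof (rule bij_betw_byWitness[of _ "?a h"])
      show "\<forall>M\<in>?\<Phi>. ?a h (?a g M) = M"
        using h flag_image_mem[OF g x] flag_image_inverse[OF flags_hyperspace, of _ x h g]
        by (simp add: maxchain_action_eq)
      show "\<forall>M\<in>?\<Phi>. ?a g (?a h M) = M"
        using h flag_image_mem[OF h(1) x] flag_image_inverse[OF flags_hyperspace, of _ x g h]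
        by (simp add: maxchain_action_eq)
      show "?a g ` ?\<Phi> \<subseteq> ?\<Phi>" "?a h ` ?\<Phi> \<subseteq> ?\<Phi>"
        using flag_image_mem[OF g x] flag_image_mem[OF h(1) x] by (auto simp: maxchain_action_eq)
    qed
    then show ?thesis by (simp add: Bij_def maxchain_action_def)
  qed
  have "group_hom ?G (BijGroup ?\<Phi>) ?a"
  proof (intro group_hom.intro group_hom_axioms.intro group_homeo_group_fixing x group_BijGroup homI)
    show "?a g \<in> carrier (BijGroup ?\<Phi>)" if "g \<in> carrier ?G" for g
      using Bij[OF that] by (simp add: BijGroup_def)
    fix g h assume g: "g \<in> carrier ?G" and h: "h \<in> carrier ?G"
    note gh = homeo_group_fixing_mult(1)[OF g h x]
    have "?a (g \<otimes>\<^bsub>?G\<^esub> h) = compose ?\<Phi> (?a g) (?a h)"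
    proof (rule extensionalityI[of _ ?\<Phi>])
      show "?a (g \<otimes>\<^bsub>?G\<^esub> h) \<in> extensional ?\<Phi>" using Bij[OF gh] by (rule Bij_imp_extensional)
      fix M assume M: "M \<in> ?\<Phi>"
      then show "?a (g \<otimes>\<^bsub>?G\<^esub> h) M = compose ?\<Phi> (?a g) (?a h) M"
        using flag_image_mem[OF h x M] flag_image_mult[OF g h x flags_hyperspace[OF M]]
        by (simp add: compose_def maxchain_action_eq)
    qed (simp add: compose_def)
    then show "?a (g \<otimes>\<^bsub>?G\<^esub> h) = ?a g \<otimes>\<^bsub>BijGroup ?\<Phi>\<^esub> ?a h"
      using Bij[OF g] Bij[OF h] by (simp add: BijGroup_def)
  qed
  then show ?thesis by (simp add: group_action_def)
qed

text \<open>
  A coloring \<open>c\<close> is natural for \<open>g M\<close> iff \<open>c g\<close> is natural for \<open>M\<close>, and \<open>c g\<close> does not change when \<open>g\<close>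
  moves slightly.
\<close>

lemma continuous_action_flags:
  assumes x: "x \<in> topspace E"
  shows "continuous_map (prod_topology (homeo_topology_fixing E x) (maxchain_space_at E x))
    (maxchain_space_at E x) (\<lambda>(g, M). maxchain_action E x g M)" (is "continuous_map ?X ?\<Phi> ?f")
  unfolding continuous_map_def
proof (intro conjI allI impI)
  let ?G = "carrier (homeo_group_fixing E x)"
  have f: "?f (g, M) = flag_image g M" if "M \<in> topspace ?\<Phi>" for g M
    using that by (simp add: maxchain_action_eq)
  show "?f \<in> topspace ?X \<rightarrow> topspace ?\<Phi>" using flag_image_mem[OF _ x] by (auto simp: maxchain_action_eq)
  fix W assume W: "openin ?\<Phi> W"
  show "openin ?X {p \<in> topspace ?X. ?f p \<in> W}"
  proof (subst openin_subopen, intro ballI)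
    fix p assume "p \<in> {p \<in> topspace ?X. ?f p \<in> W}"
    then obtain g M where p: "p = (g, M)" "g \<in> ?G" "M \<in> topspace ?\<Phi>" "flag_image g M \<in> W"
      by (auto simp: maxchain_action_eq)
    obtain n c where c: "coloring E x n c" "natural E (flag_image g M) n c"
      "\<And>N. N \<in> topspace ?\<Phi> \<Longrightarrow> natural E N n c \<Longrightarrow> N \<in> W"
      using flag_nbhd_natural[OF x W p(4)] by metis
    let ?d = "\<lambda>y. c (g y)"
    define P where "P = {v \<in> ?G. \<forall>y\<in>topspace E. c (v y) = c (g y)} \<times> {N \<in> topspace ?\<Phi>. natural E N n ?d}"
    have "openin ?X P"
      unfolding P_def openin_prod_Times_iff
      using openin_preserving[OF c(1) p(2)] openin_natural[OF coloring_comp[OF c(1) p(2)]] by simp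
    moreover have "p \<in> P"
      using p c(2) natural_flag_image[OF p(2) flags_hyperspace[OF p(3)]] by (simp add: P_def)
    moreover have "P \<subseteq> {p \<in> topspace ?X. ?f p \<in> W}"
    proof
      fix q assume "q \<in> P"
      then obtain v N where q: "q = (v, N)" "v \<in> ?G" "\<forall>y\<in>topspace E. c (v y) = c (g y)"
        "N \<in> topspace ?\<Phi>" "natural E N n ?d" by (auto simp: P_def)
      have "natural E N n (\<lambda>y. c (v y))" using q natural_cong[of E "\<lambda>y. c (v y)" ?d] by simp
      then have "natural E (flag_image v N) n c"
        using natural_flag_image[OF q(2) flags_hyperspace[OF q(4)]] by simp
      then have "flag_image v N \<in> W" by (rule c(3)[OF flag_image_mem[OF q(2) x q(4)]])
      then show "q \<in> {p \<in> topspace ?X. ?f p \<in> W}" using q by (simp add: maxchain_action_eq)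
    qed
    ultimately show "\<exists>T. openin ?X T \<and> p \<in> T \<and> T \<subseteq> {p \<in> topspace ?X. ?f p \<in> W}" by blast
  qed
qed

lemma flow_flags:
  assumes x: "x \<in> topspace E"
  shows "flow (homeo_group_fixing E x) (homeo_topology_fixing E x) (maxchain_space_at E x) (maxchain_action E x)"
  by (intro flow.intro flow_axioms.intro topological_group_homeo_fixing group_action_flags
    compact_flags Hausdorff_flags continuous_action_flags x)

end

text \<open>
  The properties of the Cantor set that the argument uses, with a marked point.
\<close>

locale pointed_cantor = perfect_stone +
  fixes x
  assumes x: "x \<in> topspace E"
    and clopen_homogeneous: "clopenin E A \<Longrightarrow> clopenin E B \<Longrightarrow> a \<in> A \<Longrightarrow> b \<in> B \<Longrightarrow>
      \<exists>f g. homeomorphic_maps (subtopology E A) (subtopology E B) f g \<and> f a = b"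
begin

abbreviation "G \<equiv> homeo_group_fixing E x"
abbreviation "\<Phi> \<equiv> maxchain_space_at E x"

text \<open>
  Corresponding pieces are homeomorphic, with \<open>x\<close> going to \<open>x\<close> in the pieces of label \<open>0\<close>; the
  homeomorphisms are glued.
\<close>

lemma coloring_transitive:
  assumes c: "coloring E x n c" and d: "coloring E x n d"
  shows "\<exists>g\<in>carrier G. \<forall>y\<in>topspace E. d (g y) = c y"
proof -
  have cl: "clopenin E (piece E c i)" "clopenin E (piece E d i)" for i
    using c d by (auto simp: coloring_def)
  have xp: "x \<in> piece E c 0" "x \<in> piece E d 0" using x c d by (auto simp: piece_def coloring_def)
  have "\<exists>f g. homeomorphic_maps (subtopology E (piece E c i)) (subtopology E (piece E d i)) f g \<and> (i = 0 \<longrightarrow> f x = x)" for i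
  proof (cases "i < n")
    case False
    then have "piece E c i = {}" "piece E d i = {}"
      using coloring_bound[OF c] coloring_bound[OF d] by (auto simp: piece_def)
    then show ?thesis by (intro exI[of _ id]) (simp add: homeomorphic_maps_def)
  next
    case True
    then have "i \<in> c ` topspace E" "i \<in> d ` topspace E" using c d by (auto simp: coloring_def)
    then obtain a0 b0 where "a0 \<in> piece E c i" "b0 \<in> piece E d i" by (auto simp: piece_def)
    then obtain a b where ab: "a \<in> piece E c i" "b \<in> piece E d i" "i = 0 \<longrightarrow> a = x \<and> b = x"
      using xp by metis
    then show ?thesis using clopen_homogeneous[OF cl ab(1,2)] by auto
  qed
  then obtain f g where fg: "\<And>i. homeomorphic_maps (subtopology E (piece E c i)) (subtopology E (piece E d i)) (f i) (g i)"
    "f 0 x = x" by metis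
  note glue = homeomorphic_maps_glue[OF _ _ fg(1)]
  define h where "h = restrict (\<lambda>y. f (c y) y) (topspace E)"
  have "homeomorphic_map E E (\<lambda>y. f (c y) y)"
    using glue(1) cl unfolding homeomorphic_map_maps clopenin_def by blast
  then have hom: "homeomorphic_map E E h" by (rule homeomorphic_map_eq) (simp add: h_def)
  have "h \<in> carrier G"
    unfolding homeo_group_fixing_carrier
  proof (intro conjI)
    show "h \<in> Bij (topspace E)"
      using homeomorphic_imp_injective_map[OF hom]
        homeomorphic_imp_surjective_map[OF hom] by (simp add: Bij_def bij_betw_def h_def)
    show "h x = x" using x fg(2) c by (simp add: h_def coloring_def)
  qed (rule hom)
  moreover have "d (h y) = c y" if "y \<in> topspace E" for y
    using glue(2)[of y] cl that unfolding clopenin_def by (simp add: h_def)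
  ultimately show ?thesis by blast
qed

text \<open>
  A neighbourhood of \<open>N\<close> asks for a coloring \<open>c\<close> to be natural. Relabelling \<open>c\<close> in the order of \<open>M\<close> gives
  a coloring with as many labels, and an element that carries it to \<open>c\<close> moves \<open>M\<close> into the neighbourhood.
\<close>

lemma orbit_dense:
  assumes M: "M \<in> topspace \<Phi>" and U: "openin \<Phi> U" and N: "N \<in> U"
  shows "\<exists>g\<in>carrier G. flag_image g M \<in> U"
proof -
  have Mm: "subset.maxchain (hyperspace E) M" "{x} \<in> M" using M unfolding topspace_flags by auto
  obtain n c where c: "coloring E x n c" "\<And>M. M \<in> topspace \<Phi> \<Longrightarrow> natural E M n c \<Longrightarrow> M \<in> U"
    using flag_nbhd_natural[OF x U N] by metis
  have im: "c ` topspace E = {..<n}" and cl: "\<And>i. clopenin E (piece E c i)" using c(1) by (auto simp: coloring_def)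
  obtain m e where e: "inj_on e (c ` topspace E)" "coloring E x m (\<lambda>y. e (c y))" "natural E M m (\<lambda>y. e (c y))"
    by (rule natural_coloring_exists[OF x Mm _ cl]) (simp_all add: im)
  have "e ` c ` topspace E = {..<m}" using e(2) by (simp add: coloring_def image_image)
  then have "m = n" using card_image[OF e(1)] im by simp
  then obtain g where g: "g \<in> carrier G" "\<forall>y\<in>topspace E. c (g y) = e (c y)"
    using coloring_transitive[of n "\<lambda>y. e (c y)" c] e(2) c(1) by blast
  have "natural E M n (\<lambda>y. c (g y))"
    using e(3) \<open>m = n\<close> natural_cong[of E "\<lambda>y. c (g y)" "\<lambda>y. e (c y)"] g(2) by simp
  then have "natural E (flag_image g M) n c" using natural_flag_image[OF g(1) flags_hyperspace[OF M]] by simp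
  then have "flag_image g M \<in> U" by (rule c(2)[OF flag_image_mem[OF g(1) x M]])
  then show ?thesis using g(1) by blast
qed

lemma minimal_flow_flags:
  "minimal_flow G (homeo_topology_fixing E x) \<Phi> (maxchain_action E x)"
proof (intro minimal_flow.intro minimal_flow_axioms.intro flow_flags x flags_nonempty)
  fix A assume A: "closedin \<Phi> A" "A \<noteq> {}" and inv: "\<And>g. g \<in> carrier G \<Longrightarrow> maxchain_action E x g ` A \<subseteq> A"
  have sub: "A \<subseteq> topspace \<Phi>" by (rule closedin_subset[OF A(1)])
  obtain M where M: "M \<in> A" "M \<in> topspace \<Phi>" using A(2) sub by blast
  show "A = topspace \<Phi>"
  proof (rule ccontr)
    assume "A \<noteq> topspace \<Phi>"
    then obtain N where "N \<in> topspace \<Phi> - A" using sub by blast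
    then obtain g where g: "g \<in> carrier G" "flag_image g M \<in> topspace \<Phi> - A"
      using orbit_dense[OF M(2), of "topspace \<Phi> - A" N] A(1) by blast
    then show False using inv[OF g(1)] M by (auto simp: maxchain_action_eq)
  qed
qed

end

section \<open>Mapping the chains onto a minimal flow\<close>

text \<open>
  What a partition has to satisfy in order to be fine enough for telling \<open>U\<close> from \<open>V\<close>.
\<close>

definition adapted :: "'a topology \<Rightarrow> 'a \<Rightarrow> (('a \<Rightarrow> 'a) \<Rightarrow> 'q \<Rightarrow> 'q) \<Rightarrow> ('a \<Rightarrow> nat) \<Rightarrow> 'q set \<Rightarrow> 'q set \<Rightarrow> bool" where
  "adapted E x \<psi> c U V \<longleftrightarrow> (\<forall>v\<in>carrier (homeo_group_fixing E x).
     (\<forall>y\<in>topspace E. c (v y) = c y) \<longrightarrow> (\<forall>z\<in>U. \<psi> v z \<notin> V))"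

text \<open>
  Substitution into words over the alphabet \<open>{0}\<close> is composition of the corresponding rigid surjections.
\<close>

lemma substitute_one_nth:
  assumes "i \<le> length f"
  shows "(0 # w) ! ((0 # f) ! i) = (0 # substitute 1 w f) ! i"
  using assms by (cases i) (auto simp: substitute_def nth_Cons')

locale cantor_flow = pointed_cantor E x + Y: minimal_flow "homeo_group_fixing E x" "homeo_topology_fixing E x" Y \<psi>
  for E :: "'a topology" and x :: 'a and Y :: "'q topology" and \<psi> :: "('a \<Rightarrow> 'a) \<Rightarrow> 'q \<Rightarrow> 'q"
begin

lemmas G_mult = homeo_group_fixing_mult[OF _ _ x]

lemma \<psi>_mem: "g \<in> carrier G \<Longrightarrow> z \<in> topspace Y \<Longrightarrow> \<psi> g z \<in> topspace Y"
  using Y.element_image by blast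

lemma \<psi>_mult: "g \<in> carrier G \<Longrightarrow> h \<in> carrier G \<Longrightarrow> z \<in> topspace Y \<Longrightarrow> \<psi> (g \<otimes>\<^bsub>G\<^esub> h) z = \<psi> g (\<psi> h z)"
  using Y.composition_rule by blast

lemma \<psi>_one: "z \<in> topspace Y \<Longrightarrow> \<psi> \<one>\<^bsub>G\<^esub> z = z"
  using Y.id_eq_one by (metis restrict_apply')

lemma continuous_\<psi>: "g \<in> carrier G \<Longrightarrow> continuous_map Y Y (\<psi> g)"
proof -
  assume g: "g \<in> carrier G"
  have "continuous_map Y (prod_topology (homeo_topology_fixing E x) Y) (\<lambda>z. (g, z))"
    using g by (intro continuous_map_pairedI) simp_all
  from continuous_map_compose[OF this Y.continuous_action] show ?thesis by (simp add: o_def)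
qed

text \<open>
  Distinct points have neighbourhoods with disjoint closures. The closure of the first is compact, so by
  the tube lemma small group elements keep it away from the closure of the second. Being adapted does not
  depend on the labels, which allows the coloring to be natural for \<open>M\<close>.
\<close>

lemma adapted_coloring_exists:
  assumes M: "M \<in> topspace \<Phi>" and y: "y1 \<in> topspace Y" "y2 \<in> topspace Y" "y1 \<noteq> y2"
  obtains n c U V where "coloring E x n c" "natural E M n c" "openin Y U" "openin Y V" "y1 \<in> U" "y2 \<in> V"
    "adapted E x \<psi> c U V"
proof -
  have Mm: "subset.maxchain (hyperspace E) M" "{x} \<in> M" using M unfolding topspace_flags by auto
  have reg: "regular_space Y" using Y.compact Y.Hausdorff by (rule compact_Hausdorff_imp_regular_space)
  have c2: "closedin Y {y2}" using closedin_Hausdorff_singleton[OF Y.Hausdorff y(2)] .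
  obtain U where U: "openin Y U" "y1 \<in> U" "disjnt {y2} (Y closure_of U)"
    using reg[unfolded regular_space, rule_format, of "{y2}" y1] c2 y by auto
  let ?D = "Y closure_of U"
  have "y2 \<in> topspace Y - ?D" using U(3) y(2) by (simp add: disjnt_def)
  then obtain V where V: "openin Y V" "y2 \<in> V" "disjnt ?D (Y closure_of V)"
    using reg[unfolded regular_space, rule_format, of ?D y2] by auto
  let ?T = "homeo_topology_fixing E x"
  define W where "W = {p \<in> topspace (prod_topology ?T Y). (\<lambda>(g, p). \<psi> g p) p \<in> topspace Y - Y closure_of V}"
  have W: "openin (prod_topology ?T Y) W"
    unfolding W_def by (rule openin_continuous_map_preimage[OF Y.continuous_action]) auto
  have UD: "U \<subseteq> ?D" by (rule closure_of_subset[OF openin_subset[OF U(1)]])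
  have VD: "V \<subseteq> Y closure_of V" by (rule closure_of_subset[OF openin_subset[OF V(1)]])
  have one: "\<one>\<^bsub>G\<^esub> \<in> carrier G" by simp
  have sub: "{\<one>\<^bsub>G\<^esub>} \<times> ?D \<subseteq> W"
  proof
    fix p assume "p \<in> {\<one>\<^bsub>G\<^esub>} \<times> ?D"
    then obtain z where z: "p = (\<one>\<^bsub>G\<^esub>, z)" "z \<in> ?D" by blast
    have zY: "z \<in> topspace Y" using z(2) closure_of_subset_topspace by fastforce
    then have "z \<in> topspace Y - Y closure_of V" using z(2) V(3) by (auto simp: disjnt_def)
    then show "p \<in> W" using z(1) zY one by (simp add: W_def \<psi>_one)
  qed
  have "compactin Y ?D" by (rule closedin_compact_space[OF Y.compact closedin_closure_of])
  from tube_lemma_right[OF W this _ sub] one obtain A B where AB: "openin ?T A" "\<one>\<^bsub>G\<^esub> \<in> A" "?D \<subseteq> B" "A \<times> B \<subseteq> W"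
    by auto
  obtain m d where d: "coloring E x m d"
    "\<And>v. v \<in> carrier G \<Longrightarrow> (\<And>y. y \<in> topspace E \<Longrightarrow> d (v y) = d (\<one>\<^bsub>G\<^esub> y)) \<Longrightarrow> v \<in> A"
    using homeo_topology_nbhd[OF x AB(1,2)] by metis
  have fin: "finite (d ` topspace E)" and cl: "\<And>i. clopenin E (piece E d i)" using d(1) by (auto simp: coloring_def)
  obtain n e where e: "inj_on e (d ` topspace E)" "coloring E x n (\<lambda>y. e (d y))" "natural E M n (\<lambda>y. e (d y))"
    by (rule natural_coloring_exists[OF x Mm fin cl])
  have "adapted E x \<psi> (\<lambda>y. e (d y)) U V"
    unfolding adapted_def
  proof (intro ballI impI)
    fix v z assume v: "v \<in> carrier G" "\<forall>y\<in>topspace E. e (d (v y)) = e (d y)" and z: "z \<in> U"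
    have "v \<in> A"
    proof (rule d(2)[OF v(1)])
      fix y assume y: "y \<in> topspace E"
      have "d (v y) = d y"
        by (rule inj_onD[OF e(1)]) (use y v homeo_group_fixing_mapsto[OF v(1) y] in auto)
      then show "d (v y) = d (\<one>\<^bsub>G\<^esub> y)" using y by (simp add: homeo_group_fixing_one)
    qed
    moreover have "z \<in> B" using z UD AB(3) by blast
    ultimately have "(v, z) \<in> W" using AB(4) by blast
    then show "\<psi> v z \<notin> V" using VD by (auto simp: W_def)
  qed
  then show thesis by (rule that[OF e(2,3) U(1) V(1) U(2) V(2)])
qed

text \<open>
  The conditions to be met by a base point \<open>z\<close> that corresponds to \<open>M\<close>: since \<open>k M\<close> and \<open>k' M\<close> induce
  the same order on the partition \<open>c\<close>, the points \<open>k z\<close> and \<open>k' z\<close> should not be separated by \<open>U\<close> and \<open>V\<close>.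
\<close>

definition "obstructions M =
  {(n, c, U, V, k, k'). coloring E x n c \<and> openin Y U \<and> openin Y V \<and> adapted E x \<psi> c U V \<and>
     k \<in> carrier G \<and> k' \<in> carrier G \<and> natural E M n (\<lambda>y. c (k y)) \<and> natural E M n (\<lambda>y. c (k' y))}"

definition "avoiding = (\<lambda>(n :: nat, c :: 'a \<Rightarrow> nat, U, V, k, k'). {z \<in> topspace Y. \<not> (\<psi> k z \<in> U \<and> \<psi> k' z \<in> V)})"

text \<open>
  The Ramsey argument. All colorings \<open>c k\<close> and \<open>c k'\<close> in question are quotients of one natural coloring
  \<open>d\<close> by rigid surjections, and the point sought is a translate of an arbitrary point of \<open>Y\<close>.
\<close>

lemma finitely_many_obstructions_avoidable:
  assumes M: "M \<in> topspace \<Phi>" and J: "finite J" "J \<subseteq> obstructions M"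
  shows "\<exists>z\<in>topspace Y. \<forall>j\<in>J. z \<in> avoiding j"
proof -
  have Mm: "subset.maxchain (hyperspace E) M" "{x} \<in> M" using M unfolding topspace_flags by auto
  (* Names for the components of an obstruction; elt selects one of its two group elements. *)
  define num where "num = (\<lambda>(n :: nat, c :: 'a \<Rightarrow> nat, U :: 'q set, V :: 'q set, k :: 'a \<Rightarrow> 'a, k' :: 'a \<Rightarrow> 'a). n)"
  define col where "col = (\<lambda>(n :: nat, c :: 'a \<Rightarrow> nat, U :: 'q set, V :: 'q set, k :: 'a \<Rightarrow> 'a, k' :: 'a \<Rightarrow> 'a). c)"
  define src where "src = (\<lambda>(n :: nat, c :: 'a \<Rightarrow> nat, U :: 'q set, V :: 'q set, k :: 'a \<Rightarrow> 'a, k' :: 'a \<Rightarrow> 'a). U)"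
  define snk where "snk = (\<lambda>(n :: nat, c :: 'a \<Rightarrow> nat, U :: 'q set, V :: 'q set, k :: 'a \<Rightarrow> 'a, k' :: 'a \<Rightarrow> 'a). V)"
  define elt where "elt = (\<lambda>(n :: nat, c :: 'a \<Rightarrow> nat, U :: 'q set, V :: 'q set, k :: 'a \<Rightarrow> 'a, k' :: 'a \<Rightarrow> 'a) b. if b then k else k')"
  note sel = num_def col_def src_def snk_def elt_def
  have J': "coloring E x (num j) (col j)" "adapted E x \<psi> (col j) (src j) (snk j)"
    "elt j b \<in> carrier G" "natural E M (num j) (\<lambda>y. col j (elt j b y))" if "j \<in> J" for j b
    using J(2) that by (auto simp: obstructions_def sel)
  have av: "z \<in> avoiding j" if "z \<in> topspace Y" "\<psi> (elt j True) z \<in> src j \<Longrightarrow> \<psi> (elt j False) z \<in> snk j \<Longrightarrow> False" for z j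
    using that by (cases j) (auto simp: avoiding_def sel)
  have col: "coloring E x (num j) (\<lambda>y. col j (elt j b y))" if "j \<in> J" for j b
    by (rule coloring_comp[OF J'(1)[OF that] J'(3)[OF that]])
  define f where "f p y = col (fst p) (elt (fst p) (snd p) y)" for p y
  have fc: "coloring E x (num (fst p)) (f p)" if "p \<in> J \<times> UNIV" for p
    using col[of "fst p" "snd p"] that by (auto simp: f_def[abs_def])
  have fin: "finite (f p ` topspace E)" and cl: "clopenin E (piece E (f p) v)" if "p \<in> J \<times> UNIV" for p v
    using fc[OF that] by (auto simp: coloring_def)
  have finJ: "finite (J \<times> (UNIV :: bool set))" using J(1) by simp
  obtain m d where d: "coloring E x m d" "natural E M m d"
    and fd: "\<forall>p\<in>J \<times> UNIV. \<exists>\<rho>. \<forall>y\<in>topspace E. f p y = \<rho> (d y)"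
    by (rule natural_coloring_of_functions[OF x Mm finJ fin cl])
  have word: "\<exists>w\<in>words 1 (num j - 1) (m - 1). \<forall>y\<in>topspace E. col j (elt j b y) = (0 # w) ! d y" if j: "j \<in> J" for j b
  proof -
    obtain \<rho> where \<rho>: "\<forall>y\<in>topspace E. f (j, b) y = \<rho> (d y)" using bspec[OF fd, of "(j, b)"] j by auto
    have "\<And>y. y \<in> topspace E \<Longrightarrow> col j (elt j b y) = \<rho> (d y)" using \<rho> by (simp add: f_def)
    then show ?thesis by (rule natural_refinement_word[OF Mm(1) x col[OF j] J'(4)[OF j] d])
  qed
  obtain js where js: "set js = J" using finite_list[OF J(1)] by blast
  define ks where "ks = map (\<lambda>j. num j - 1) js"
  obtain N where N: "\<forall>\<kappa> :: nat \<Rightarrow> nat list \<Rightarrow> bool. \<exists>f\<in>words 1 (m - 1) N.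
    \<forall>j<length ks. \<forall>g\<in>words 1 (ks ! j) (m - 1). \<forall>g'\<in>words 1 (ks ! j) (m - 1). \<kappa> j (substitute 1 g f) = \<kappa> j (substitute 1 g' f)"
    using Graham_Rothschild_simultaneous[of 1 "m - 1" ks] by auto
  obtain b where b: "coloring E x (Suc N) b" using coloring_exists[OF x] by blast
  obtain z0 where z0: "z0 \<in> topspace Y" using Y.nonempty by blast
  (* The color of the labelled partition coded by w: can it be obtained from the i-th coloring by an
     element that moves the arbitrary point z0 into the i-th source set? *)
  define \<kappa> where "\<kappa> i w \<longleftrightarrow> (\<exists>h\<in>carrier G. (\<forall>y\<in>topspace E. col (js ! i) (h y) = (0 # w) ! b y) \<and>
    \<psi> h z0 \<in> src (js ! i))" for i w
  obtain u where u: "u \<in> words 1 (m - 1) N" and mono: "\<And>i w w'. i < length ks \<Longrightarrow> w \<in> words 1 (ks ! i) (m - 1) \<Longrightarrow>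
    w' \<in> words 1 (ks ! i) (m - 1) \<Longrightarrow> \<kappa> i (substitute 1 w u) = \<kappa> i (substitute 1 w' u)"
    using N[rule_format, of \<kappa>] by blast
  have m1: "Suc (m - 1) = m" using coloring_bound[OF d(1) x] by simp
  have "coloring E x m (\<lambda>y. (0 # u) ! b y)" using coloring_word[OF b u] m1 by simp
  then obtain g where g: "g \<in> carrier G" "\<forall>y\<in>topspace E. d (g y) = (0 # u) ! b y"
    using coloring_transitive[OF _ d(1)] by blast
  have gz: "\<psi> g z0 \<in> topspace Y" by (rule \<psi>_mem[OF g(1) z0])
  show ?thesis
  proof (intro bexI[OF _ gz] ballI)
    fix j assume j: "j \<in> J"
    then obtain i where i: "i < length js" "js ! i = j" using js by (metis in_set_conv_nth)
    have ksi: "ks ! i = num j - 1" "i < length ks" using i by (simp_all add: ks_def)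
    have wd: "\<exists>w\<in>words 1 (ks ! i) (m - 1). \<forall>y\<in>topspace E. col j (elt j s (g y)) = (0 # substitute 1 w u) ! b y" for s
    proof -
      obtain w where w: "w \<in> words 1 (ks ! i) (m - 1)" "\<forall>y\<in>topspace E. col j (elt j s y) = (0 # w) ! d y"
        using word[OF j, of s] ksi by auto
      have "col j (elt j s (g y)) = (0 # substitute 1 w u) ! b y" if y: "y \<in> topspace E" for y
      proof -
        have "b y \<le> length u" using coloring_bound[OF b y] u by (simp add: words_def)
        then show ?thesis
          using w(2) homeo_group_fixing_mapsto[OF g(1) y] g(2) y substitute_one_nth[of "b y" u w] by simp
      qed
      then show ?thesis using w(1) by blast
    qed
    obtain w where w: "w \<in> words 1 (ks ! i) (m - 1)"
      "\<forall>y\<in>topspace E. col j (elt j True (g y)) = (0 # substitute 1 w u) ! b y" using wd by blast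
    obtain w' where w': "w' \<in> words 1 (ks ! i) (m - 1)"
      "\<forall>y\<in>topspace E. col j (elt j False (g y)) = (0 # substitute 1 w' u) ! b y" using wd by blast
    let ?k = "elt j True" and ?k' = "elt j False"
    have k: "?k \<in> carrier G" "?k' \<in> carrier G" using J'(3)[OF j] by auto
    show "\<psi> g z0 \<in> avoiding j"
    proof (rule av[OF gz])
      assume U: "\<psi> ?k (\<psi> g z0) \<in> src j" and V: "\<psi> ?k' (\<psi> g z0) \<in> snk j"
      have kg: "?k \<otimes>\<^bsub>G\<^esub> g \<in> carrier G" and kg': "?k' \<otimes>\<^bsub>G\<^esub> g \<in> carrier G" using k g by auto
      have "\<kappa> i (substitute 1 w u)"
        unfolding \<kappa>_def
      proof (intro bexI[OF _ kg] conjI ballI)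
        show "col (js ! i) ((?k \<otimes>\<^bsub>G\<^esub> g) y) = (0 # substitute 1 w u) ! b y" if "y \<in> topspace E" for y
          using w(2) that i(2) G_mult(2)[OF k(1) g(1) that] by simp
        show "\<psi> (?k \<otimes>\<^bsub>G\<^esub> g) z0 \<in> src (js ! i)" using U i(2) \<psi>_mult[OF k(1) g(1) z0] by simp
      qed
      then have "\<kappa> i (substitute 1 w' u)" using mono[OF ksi(2) w(1) w'(1)] by simp
      then obtain h where h: "h \<in> carrier G" "\<forall>y\<in>topspace E. col j (h y) = (0 # substitute 1 w' u) ! b y"
        "\<psi> h z0 \<in> src j" unfolding \<kappa>_def i(2) by blast
      have ih: "inv\<^bsub>G\<^esub> h \<in> carrier G" using h(1) by simp
      (* This element preserves the pieces of the coloring, because h and k' g pull it back to the same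
         labelled partition. It moves the point h z0 of the source set to k' (g z0). *)
      let ?v = "(?k' \<otimes>\<^bsub>G\<^esub> g) \<otimes>\<^bsub>G\<^esub> inv\<^bsub>G\<^esub> h"
      have v: "?v \<in> carrier G" by (rule G_mult(1)[OF kg' ih])
      have "col j (?v y) = col j y" if y: "y \<in> topspace E" for y
      proof -
        let ?t = "(inv\<^bsub>G\<^esub> h) y"
        have t: "?t \<in> topspace E" by (rule homeo_group_fixing_mapsto[OF ih y])
        have "?v y = ?k' (g ?t)" using G_mult(2)[OF kg' ih y] G_mult(2)[OF k(2) g(1) t] by simp
        then have "col j (?v y) = col j (h ?t)" using w'(2) h(2) t by simp
        then show ?thesis using homeo_group_fixing_inv(2)[OF h(1) x y] by simp
      qed
      then have "\<psi> ?v (\<psi> h z0) \<notin> snk j"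
        using J'(2)[OF j] v h(3) unfolding adapted_def by blast
      moreover have "\<psi> ?v (\<psi> h z0) = \<psi> ?k' (\<psi> g z0)"
      proof -
        have "?v \<otimes>\<^bsub>G\<^esub> h = ?k' \<otimes>\<^bsub>G\<^esub> g"
          using kg' h(1) ih by (simp add: Y.m_assoc)
        then show ?thesis using \<psi>_mult[OF v h(1) z0] \<psi>_mult[OF k(2) g(1) z0] by simp
      qed
      ultimately show False using V by simp
    qed
  qed
qed

lemma closedin_avoiding:
  assumes "j \<in> obstructions M"
  shows "closedin Y (avoiding j)"
proof -
  obtain n c U V k k' where j: "j = (n, c, U, V, k, k')" by (cases j)
  have o: "openin Y U" "openin Y V" "k \<in> carrier G" "k' \<in> carrier G"
    using assms by (auto simp: j obstructions_def)
  have "openin Y ({z \<in> topspace Y. \<psi> k z \<in> U} \<inter> {z \<in> topspace Y. \<psi> k' z \<in> V})"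
    by (rule openin_Int[OF openin_continuous_map_preimage[OF continuous_\<psi>[OF o(3)] o(1)]
      openin_continuous_map_preimage[OF continuous_\<psi>[OF o(4)] o(2)]])
  moreover have "avoiding j = topspace Y - ({z \<in> topspace Y. \<psi> k z \<in> U} \<inter> {z \<in> topspace Y. \<psi> k' z \<in> V})"
    by (auto simp: j avoiding_def)
  ultimately show ?thesis by (simp add: closedin_diff)
qed

lemma base_point_exists:
  assumes M: "M \<in> topspace \<Phi>"
  shows "\<exists>z\<in>topspace Y. \<forall>j\<in>obstructions M. z \<in> avoiding j"
proof -
  let ?U = "insert (topspace Y) (avoiding ` obstructions M)"
  have "\<Inter>\<F> \<noteq> {}" if F: "finite \<F>" "\<F> \<subseteq> ?U" for \<F>
  proof -
    have "\<F> - {topspace Y} \<subseteq> avoiding ` obstructions M" using F(2) by blast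
    then obtain J where J: "finite J" "J \<subseteq> obstructions M" "\<F> - {topspace Y} = avoiding ` J"
      using F(1) finite_subset_image[of "\<F> - {topspace Y}" avoiding "obstructions M"] by auto
    obtain z where z: "z \<in> topspace Y" "\<forall>j\<in>J. z \<in> avoiding j"
      using finitely_many_obstructions_avoidable[OF M J(1,2)] by blast
    have "z \<in> S" if "S \<in> \<F>" for S
    proof (cases "S = topspace Y")
      case False
      then have "S \<in> avoiding ` J" using that J(3) by blast
      then show ?thesis using z(2) by blast
    qed (use z in simp)
    then show ?thesis by blast
  qed
  moreover have "closedin Y C" if "C \<in> ?U" for C using that closedin_avoiding by auto
  ultimately have "\<Inter>?U \<noteq> {}"
    using Y.compact[unfolded compact_space_fip, rule_format, of ?U] by simp
  then show ?thesis by auto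
qed

text \<open>
  The closure of the orbit of \<open>(M0, z0)\<close> is closed and invariant. By the choice of \<open>z0\<close> it has at
  most one point over each chain, and by density of orbits and compactness of \<open>Y\<close> it has at least one.
\<close>

lemma flow_factor_flags: "flow_factor G \<Phi> (maxchain_action E x) Y \<psi>"
proof -
  obtain M0 where M0: "M0 \<in> topspace \<Phi>" using flags_nonempty[OF x] by blast
  obtain z0 where z0: "z0 \<in> topspace Y" "\<forall>j\<in>obstructions M0. z0 \<in> avoiding j"
    by (rule bexE[OF base_point_exists[OF M0]])
  have base: "\<not> (\<psi> k z0 \<in> U \<and> \<psi> k' z0 \<in> V)"
    if "coloring E x n c" "openin Y U" "openin Y V" "adapted E x \<psi> c U V" "k \<in> carrier G" "k' \<in> carrier G"
      "natural E M0 n (\<lambda>y. c (k y))" "natural E M0 n (\<lambda>y. c (k' y))" for n c U V k k'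
    using bspec[OF z0(2), of "(n, c, U, V, k, k')"] that by (simp add: obstructions_def avoiding_def)
  let ?P = "prod_topology \<Phi> Y"
  define S where "S = (\<lambda>k. (flag_image k M0, \<psi> k z0)) ` carrier G"
  have SP: "S \<subseteq> topspace ?P" using flag_image_mem[OF _ x M0] \<psi>_mem[OF _ z0(1)] by (auto simp: S_def)
  define \<Gamma> where "\<Gamma> = ?P closure_of S"
  have \<Gamma>cl: "closedin ?P \<Gamma>" by (simp add: \<Gamma>_def)
  have S\<Gamma>: "S \<subseteq> \<Gamma>" unfolding \<Gamma>_def by (rule closure_of_subset[OF SP])
  have \<Gamma>P: "M \<in> topspace \<Phi>" "z \<in> topspace Y" if "(M, z) \<in> \<Gamma>" for M z
    using closedin_subset[OF \<Gamma>cl] that by auto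
  have single: "z1 = z2" if z1: "(M, z1) \<in> \<Gamma>" and z2: "(M, z2) \<in> \<Gamma>" for M z1 z2
  proof (rule ccontr)
    assume ne: "z1 \<noteq> z2"
    obtain n c U V where c: "coloring E x n c" "natural E M n c" and UV: "openin Y U" "openin Y V" "z1 \<in> U" "z2 \<in> V"
      and ad: "adapted E x \<psi> c U V"
      by (rule adapted_coloring_exists[OF \<Gamma>P(1)[OF z1] \<Gamma>P(2)[OF z1] \<Gamma>P(2)[OF z2] ne])
    let ?N = "{M \<in> topspace \<Phi>. natural E M n c}"
    have near: "\<exists>k\<in>carrier G. natural E M0 n (\<lambda>y. c (k y)) \<and> \<psi> k z0 \<in> W"
      if W: "openin Y W" "z \<in> W" and z: "(M, z) \<in> \<Gamma>" for W z
    proof -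
      have "openin ?P (?N \<times> W)" using openin_natural[OF c(1)] W(1) by (simp add: openin_prod_Times_iff)
      moreover have "(M, z) \<in> ?N \<times> W" using W(2) c(2) \<Gamma>P(1)[OF z] by simp
      moreover have "\<forall>T. (M, z) \<in> T \<and> openin ?P T \<longrightarrow> (\<exists>p. p \<in> S \<and> p \<in> T)"
        using z unfolding \<Gamma>_def in_closure_of by (rule conjunct2)
      ultimately have "\<exists>p. p \<in> S \<and> p \<in> ?N \<times> W" by metis
      then obtain p where p: "p \<in> S" "p \<in> ?N \<times> W" by (elim exE conjE)
      then obtain k where k: "k \<in> carrier G" "flag_image k M0 \<in> ?N" "\<psi> k z0 \<in> W" by (auto simp: S_def)
      then have "natural E M0 n (\<lambda>y. c (k y))"
        using natural_flag_image[OF k(1) flags_hyperspace[OF M0]] by simp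
      then show ?thesis using k by blast
    qed
    obtain k where "k \<in> carrier G" "natural E M0 n (\<lambda>y. c (k y))" "\<psi> k z0 \<in> U"
      using near[OF UV(1,3) z1] by blast
    moreover obtain k' where "k' \<in> carrier G" "natural E M0 n (\<lambda>y. c (k' y))" "\<psi> k' z0 \<in> V"
      using near[OF UV(2,4) z2] by blast
    ultimately show False using base[OF c(1) UV(1,2) ad] by blast
  qed
  have proj: "closedin \<Phi> (fst ` C)" if "closedin ?P C" for C
    using closed_map_fst[OF Y.compact, of \<Phi>] that by (simp add: closed_map_def)
  have total: "\<exists>z. (M, z) \<in> \<Gamma>" if M: "M \<in> topspace \<Phi>" for M
  proof (rule ccontr)
    assume "\<not> ?thesis"
    then have far: "M \<in> topspace \<Phi> - fst ` \<Gamma>" using M by force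
    have op: "openin \<Phi> (topspace \<Phi> - fst ` \<Gamma>)" using proj[OF \<Gamma>cl] by blast
    obtain k where k: "k \<in> carrier G" "flag_image k M0 \<in> topspace \<Phi> - fst ` \<Gamma>"
      by (rule bexE[OF orbit_dense[OF M0 op far]])
    have "(flag_image k M0, \<psi> k z0) \<in> \<Gamma>" using S\<Gamma> k(1) by (auto simp: S_def)
    then show False using k(2) by force
  qed
  have inv: "(flag_image g M, \<psi> g z) \<in> \<Gamma>" if g: "g \<in> carrier G" and Mz: "(M, z) \<in> \<Gamma>" for g M z
  proof -
    let ?h = "\<lambda>(M, z). (maxchain_action E x g M, \<psi> g z)"
    have "continuous_map \<Phi> (prod_topology (homeo_topology_fixing E x) \<Phi>) (\<lambda>M. (g, M))"
      using g by (intro continuous_map_pairedI) simp_all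
    from continuous_map_compose[OF this continuous_action_flags[OF x]]
    have "continuous_map \<Phi> \<Phi> (maxchain_action E x g)" by (simp add: o_def)
    then have "continuous_map ?P ?P ?h"
      using continuous_\<psi>[OF g] by (simp add: continuous_map_prod_top)
    then have "?h ` \<Gamma> \<subseteq> ?P closure_of (?h ` S)" unfolding \<Gamma>_def by (rule continuous_map_image_closure_subset)
    also have "?h ` S \<subseteq> S"
    proof
      fix p assume "p \<in> ?h ` S"
      then obtain k where k: "k \<in> carrier G" "p = ?h (flag_image k M0, \<psi> k z0)" by (auto simp: S_def)
      have "p = (flag_image (g \<otimes>\<^bsub>G\<^esub> k) M0, \<psi> (g \<otimes>\<^bsub>G\<^esub> k) z0)"
        using k flag_image_mem[OF k(1) x M0] flag_image_mult[OF g k(1) x flags_hyperspace[OF M0]]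
          \<psi>_mult[OF g k(1) z0(1)] by (simp add: maxchain_action_eq)
      then show "p \<in> S" using G_mult(1)[OF g k(1)] by (auto simp: S_def)
    qed
    then have "?P closure_of (?h ` S) \<subseteq> \<Gamma>" unfolding \<Gamma>_def by (rule closure_of_mono)
    finally have "?h (M, z) \<in> \<Gamma>" using Mz by blast
    then show ?thesis using \<Gamma>P(1)[OF Mz] by (simp add: maxchain_action_eq)
  qed
  define \<pi> where "\<pi> M = (THE z. (M, z) \<in> \<Gamma>)" for M
  have \<pi>: "(M, z) \<in> \<Gamma> \<longleftrightarrow> z = \<pi> M" if M: "M \<in> topspace \<Phi>" for M z
  proof -
    obtain z' where z': "(M, z') \<in> \<Gamma>" using total[OF M] by blast
    have \<pi>z: "\<pi> M = z'" unfolding \<pi>_def by (rule the_equality, rule z', rule single[OF _ z'])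
    show ?thesis
    proof
      assume "(M, z) \<in> \<Gamma>"
      from single[OF this z'] show "z = \<pi> M" by (simp add: \<pi>z)
    next
      assume "z = \<pi> M"
      then show "(M, z) \<in> \<Gamma>" using z' by (simp add: \<pi>z)
    qed
  qed
  have \<pi>Y: "\<pi> M \<in> topspace Y" if "M \<in> topspace \<Phi>" for M using \<Gamma>P(2)[of M "\<pi> M"] \<pi>[OF that] by simp
  have equiv: "\<pi> (maxchain_action E x g M) = \<psi> g (\<pi> M)" if "g \<in> carrier G" "M \<in> topspace \<Phi>" for g M
  proof -
    have "(flag_image g M, \<psi> g (\<pi> M)) \<in> \<Gamma>" using inv[OF that(1)] \<pi>[OF that(2)] by simp
    then show ?thesis using \<pi>[OF flag_image_mem[OF that(1) x that(2)]] that(2) by (simp add: maxchain_action_eq)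
  qed
  have cont: "continuous_map \<Phi> Y \<pi>"
    unfolding continuous_map_closedin
  proof (intro conjI allI impI)
    show "\<pi> \<in> topspace \<Phi> \<rightarrow> topspace Y" using \<pi>Y by blast
    fix C assume C: "closedin Y C"
    have "closedin ?P (\<Gamma> \<inter> (topspace \<Phi> \<times> C))"
      using \<Gamma>cl C by (intro closedin_Int) (simp_all add: closedin_prod_Times_iff)
    from proj[OF this] have "closedin \<Phi> (fst ` (\<Gamma> \<inter> (topspace \<Phi> \<times> C)))" .
    moreover have "fst ` (\<Gamma> \<inter> (topspace \<Phi> \<times> C)) = {M \<in> topspace \<Phi>. \<pi> M \<in> C}"
    proof (rule equalityI; rule subsetI)
      fix M assume "M \<in> fst ` (\<Gamma> \<inter> (topspace \<Phi> \<times> C))"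
      then obtain z where "(M, z) \<in> \<Gamma>" "M \<in> topspace \<Phi>" "z \<in> C" by auto
      then show "M \<in> {M \<in> topspace \<Phi>. \<pi> M \<in> C}" using \<pi> by simp
    next
      fix M assume "M \<in> {M \<in> topspace \<Phi>. \<pi> M \<in> C}"
      then have "(M, \<pi> M) \<in> \<Gamma> \<inter> (topspace \<Phi> \<times> C)" using \<pi> by simp
      then show "M \<in> fst ` (\<Gamma> \<inter> (topspace \<Phi> \<times> C))" by (metis fst_conv image_eqI)
    qed
    ultimately show "closedin \<Phi> {M \<in> topspace \<Phi>. \<pi> M \<in> C}" by simp
  qed
  have "\<pi> ` topspace \<Phi> = topspace Y"
  proof (rule Y.minimal)
    have "compactin \<Phi> (topspace \<Phi>)" using compact_flags[OF x] by (simp add: compact_space_def)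
    then have "compactin Y (\<pi> ` topspace \<Phi>)" by (rule image_compactin[OF _ cont])
    then show "closedin Y (\<pi> ` topspace \<Phi>)" by (rule compactin_imp_closedin[OF Y.Hausdorff])
    show "\<pi> ` topspace \<Phi> \<noteq> {}" using M0 by blast
    fix g assume g: "g \<in> carrier G"
    show "\<psi> g ` \<pi> ` topspace \<Phi> \<subseteq> \<pi> ` topspace \<Phi>"
    proof
      fix z assume "z \<in> \<psi> g ` \<pi> ` topspace \<Phi>"
      then obtain M where M: "M \<in> topspace \<Phi>" "z = \<psi> g (\<pi> M)" by blast
      then have "z = \<pi> (flag_image g M)" using equiv[OF g M(1)] by (simp add: maxchain_action_eq)
      then show "z \<in> \<pi> ` topspace \<Phi>" using flag_image_mem[OF g x M(1)] by blast
    qed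
  qed
  then show ?thesis unfolding flow_factor_def using cont equiv by blast
qed

end

section \<open>The Cantor space\<close>

definition pointed_homeomorphic :: "'a topology \<Rightarrow> 'a \<Rightarrow> 'b topology \<Rightarrow> 'b \<Rightarrow> bool" where
  "pointed_homeomorphic X a Y b \<longleftrightarrow> (\<exists>f g. homeomorphic_maps X Y f g \<and> f a = b)"

lemma pointed_homeomorphic_trans:
  assumes "pointed_homeomorphic X a Y b" "pointed_homeomorphic Y b Z c"
  shows "pointed_homeomorphic X a Z c"
proof -
  obtain f g where 1: "homeomorphic_maps X Y f g" "f a = b"
    using assms(1) unfolding pointed_homeomorphic_def by (elim exE conjE)
  obtain f' g' where 2: "homeomorphic_maps Y Z f' g'" "f' b = c"
    using assms(2) unfolding pointed_homeomorphic_def by (elim exE conjE)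
  show ?thesis
    unfolding pointed_homeomorphic_def
    by (rule exI[of _ "f' \<circ> f"], rule exI[of _ "g \<circ> g'"])
      (use homeomorphic_maps_compose[OF conjI[OF 1(1) 2(1)]] 1(2) 2(2) in simp)
qed

lemma pointed_homeomorphic_sym:
  assumes "pointed_homeomorphic X a Y b" "a \<in> topspace X"
  shows "pointed_homeomorphic Y b X a"
proof -
  obtain f g where fg: "homeomorphic_maps X Y f g" "f a = b"
    using assms(1) unfolding pointed_homeomorphic_def by (elim exE conjE)
  have "g b = a" using fg assms(2) by (auto simp: homeomorphic_maps_def)
  moreover have "homeomorphic_maps Y X g f" by (rule homeomorphic_maps_sym[THEN iffD1, OF fg(1)])
  ultimately show ?thesis unfolding pointed_homeomorphic_def by blast
qed

lemma topspace_cantor [simp]: "topspace cantor_space = UNIV"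
  by (simp add: cantor_space_def)

lemma continuous_map_into_cantor:
  "continuous_map X cantor_space f \<longleftrightarrow> (\<forall>i. continuous_map X (discrete_topology UNIV) (\<lambda>y. f y i))"
  by (simp add: cantor_space_def continuous_map_componentwise_UNIV)

lemma continuous_map_cantor_coordinate:
  "continuous_map cantor_space (discrete_topology UNIV) (\<lambda>y. h (y i))"
proof -
  have "continuous_map cantor_space (discrete_topology UNIV) (\<lambda>y. y i)"
    unfolding cantor_space_def by (rule continuous_map_product_projection) simp
  from continuous_map_compose[OF this, of "discrete_topology UNIV" h] show ?thesis
    by (simp add: o_def)
qed

lemma clopenin_cantor_coordinate: "clopenin cantor_space {y. y i = b}"
proof -
  have "clopenin (discrete_topology UNIV) {b}" by (simp add: clopenin_def)
  from clopenin_vimage[OF continuous_map_cantor_coordinate[of id i] this] show ?thesis by simp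
qed

definition cylinder :: "(nat \<Rightarrow> bool) \<Rightarrow> nat \<Rightarrow> (nat \<Rightarrow> bool) set" where
  "cylinder y L = {z. \<forall>i<L. z i = y i}"

lemma clopenin_cylinder: "clopenin cantor_space (cylinder y L)"
proof -
  have "cylinder y L = topspace cantor_space \<inter> (\<Inter>i\<in>{..<L}. {z. z i = y i})"
    by (auto simp: cylinder_def)
  then show ?thesis
    using clopenin_INT[of "{..<L}" cantor_space "\<lambda>i. {z. z i = y i}"] clopenin_cantor_coordinate by simp
qed

lemma cylinder_nbhd:
  assumes "openin cantor_space U" "y \<in> U"
  shows "\<exists>L. cylinder y L \<subseteq> U"
proof -
  obtain V where V: "finite {i. V i \<noteq> (UNIV :: bool set)}" "y \<in> Pi\<^sub>E UNIV V" "Pi\<^sub>E UNIV V \<subseteq> U"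
    using assms unfolding cantor_space_def openin_product_topology_alt by auto
  obtain L where L: "\<forall>i\<in>{i. V i \<noteq> UNIV}. i < L" using V(1) finite_nat_set_iff_bounded by blast
  have "cylinder y L \<subseteq> Pi\<^sub>E UNIV V"
  proof
    fix z assume z: "z \<in> cylinder y L"
    have "z i \<in> V i" for i
    proof (cases "V i = UNIV")
      case False
      then have "z i = y i" using L z by (simp add: cylinder_def)
      then show ?thesis using V(2) by (simp add: PiE_iff)
    qed simp
    then show "z \<in> Pi\<^sub>E UNIV V" by (simp add: PiE_iff)
  qed
  then show ?thesis using V(3) by blast
qed

lemma compact_cantor: "compact_space cantor_space"
  by (simp add: cantor_space_def compact_space_product_topology compact_space_discrete_topology)

lemma Hausdorff_cantor: "Hausdorff_space cantor_space"
  by (simp add: cantor_space_def Hausdorff_space_product_topology Hausdorff_space_discrete_topology)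

text \<open>
  By compactness, finitely many cylinders that are contained in \<open>A\<close> or disjoint from it cover the space.
\<close>

lemma clopen_cantor_finite_depth:
  assumes A: "clopenin cantor_space A"
  obtains L where "\<And>y z. (\<And>i. i < L \<Longrightarrow> y i = z i) \<Longrightarrow> y \<in> A \<longleftrightarrow> z \<in> A"
proof -
  define S where "S = {(y, L). cylinder y L \<subseteq> A \<or> cylinder y L \<subseteq> - A}"
  have oA: "openin cantor_space A" "openin cantor_space (- A)"
    using A openin_diff[of cantor_space UNIV A] openin_topspace[of cantor_space]
    by (simp_all add: clopenin_def Compl_eq_Diff_UNIV)
  have "\<exists>\<F>. finite \<F> \<and> \<F> \<subseteq> (\<lambda>(y, L). cylinder y L) ` S \<and> topspace cantor_space \<subseteq> \<Union>\<F>"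
  proof (rule compactinD)
    show "compactin cantor_space (topspace cantor_space)"
      using compact_cantor by (simp add: compact_space_def)
    show "openin cantor_space U" if "U \<in> (\<lambda>(y, L). cylinder y L) ` S" for U
      using that clopenin_cylinder by (auto simp: clopenin_def)
    show "topspace cantor_space \<subseteq> \<Union>((\<lambda>(y, L). cylinder y L) ` S)"
    proof
      fix y :: "nat \<Rightarrow> bool"
      have "\<exists>L. (y, L) \<in> S"
      proof (cases "y \<in> A")
        case True
        then show ?thesis using cylinder_nbhd[OF oA(1)] by (simp add: S_def) blast
      next
        case False
        then show ?thesis using cylinder_nbhd[OF oA(2), of y] by (simp add: S_def) blast
      qed
      then obtain L where "(y, L) \<in> S" by blast
      moreover have "y \<in> cylinder y L" by (simp add: cylinder_def)
      ultimately show "y \<in> \<Union>((\<lambda>(y, L). cylinder y L) ` S)" by force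
    qed
  qed
  then obtain \<F> where \<F>: "finite \<F>" "\<F> \<subseteq> (\<lambda>(y, L). cylinder y L) ` S" "UNIV \<subseteq> \<Union>\<F>" by auto
  obtain P where P: "finite P" "P \<subseteq> S" "\<F> = (\<lambda>(y, L). cylinder y L) ` P"
    using finite_subset_image[OF \<F>(1,2)] by blast
  obtain L where L: "\<forall>n\<in>snd ` P. n < L" using P(1) finite_nat_set_iff_bounded[of "snd ` P"] by auto
  have imp: "z \<in> A" if yz: "\<And>i. i < L \<Longrightarrow> y i = z i" and y: "y \<in> A" for y z
  proof -
    have "y \<in> \<Union>((\<lambda>(y, L). cylinder y L) ` P)" using \<F>(3) P(3) by blast
    then obtain u n where u: "(u, n) \<in> P" "y \<in> cylinder u n" by auto
    have "n < L" using L u(1) by force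
    then have "z \<in> cylinder u n" using u(2) yz by (auto simp: cylinder_def)
    moreover have "cylinder u n \<subseteq> A \<or> cylinder u n \<subseteq> - A" using P(2) u(1) by (auto simp: S_def)
    ultimately show ?thesis using u(2) y by blast
  qed
  show thesis
  proof (rule that[of L])
    fix y z :: "nat \<Rightarrow> bool" assume *: "\<And>i. i < L \<Longrightarrow> y i = z i"
    show "y \<in> A \<longleftrightarrow> z \<in> A" using imp[of y z] imp[of z y] * by auto
  qed
qed

lemma cantor_homogeneous: "pointed_homeomorphic cantor_space a cantor_space b"
proof -
  (* Translation by a + b in the group of binary sequences. *)
  let ?f = "\<lambda>y i. if a i = b i then y i else \<not> y i"
  have "continuous_map cantor_space cantor_space ?f"
    unfolding continuous_map_into_cantor
  proof
    fix i
    show "continuous_map cantor_space (discrete_topology UNIV) (\<lambda>y. ?f y i)"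
      by (rule continuous_map_cantor_coordinate[of "\<lambda>v. if a i = b i then v else \<not> v" i])
  qed
  then have "homeomorphic_maps cantor_space cantor_space ?f ?f"
    by (auto simp: homeomorphic_maps_def)
  moreover have "?f a = b" by auto
  ultimately show ?thesis unfolding pointed_homeomorphic_def by blast
qed

definition tail_seq :: "(nat \<Rightarrow> bool) \<Rightarrow> nat \<Rightarrow> bool" where
  "tail_seq y = (\<lambda>i. y (Suc i))"

definition cons_seq :: "bool \<Rightarrow> (nat \<Rightarrow> bool) \<Rightarrow> nat \<Rightarrow> bool" where
  "cons_seq v y = case_nat v y"

lemma tail_cons [simp]: "tail_seq (cons_seq v y) = y"
  by (simp add: tail_seq_def cons_seq_def)

lemma cons_tail: "y 0 = v \<Longrightarrow> cons_seq v (tail_seq y) = y"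
  by (auto simp: tail_seq_def cons_seq_def fun_eq_iff split: nat.split)

lemma cons_0 [simp]: "cons_seq v y 0 = v"
  by (simp add: cons_seq_def)

lemma tail_homeomorphic:
  "homeomorphic_maps (subtopology cantor_space {y. y 0 = v \<and> tail_seq y \<in> D}) (subtopology cantor_space D)
    tail_seq (cons_seq v)"
proof -
  have t: "continuous_map cantor_space cantor_space tail_seq"
    unfolding continuous_map_into_cantor tail_seq_def
    using continuous_map_cantor_coordinate[of id] by simp
  have "continuous_map cantor_space (discrete_topology UNIV) (\<lambda>y. cons_seq v y i)" for i
    using continuous_map_cantor_coordinate[of id] by (cases i) (simp_all add: cons_seq_def)
  then have c: "continuous_map cantor_space cantor_space (cons_seq v)"
    unfolding continuous_map_into_cantor by blast
  show ?thesis
    unfolding homeomorphic_maps_def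
    using t c by (auto simp: continuous_map_in_subtopology cons_tail intro: continuous_map_from_subtopology)
qed

text \<open>
  Split by the first coordinate. The part of \<open>A\<close> in either half is, if nonempty, a copy of a set of
  smaller depth, hence of the whole space. If both parts are nonempty, they are glued, since the whole
  space is the union of two copies of itself.
\<close>

lemma finite_depth_homeomorphic:
  assumes "\<And>y z. (\<And>i. i < L \<Longrightarrow> y i = z i) \<Longrightarrow> y \<in> A \<longleftrightarrow> z \<in> A" and "a \<in> A"
  shows "pointed_homeomorphic (subtopology cantor_space A) a cantor_space b"
  using assms
proof (induction L arbitrary: A a b)
  case 0
  have "A = UNIV" using 0 by blast
  then show ?case using cantor_homogeneous by simp
next
  case (Suc L A a b)
  define S where "S v = {z. cons_seq v z \<in> A}" for v
  have depth: "y \<in> S v \<longleftrightarrow> z \<in> S v" if yz: "\<And>i. i < L \<Longrightarrow> y i = z i" for y z v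
  proof -
    have "cons_seq v y i = cons_seq v z i" if "i < Suc L" for i
      using that yz by (cases i) (simp_all add: cons_seq_def)
    from Suc.prems(1)[OF this] show ?thesis by (simp add: S_def)
  qed
  have half: "{y. y 0 = v \<and> tail_seq y \<in> S v} = {y \<in> A. y 0 = v}" for v
    by (auto simp: S_def cons_tail)
  have S: "pointed_homeomorphic (subtopology cantor_space {y \<in> A. y 0 = v}) y cantor_space z"
    if y: "y \<in> A" "y 0 = v" for v y z
  proof (rule pointed_homeomorphic_trans)
    show "pointed_homeomorphic (subtopology cantor_space {y \<in> A. y 0 = v}) y
      (subtopology cantor_space (S v)) (tail_seq y)"
      using tail_homeomorphic[of v "S v"] unfolding half pointed_homeomorphic_def by blast
    have "tail_seq y \<in> S v" using y by (simp add: S_def cons_tail)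
    then show "pointed_homeomorphic (subtopology cantor_space (S v)) (tail_seq y) cantor_space z"
      using Suc.IH[of "S v" "tail_seq y" z] depth by blast
  qed
  have full: "{y. y 0 = v \<and> tail_seq y \<in> UNIV} = {y. y 0 = v}" for v :: bool by simp
  have T: "pointed_homeomorphic cantor_space z (subtopology cantor_space {y. y 0 = v}) (cons_seq v z)" for v z
    using tail_homeomorphic[of v UNIV] unfolding full pointed_homeomorphic_def
    by (metis homeomorphic_maps_sym subtopology_UNIV)
  show ?case
  proof (cases "\<exists>a'\<in>A. a' 0 \<noteq> a 0")
    case False
    then have "{y \<in> A. y 0 = a 0} = A" by blast
    then show ?thesis using S[OF Suc.prems(2) refl, of b] by simp
  next
    case True
    then obtain a' where a': "a' \<in> A" "a' 0 = (\<not> a 0)" by blast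
    let ?X = "subtopology cantor_space A"
    let ?h = "\<lambda>y :: nat \<Rightarrow> bool. y 0"
    have pX: "piece ?X ?h v = {y \<in> A. y 0 = v}" and pY: "piece cantor_space ?h v = {y. y 0 = v}" for v
      by (auto simp: piece_def)
    have sub: "subtopology ?X {y \<in> A. y 0 = v} = subtopology cantor_space {y \<in> A. y 0 = v}" for v
      by (simp add: subtopology_subtopology Int_absorb1 Collect_subset Int_def conj_left_absorb)
    have ex: "\<exists>f g. homeomorphic_maps (subtopology ?X (piece ?X ?h v)) (subtopology cantor_space (piece cantor_space ?h v)) f g" for v
    proof -
      obtain y where y: "y \<in> A" "y 0 = v" using a' Suc.prems(2) by (metis (full_types))
      from pointed_homeomorphic_trans[OF S[OF y] T[of y v]]
      have "pointed_homeomorphic (subtopology cantor_space {y \<in> A. y 0 = v}) y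
        (subtopology cantor_space {y. y 0 = v}) (cons_seq v y)" .
      then show ?thesis unfolding pX pY sub pointed_homeomorphic_def by (elim exE conjE) (intro exI)
    qed
    obtain f g where fg: "\<And>v. homeomorphic_maps (subtopology ?X (piece ?X ?h v)) (subtopology cantor_space (piece cantor_space ?h v)) (f v) (g v)"
      using ex by metis
    have oY: "openin cantor_space (piece cantor_space ?h v)" for v
      unfolding pY using clopenin_cantor_coordinate by (simp add: clopenin_def)
    have oX: "openin ?X (piece ?X ?h v)" for v
    proof -
      have "piece ?X ?h v = piece cantor_space ?h v \<inter> A" by (auto simp: piece_def)
      then show ?thesis using oY by (auto simp: openin_subtopology)
    qed
    from homeomorphic_maps_glue(1)[OF oX oY fg]
    have "pointed_homeomorphic ?X a cantor_space (f (a 0) a)"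
      unfolding pointed_homeomorphic_def by blast
    then show ?thesis using cantor_homogeneous by (rule pointed_homeomorphic_trans)
  qed
qed

lemma clopen_cantor_homeomorphic:
  assumes "clopenin cantor_space A" "a \<in> A"
  shows "pointed_homeomorphic (subtopology cantor_space A) a cantor_space b"
proof -
  obtain L where "\<And>y z. (\<And>i. i < L \<Longrightarrow> y i = z i) \<Longrightarrow> y \<in> A \<longleftrightarrow> z \<in> A"
    using clopen_cantor_finite_depth[OF assms(1)] by metis
  then show ?thesis using assms(2) by (rule finite_depth_homeomorphic)
qed

lemma pointed_cantor_if_homeomorphic:
  assumes E: "E homeomorphic_space cantor_space" and x: "x \<in> topspace E"
  shows "pointed_cantor E x"
proof -
  obtain \<phi> \<gamma> where hom: "homeomorphic_maps E cantor_space \<phi> \<gamma>"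
    using E unfolding homeomorphic_space_def by (elim exE)
  have \<phi>: "homeomorphic_map E cantor_space \<phi>" and \<gamma>\<phi>: "\<And>y. y \<in> topspace E \<Longrightarrow> \<gamma> (\<phi> y) = y"
    and \<phi>\<gamma>: "\<And>y. \<phi> (\<gamma> y) = y" and \<gamma>E: "\<And>y. \<gamma> y \<in> topspace E"
    using hom homeomorphic_maps_map[of E cantor_space \<phi> \<gamma>]
    by (auto simp: homeomorphic_maps_def continuous_map_def)
  have c\<phi>: "continuous_map E cantor_space \<phi>" using \<phi> by (rule homeomorphic_imp_continuous_map)
  have nbhd: "\<exists>L. \<forall>z\<in>topspace E. \<phi> z \<in> cylinder (\<phi> y) L \<longrightarrow> z \<in> U" if U: "openin E U" "y \<in> U" for U y
  proof -
    have "openin cantor_space (\<phi> ` U)"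
      using homeomorphic_map_openness[OF \<phi> openin_subset[OF U(1)]] U(1) by simp
    then obtain L where L: "cylinder (\<phi> y) L \<subseteq> \<phi> ` U" using cylinder_nbhd U(2) by blast
    have "z \<in> U" if z: "z \<in> topspace E" "\<phi> z \<in> cylinder (\<phi> y) L" for z
    proof -
      obtain u where u: "u \<in> U" "\<phi> z = \<phi> u" using L z(2) by blast
      then have "z = u" using \<gamma>\<phi>[OF z(1)] \<gamma>\<phi>[of u] openin_subset[OF U(1)] by auto
      then show ?thesis using u by simp
    qed
    then show ?thesis by blast
  qed
  have image: "pointed_homeomorphic (subtopology E A) a cantor_space b" if A: "clopenin E A" "a \<in> A" for A a b
  proof (rule pointed_homeomorphic_trans)
    have AE: "A \<subseteq> topspace E" using A(1) by (rule clopenin_subset)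
    have "homeomorphic_maps (subtopology E A) (subtopology cantor_space (\<phi> ` A)) \<phi> \<gamma>"
      by (rule homeomorphic_maps_subtopologies[OF hom]) (use AE in \<open>simp add: Int_absorb1\<close>)
    then show "pointed_homeomorphic (subtopology E A) a (subtopology cantor_space (\<phi> ` A)) (\<phi> a)"
      unfolding pointed_homeomorphic_def by blast
    have "clopenin cantor_space (\<phi> ` A)"
      using A(1) homeomorphic_map_openness[OF \<phi> AE] homeomorphic_map_closedness[OF \<phi> AE] by (simp add: clopenin_def)
    then show "pointed_homeomorphic (subtopology cantor_space (\<phi> ` A)) (\<phi> a) cantor_space b"
      by (rule clopen_cantor_homeomorphic) (use A(2) in simp)
  qed
  show ?thesis
  proof
    show "compact_space E" using homeomorphic_compact_space[OF E] compact_cantor by simp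
    show "Hausdorff_space E" using homeomorphic_Hausdorff_space[OF E] Hausdorff_cantor by simp
    show "x \<in> topspace E" by (rule x)
    show "\<exists>A. clopenin E A \<and> y \<in> A \<and> A \<subseteq> U" if U: "openin E U" "y \<in> U" for U y
    proof -
      obtain L where L: "\<forall>z\<in>topspace E. \<phi> z \<in> cylinder (\<phi> y) L \<longrightarrow> z \<in> U" using nbhd[OF U] by blast
      let ?A = "{z \<in> topspace E. \<phi> z \<in> cylinder (\<phi> y) L}"
      have "clopenin E ?A" by (rule clopenin_vimage[OF c\<phi> clopenin_cylinder])
      moreover have "y \<in> ?A" using U openin_subset[OF U(1)] by (auto simp: cylinder_def)
      moreover have "?A \<subseteq> U" using L by blast
      ultimately show ?thesis by blast
    qed
    show "\<exists>z\<in>U. z \<noteq> y" if U: "openin E U" "y \<in> U" for U y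
    proof -
      obtain L where L: "\<forall>z\<in>topspace E. \<phi> z \<in> cylinder (\<phi> y) L \<longrightarrow> z \<in> U" using nbhd[OF U] by blast
      let ?z = "(\<phi> y)(L := \<not> \<phi> y L)"
      have "?z \<in> cylinder (\<phi> y) L" by (simp add: cylinder_def)
      then have "\<gamma> ?z \<in> U" using L \<gamma>E \<phi>\<gamma> by simp
      moreover have "\<gamma> ?z \<noteq> y"
      proof
        assume "\<gamma> ?z = y"
        then have "?z = \<phi> y" using \<phi>\<gamma>[of ?z] by simp
        then have "?z L = \<phi> y L" by (rule fun_cong)
        then show False by simp
      qed
      ultimately show ?thesis by blast
    qed
    show "\<exists>f g. homeomorphic_maps (subtopology E A) (subtopology E B) f g \<and> f a = b"
      if A: "clopenin E A" "clopenin E B" "a \<in> A" "b \<in> B" for A B a b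
    proof -
      let ?p = "\<lambda>_ :: nat. False"
      have B: "b \<in> topspace (subtopology E B)" using A(4) clopenin_subset[OF A(2)] by auto
      from pointed_homeomorphic_trans[OF image[OF A(1,3), of ?p]
          pointed_homeomorphic_sym[OF image[OF A(2,4), of ?p] B]]
      show ?thesis unfolding pointed_homeomorphic_def .
    qed
  qed
qed

section \<open>The universal minimal flow\<close>

theorem theorem11:
  fixes E :: "'a topology" and x :: 'a
  assumes "E homeomorphic_space cantor_space"
    and "x \<in> topspace E"
  shows "universal_minimal_flow TYPE('q)
    (homeo_group_fixing E x) (homeo_topology_fixing E x)
    (maxchain_space_at E x) (maxchain_action E x)"
proof -
  interpret pointed_cantor E x
    by (rule pointed_cantor_if_homeomorphic[OF assms])
  show ?thesis
    unfolding universal_minimal_flow_def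
  proof (intro conjI allI impI minimal_flow_flags)
    fix Y :: "'q topology" and \<psi>
    assume "minimal_flow (homeo_group_fixing E x) (homeo_topology_fixing E x) Y \<psi>"
    then interpret cantor_flow E x Y \<psi>
      by (intro cantor_flow.intro pointed_cantor_axioms)
    show "flow_factor (homeo_group_fixing E x) (maxchain_space_at E x) (maxchain_action E x) Y \<psi>"
      by (rule flow_factor_flags)
  qed
qed

end
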